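(* Let $\mathbb{T}$ be a time scale with $\min\mathbb{T}=0$ and $\max\mathbb{T}=T\in(0,\infty)$, let $(\Omega,\mathcal{F},(\mathcal{F}_t)_{t\in\mathbb{T}},\mathbf{P})$ be a filtered probability space satisfying the usual conditions, and let $W=(W_t)_{t\in\mathbb{T}}$ be a $d$-dimensional $(\mathcal{F}_t)$-Brownian motion on $\mathbb{T}$. Let $k\ge 1$. For every $M\in\mathcal{M}^{2}_{\mathbb{T},k}$ with $M_0=0$ $\mathbf{P}$-a.s., there is a decomposition $$M_t=I_t(X)+N_t,\qquad \forall t\in\mathbb{T},$$ where $X\in\mathcal{L}^2_{\mathbb{T},k\times d}$, so that $I(X)\in\mathcal{M}^{2,*}_{\mathbb{T},k}$, $N\in\mathcal{M}^{2}_{\mathbb{T},k}$ with $N_0=0$, and $N$ is orthogonal to every element of $\mathcal{M}^{2,*}_{\mathbb{T},k}$.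
   Context: A time scale $\mathbb{T}$ is a nonempty closed subset of $\mathbf{R}$. Here $0=\min\mathbb{T}$, $T=\max\mathbb{T}<\infty$. Write $\sigma(t)=\inf\{s\in\mathbb{T}:s>t\}$ and $\rho(t)=\sup\{s\in\mathbb{T}:s<t\}$, with $\rho(0)=0$; $t$ is right-dense if $\sigma(t)=t$ (left-dense if $\rho(t)=t$) and right-scattered if $\sigma(t)>t$ (left-scattered if $\rho(t)<t$). Intervals are intersected with $\mathbb{T}$. $\int_s^t f_u\nabla u$ is the integral of $f$ over $(s,t]\cap\mathbb{T}$ with respect to the Lebesgue $\nabla$-measure, i.e. the Borel measure on $(0,T]\cap\mathbb{T}$ with mass $b-a$ on $(a,b]\cap\mathbb{T}$ for $a<b$ in $\mathbb{T}$. Usual conditions: the filtration is complete, and right-continuous at right-dense points (nothing is required at right-scattered points). A $d$-dimensional $(\mathcal{F}_t)$-Brownian motion on $\mathbb{T}$ is an adapted $\mathbf{R}^d$-valued process, continuous on $\mathbb{T}$, with $W_0=0$, such that for $s<t$ in $\mathbb{T}$ the increment $W_t-W_s$ is independent of $\mathcal{F}_s$ and Gaussian with mean $0$ and covariance $(t-s)\mathrm{Id}$. A process on $\mathbb{T}$ is predictable if it is measurable for the $\sigma$-algebra generated by the sets $((s,t]\cap\mathbb{T})\times A$, $s<t$ in $\mathbb{T}$, $A\in\mathcal{F}_s$. $\mathcal{M}^2_{\mathbb{T},k}$ is the space of $\mathbf{R}^k$-valued $(\mathcal{F}_t)_{t\in\mathbb{T}}$-martingales $M$ with $E[\sup_{t\in\mathbb{T}}|M_t|^2]<\infty$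 (right-continuous modifications are taken). $\mathcal{L}^2_{\mathbb{T},k\times d}$ is the space of predictable $\mathbf{R}^{k\times d}$-valued processes $X$ with $E\int_0^T|X_s|^2\nabla s<\infty$, where $|z|=\sqrt{\mathrm{tr}(zz^{T})}$. For such $X$, $I_t(X)=\int_0^tX_s\nabla W_s$ is the Itô-type $\nabla$-stochastic integral over $(0,t]\cap\mathbb{T}$, with $i$-th component $\sum_{j=1}^d\int_0^tX^{ij}_s\nabla W^j_s$; it is the $L^2$-isometric extension of the map sending $\xi 1_{(a,b]}$ ($\xi$ bounded and $\mathcal{F}_a$-measurable, $a<b$ in $\mathbb{T}$) to $\xi(W_{b\wedge t}-W_{a\wedge t})$. $\mathcal{M}^{2,*}_{\mathbb{T},k}=\{I(X):X\in\mathcal{L}^2_{\mathbb{T},k\times d}\}$. $N$ is orthogonal to $I(X)$ if $\langle N,I(X)\rangle=0$, equivalently if the (inner) product process $(N_tI_t(X))_{t\in\mathbb{T}}$ is an $(\mathcal{F}_t)$-martingale. *)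

theory Defs
  imports "HOL-Probability.Probability"
begin

text \<open>Processes and filtrations are indexed by all of \<^typ>\<open>real\<close>; only their values at times in the
  time scale \<open>\<T>\<close> matter.\<close>

subsection \<open>Time scales\<close>

definition time_scale :: "real set \<Rightarrow> real \<Rightarrow> bool" where
  "time_scale \<T> T \<longleftrightarrow> closed \<T> \<and> 0 \<in> \<T> \<and> T \<in> \<T> \<and> (\<forall>t\<in>\<T>. 0 \<le> t \<and> t \<le> T)"

text \<open>The infimum of the empty set is read as the maximum of the time scale.\<close>

definition forward_jump :: "real set \<Rightarrow> real \<Rightarrow> real" where
  "forward_jump \<T> t = (if \<exists>s\<in>\<T>. t < s then Inf {s\<in>\<T>. t < s} else Sup \<T>)"

definition right_dense :: "real set \<Rightarrow> real \<Rightarrow> bool" where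
  "right_dense \<T> t \<longleftrightarrow> forward_jump \<T> t = t"

text \<open>The Lebesgue nabla-measure: the Lebesgue-Stieltjes measure of the step-filling function
  sending \<open>x \<ge> 0\<close> to the last point of \<open>\<T>\<close> not after \<open>x\<close>, on \<open>(0,T] \<inter> \<T>\<close>.  The lemma
  \<open>emeasure_nabla_measure_Ioc\<close> below is its defining property.\<close>

definition nabla_measure :: "real set \<Rightarrow> real measure" where
  "nabla_measure \<T> =
     restrict_space (interval_measure (\<lambda>x. Sup {s\<in>\<T>. s \<le> max 0 x})) (\<T> \<inter> {0<..})"

subsection \<open>Filtered probability spaces and martingales\<close>

definition filtration_on :: "'w measure \<Rightarrow> real set \<Rightarrow> (real \<Rightarrow> 'w measure) \<Rightarrow> bool" where
  "filtration_on P \<T> F \<longleftrightarrow>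
     (\<forall>t\<in>\<T>. subalgebra P (F t)) \<and>
     (\<forall>s\<in>\<T>. \<forall>t\<in>\<T>. s \<le> t \<longrightarrow> sets (F s) \<subseteq> sets (F t))"

text \<open>The maximum of \<open>\<T>\<close> is a fixed point of the forward jump, but there is no later time, hence
  the restriction in the last clause.\<close>

definition usual_conditions :: "'w measure \<Rightarrow> real set \<Rightarrow> (real \<Rightarrow> 'w measure) \<Rightarrow> bool" where
  "usual_conditions P \<T> F \<longleftrightarrow>
     complete_measure P \<and>
     (\<forall>t\<in>\<T>. null_sets P \<subseteq> sets (F t)) \<and>
     (\<forall>t\<in>\<T>. right_dense \<T> t \<and> (\<exists>s\<in>\<T>. t < s) \<longrightarrow>
        sets (F t) = (\<Inter>s\<in>{s\<in>\<T>. t < s}. sets (F s)))"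

definition adapted :: "real set \<Rightarrow> (real \<Rightarrow> 'w measure) \<Rightarrow>
    (real \<Rightarrow> 'w \<Rightarrow> 'e::euclidean_space) \<Rightarrow> bool" where
  "adapted \<T> F X \<longleftrightarrow> (\<forall>t\<in>\<T>. X t \<in> borel_measurable (F t))"

text \<open>Conditional expectations of vectors are taken coordinatewise.\<close>

definition martingale_on :: "'w measure \<Rightarrow> real set \<Rightarrow> (real \<Rightarrow> 'w measure) \<Rightarrow>
    (real \<Rightarrow> 'w \<Rightarrow> 'e::euclidean_space) \<Rightarrow> bool" where
  "martingale_on P \<T> F X \<longleftrightarrow>
     adapted \<T> F X \<and>
     (\<forall>t\<in>\<T>. integrable P (X t)) \<and>
     (\<forall>s\<in>\<T>. \<forall>t\<in>\<T>. s \<le> t \<longrightarrow> (\<forall>e\<in>Basis.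
        AE \<omega> in P. real_cond_exp P (F s) (\<lambda>\<omega>. X t \<omega> \<bullet> e) \<omega> = X s \<omega> \<bullet> e))"

definition M2 :: "'w measure \<Rightarrow> real set \<Rightarrow> (real \<Rightarrow> 'w measure) \<Rightarrow>
    (real \<Rightarrow> 'w \<Rightarrow> 'e::euclidean_space) set" where
  "M2 P \<T> F = {X. martingale_on P \<T> F X \<and>
     (AE \<omega> in P. \<forall>t\<in>\<T>. ((\<lambda>s. X s \<omega>) \<longlongrightarrow> X t \<omega>) (at t within \<T> \<inter> {t<..})) \<and>
     (\<integral>\<^sup>+\<omega>. (SUP t\<in>\<T>. ennreal ((norm (X t \<omega>))\<^sup>2)) \<partial>P) < \<infinity>}"

text \<open>The density below is that of the Gaussian law with mean 0 and covariance \<open>(t - s) Id\<close>.\<close>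

definition brownian_motion_on :: "'w measure \<Rightarrow> real set \<Rightarrow> (real \<Rightarrow> 'w measure) \<Rightarrow>
    (real \<Rightarrow> 'w \<Rightarrow> real^'d) \<Rightarrow> bool" where
  "brownian_motion_on P \<T> F W \<longleftrightarrow>
     adapted \<T> F W \<and>
     (AE \<omega> in P. continuous_on \<T> (\<lambda>t. W t \<omega>)) \<and>
     (AE \<omega> in P. W 0 \<omega> = 0) \<and>
     (\<forall>s\<in>\<T>. \<forall>t\<in>\<T>. s < t \<longrightarrow>
        prob_space.indep_set P (sets (F s))
          {(\<lambda>\<omega>. W t \<omega> - W s \<omega>) -` B \<inter> space P | B. B \<in> sets borel} \<and>
        distributed P lborel (\<lambda>\<omega>. W t \<omega> - W s \<omega>)
          (\<lambda>x. ennreal (\<Prod>i\<in>UNIV. normal_density 0 (sqrt (t - s)) (x $ i))))"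

subsection \<open>Predictable integrands and the stochastic nabla-integral\<close>

text \<open>Predictability concerns times in \<open>(0,T] \<inter> \<T>\<close> only; time 0 is never charged.\<close>

definition predictable_sigma :: "'w measure \<Rightarrow> real set \<Rightarrow> (real \<Rightarrow> 'w measure) \<Rightarrow>
    (real \<times> 'w) measure" where
  "predictable_sigma P \<T> F = sigma ((\<T> \<inter> {0<..}) \<times> space P)
     {({s<..t} \<inter> \<T>) \<times> A | s t A. s \<in> \<T> \<and> t \<in> \<T> \<and> s < t \<and> A \<in> sets (F s)}"

text \<open>On matrices, of type \<^typ>\<open>real^'d^'k\<close> (\<open>k\<close> rows, \<open>d\<close> columns), \<^const>\<open>norm\<close> is the Frobenius
  norm; see \<open>norm_matrix_eq_trace\<close> below.\<close>

definition L2 :: "'w measure \<Rightarrow> real set \<Rightarrow> (real \<Rightarrow> 'w measure) \<Rightarrow>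
    (real \<Rightarrow> 'w \<Rightarrow> 'e::euclidean_space) set" where
  "L2 P \<T> F = {X. (\<lambda>(s, \<omega>). X s \<omega>) \<in> borel_measurable (predictable_sigma P \<T> F) \<and>
     (\<integral>\<^sup>+\<omega>. (\<integral>\<^sup>+s. ennreal ((norm (X s \<omega>))\<^sup>2) \<partial>nabla_measure \<T>) \<partial>P) < \<infinity>}"

text \<open>A list of triples \<open>(a, b, \<xi>)\<close> represents the simple integrand that is the sum of the
  \<open>\<xi> 1\<^bsub>(a,b]\<^esub>\<close>.\<close>

definition simple_integrand :: "'w measure \<Rightarrow> real set \<Rightarrow> (real \<Rightarrow> 'w measure) \<Rightarrow>
    (real \<times> real \<times> ('w \<Rightarrow> real)) list \<Rightarrow> bool" where
  "simple_integrand P \<T> F S \<longleftrightarrow> (\<forall>(a, b, \<xi>)\<in>set S.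
     a \<in> \<T> \<and> b \<in> \<T> \<and> a < b \<and> \<xi> \<in> borel_measurable (F a) \<and>
     (\<exists>c. \<forall>\<omega>\<in>space P. \<bar>\<xi> \<omega>\<bar> \<le> c))"

definition simple_process :: "(real \<times> real \<times> ('w \<Rightarrow> real)) list \<Rightarrow> real \<Rightarrow> 'w \<Rightarrow> real" where
  "simple_process S s \<omega> = (\<Sum>(a, b, \<xi>)\<leftarrow>S. \<xi> \<omega> * indicator {a<..b} s)"

definition simple_integral :: "(real \<Rightarrow> 'w \<Rightarrow> real) \<Rightarrow> (real \<times> real \<times> ('w \<Rightarrow> real)) list \<Rightarrow>
    real \<Rightarrow> 'w \<Rightarrow> real" where
  "simple_integral w S t \<omega> = (\<Sum>(a, b, \<xi>)\<leftarrow>S. \<xi> \<omega> * (w (min b t) \<omega> - w (min a t) \<omega>))"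

text \<open>The \<open>L\<^sup>2\<close>-extension of \<^const>\<open>simple_integral\<close>: \<open>J\<close> is a right-continuous version of the
  integral of the scalar integrand \<open>H\<close> against the scalar process \<open>w\<close>.\<close>

definition is_scalar_integral :: "'w measure \<Rightarrow> real set \<Rightarrow> (real \<Rightarrow> 'w measure) \<Rightarrow>
    (real \<Rightarrow> 'w \<Rightarrow> real) \<Rightarrow> (real \<Rightarrow> 'w \<Rightarrow> real) \<Rightarrow> (real \<Rightarrow> 'w \<Rightarrow> real) \<Rightarrow> bool" where
  "is_scalar_integral P \<T> F w H J \<longleftrightarrow> J \<in> M2 P \<T> F \<and>
     (\<exists>S. (\<forall>n. simple_integrand P \<T> F (S n)) \<and>
        (\<lambda>n. \<integral>\<^sup>+\<omega>. (\<integral>\<^sup>+s. ennreal ((simple_process (S n) s \<omega> - H s \<omega>)\<^sup>2) \<partial>nabla_measure \<T>) \<partial>P)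
          \<longlonglongrightarrow> 0 \<and>
        (\<forall>t\<in>\<T>. (\<lambda>n. \<integral>\<^sup>+\<omega>. ennreal ((simple_integral w (S n) t \<omega> - J t \<omega>)\<^sup>2) \<partial>P) \<longlonglongrightarrow> 0))"

text \<open>The choice is unique up to indistinguishability.\<close>

definition scalar_integral :: "'w measure \<Rightarrow> real set \<Rightarrow> (real \<Rightarrow> 'w measure) \<Rightarrow>
    (real \<Rightarrow> 'w \<Rightarrow> real) \<Rightarrow> (real \<Rightarrow> 'w \<Rightarrow> real) \<Rightarrow> real \<Rightarrow> 'w \<Rightarrow> real" where
  "scalar_integral P \<T> F w H = (SOME J. is_scalar_integral P \<T> F w H J)"

definition stoch_integral :: "'w measure \<Rightarrow> real set \<Rightarrow> (real \<Rightarrow> 'w measure) \<Rightarrow>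
    (real \<Rightarrow> 'w \<Rightarrow> real^'d) \<Rightarrow> (real \<Rightarrow> 'w \<Rightarrow> real^'d^'k) \<Rightarrow> real \<Rightarrow> 'w \<Rightarrow> real^'k" where
  "stoch_integral P \<T> F W X t \<omega> =
     (\<chi> i. \<Sum>j\<in>UNIV. scalar_integral P \<T> F (\<lambda>s \<omega>. W s \<omega> $ j) (\<lambda>s \<omega>. X s \<omega> $ i $ j) t \<omega>)"

definition M2_star :: "'w measure \<Rightarrow> real set \<Rightarrow> (real \<Rightarrow> 'w measure) \<Rightarrow>
    (real \<Rightarrow> 'w \<Rightarrow> real^'d) \<Rightarrow> (real \<Rightarrow> 'w \<Rightarrow> real^'k) set" where
  "M2_star P \<T> F W =
     {stoch_integral P \<T> F W X | X :: real \<Rightarrow> 'w \<Rightarrow> real^'d^'k. X \<in> L2 P \<T> F}"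

text \<open>Vanishing of the bracket of \<open>N\<close> and \<open>L\<close>: their inner product needs no compensator.\<close>

definition orthogonal_martingales :: "'w measure \<Rightarrow> real set \<Rightarrow> (real \<Rightarrow> 'w measure) \<Rightarrow>
    (real \<Rightarrow> 'w \<Rightarrow> 'e::euclidean_space) \<Rightarrow> (real \<Rightarrow> 'w \<Rightarrow> 'e) \<Rightarrow> bool" where
  "orthogonal_martingales P \<T> F N L \<longleftrightarrow> martingale_on P \<T> F (\<lambda>t \<omega>. N t \<omega> \<bullet> L t \<omega>)"

subsection \<open>Consistency checks\<close>

lemma norm_matrix_eq_trace:
  fixes z :: "real^'d^'k"
  shows "norm z = sqrt (trace (z ** transpose z))"
  by (simp add: norm_vec_def L2_set_def trace_def matrix_matrix_mult_def transpose_def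
      sum_nonneg power2_eq_square)

lemma emeasure_nabla_measure_Ioc:
  assumes ts: "time_scale \<T> T" and ab: "a \<in> \<T>" "b \<in> \<T>" "a < b"
  shows "emeasure (nabla_measure \<T>) ({a<..b} \<inter> \<T>) = ennreal (b - a)"
proof -
  define G where "G = (\<lambda>x::real. Sup {s\<in>\<T>. s \<le> max 0 x})"
  have cl: "closed \<T>" and z: "0 \<in> \<T>" and nn: "\<And>t. t \<in> \<T> \<Longrightarrow> 0 \<le> t"
    using ts by (auto simp: time_scale_def)
  have bdd: "bdd_above {s\<in>\<T>. s \<le> max 0 x}" for x by (rule bdd_aboveI[of _ "max 0 x"]) auto
  have ne: "{s\<in>\<T>. s \<le> max 0 x} \<noteq> {}" for x using z by auto
  have clx: "closed {s\<in>\<T>. s \<le> max 0 x}" for x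
    using closed_Int[OF cl closed_atMost[of "max 0 x"]] by (simp add: Int_def)
  have G_in: "G x \<in> {s\<in>\<T>. s \<le> max 0 x}" for x
    unfolding G_def using closed_contains_Sup[OF ne bdd clx] .
  have G_ub: "s \<in> \<T> \<Longrightarrow> s \<le> max 0 x \<Longrightarrow> s \<le> G x" for s x
    unfolding G_def by (rule cSup_upper[OF _ bdd]) auto
  have G_T: "G x = x" if "x \<in> \<T>" for x
    using G_in[of x] G_ub[of x x] nn[OF that] that by auto
  have G_mono: "G x \<le> G y" if "x \<le> y" for x y
    using G_in[of x] G_ub[of "G x" y] that by auto
  have G_eq: "G y = G x" if "x \<le> y" "\<And>s. s \<in> \<T> \<Longrightarrow> max 0 x < s \<Longrightarrow> max 0 y < s" for x y
  proof (rule antisym)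
    show "G y \<le> G x"
    proof (rule G_ub)
      show "G y \<le> max 0 x" using that(2)[of "G y"] G_in[of y] by force
    qed (use G_in[of y] in auto)
  qed (rule G_mono[OF that(1)])
  have G_rc: "continuous (at_right x) G" for x
  proof -
    have "(G \<longlongrightarrow> G x) (at_right x)"
    proof (cases "max 0 x \<in> \<T>")
      case True
      then have Gx: "G x = max 0 x" using G_in[of x] G_ub[of "max 0 x" x] by auto
      have "((\<lambda>y. max 0 y) \<longlongrightarrow> max 0 x) (at_right x)"
        by (intro tendsto_intros)
      moreover have "\<forall>\<^sub>F y in at_right x. G x \<le> G y"
        using G_mono by (auto simp: eventually_at_filter less_imp_le)
      moreover have "\<forall>\<^sub>F y in at_right x. G y \<le> max 0 y"
        using G_in by auto
      ultimately show ?thesis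
        using tendsto_sandwich[of "\<lambda>_. G x" G "at_right x" "\<lambda>y. max 0 y" "G x"] Gx by auto
    next
      case False
      have "open (- \<T>)" using cl by (rule open_Compl)
      then obtain e where e: "e > 0" "\<And>y. dist y (max 0 x) < e \<Longrightarrow> y \<notin> \<T>"
        using False by (auto simp: open_dist)
      have "\<forall>\<^sub>F y in at_right x. G y = G x"
      proof -
        have "\<forall>\<^sub>F y in at_right x. y < x + e \<and> x < y"
          using eventually_at_right_less[of x] eventually_at_right_real[of x "x + e"] e(1)
          by (auto elim!: eventually_mono simp: eventually_conj_iff)
        then show ?thesis
        proof (rule eventually_mono)
          fix y assume y: "y < x + e \<and> x < y"
          show "G y = G x"
          proof (rule G_eq)
            fix s assume s: "s \<in> \<T>" "max 0 x < s"
            show "max 0 y < s"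
            proof (rule ccontr)
              assume "\<not> max 0 y < s"
              then have "dist s (max 0 x) < e" using s y by (auto simp: dist_real_def max_def split: if_splits)
              then show False using e(2) s(1) by blast
            qed
          qed (use y in auto)
        qed
      qed
      then show ?thesis by (simp add: tendsto_eventually)
    qed
    then show ?thesis by (simp add: continuous_within)
  qed
  let ?I = "interval_measure G"
  have Tm: "\<T> \<in> sets borel" using cl by auto
  have Ioc: "emeasure ?I {a<..b} = ennreal (b - a)"
    using emeasure_interval_measure_Ioc[of a b G, OF _ G_mono G_rc] ab by (simp add: G_T)
  have null: "emeasure ?I ({0<..b} - \<T>) = 0"
  proof -
    have "open (- \<T>)" using cl by (rule open_Compl)
    define C where "C = {p :: real \<times> real. fst p \<in> \<rat> \<and> snd p \<in> \<rat> \<and> 0 < fst p \<and> fst p \<le> snd p \<and> {fst p..snd p} \<inter> \<T> = {}}"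
    have "C \<subseteq> \<rat> \<times> \<rat>" by (auto simp: C_def)
    then have cC: "countable C" using countable_rat countable_SIGMA countable_subset by metis
    have "{0<..b} - \<T> \<subseteq> (\<Union>p\<in>C. {fst p<..snd p})"
    proof
      fix x assume x: "x \<in> {0<..b} - \<T>"
      then obtain e where e: "e > 0" "\<And>y. dist y x < e \<Longrightarrow> y \<notin> \<T>"
        using \<open>open (- \<T>)\<close> by (auto simp: open_dist)
      obtain q where q: "q \<in> \<rat>" "max 0 (x - e) < q" "q < x"
        using Rats_dense_in_real[of "max 0 (x - e)" x] x e(1) by auto
      obtain r where r: "r \<in> \<rat>" "x < r" "r < x + e"
        using Rats_dense_in_real[of x "x + e"] e(1) by auto
      have "(q, r) \<in> C" using q r e(2) by (fastforce simp: C_def dist_real_def)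
      then show "x \<in> (\<Union>p\<in>C. {fst p<..snd p})" using q r by force
    qed
    moreover have "(\<Union>p\<in>C. {fst p<..snd p}) \<in> null_sets ?I"
    proof (rule null_sets_UN'[OF cC])
      fix p assume p: "p \<in> C"
      have "G (snd p) = G (fst p)"
      proof (rule G_eq)
        fix s assume s: "s \<in> \<T>" "max 0 (fst p) < s"
        then have "s \<notin> {fst p..snd p}" using p unfolding C_def by blast
        then show "max 0 (snd p) < s" using s by auto
      qed (use p in \<open>auto simp: C_def\<close>)
      then have "emeasure ?I {fst p<..snd p} = 0"
        using emeasure_interval_measure_Ioc[of "fst p" "snd p" G, OF _ G_mono G_rc] p
        by (auto simp: C_def)
      then show "{fst p<..snd p} \<in> null_sets ?I" by (simp add: null_sets_def)
    qed
    ultimately have "{0<..b} - \<T> \<in> null_sets ?I"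
      by (rule null_sets_subset[rotated 2]) (use Tm in auto)
    then show ?thesis by auto
  qed
  have null': "{a<..b} - \<T> \<in> null_sets ?I"
  proof (rule null_sets_subset)
    show "{0<..b} - \<T> \<in> null_sets ?I" using null Tm by (simp add: null_sets_def)
  qed (use Tm nn[OF ab(1)] in auto)
  have "emeasure (nabla_measure \<T>) ({a<..b} \<inter> \<T>) = emeasure ?I ({a<..b} \<inter> \<T>)"
    unfolding nabla_measure_def G_def[symmetric]
    by (rule emeasure_restrict_space) (use Tm nn[OF ab(1)] in auto)
  also have "\<dots> = emeasure ?I ({a<..b} - ({a<..b} - \<T>))"
    by (rule arg_cong[where f = "emeasure ?I"]) auto
  also have "\<dots> = emeasure ?I {a<..b}"
    by (rule emeasure_Diff_null_set[OF null']) auto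
  finally show ?thesis using Ioc by simp
qed

end

theory Submission
  imports Defs
begin

text \<open>The Ito isometry turns the decomposition into an orthogonal projection in \<open>L\<^sup>2(P)\<close>.  For
  simple integrands \<open>S\<^sub>j\<close>, one for each coordinate of \<open>W\<close>, the random variables
  \<open>\<Sum>\<^sub>j \<integral> S\<^sub>j dW\<^sup>j\<close>, integrated up to \<open>T\<close>, form a linear space on which the \<open>L\<^sup>2(P)\<close> distance is
  the \<open>L\<^sup>2\<close> distance of the integrands for the product of the nabla-measure and \<open>P\<close>
  (\<open>simple_integral_isometry\<close>).  Projecting the \<open>i\<close>-th coordinate of \<open>M\<^sub>T\<close> on the closure of this
  space gives a convergent sequence of simple integrals; by the isometry their integrands converge
  as well, and the limits are the \<open>i\<close>-th row of \<open>X\<close> (\<open>projection_onto_stochastic_integrals\<close>).  The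
  terminal value of \<open>N = M - I(X)\<close> is then orthogonal to all terminal values of simple integrals.

  This orthogonality at the single time \<open>T\<close> already implies that \<open>N \<cdot> I(Y)\<close> is a martingale: for
  \<open>s \<le> t\<close> and \<open>A \<in> F\<^sub>s\<close>, the variable \<open>1\<^sub>A (I\<^sub>t(S) - I\<^sub>s(S))\<close> is itself the terminal value of the
  integral of a simple integrand, namely \<open>S\<close> cut down to \<open>(s,t] \<times> A\<close>, so it is orthogonal to
  \<open>N\<^sub>T\<close>, and, being \<open>F\<^sub>t\<close>-measurable, to \<open>N\<^sub>t\<close>
  (\<open>martingale_mult_scalar_integral\<close>).

  The statement speaks of \<open>I(Y)\<close> for every \<open>Y\<close> in \<open>L\<^sup>2\<close>, where the integral is picked by a choice
  operator, so its existence must be proved.  It needs two facts.  Simple processes are dense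
  (\<open>simple_processes_dense\<close>): the residual of the projection on them has integral \<open>0\<close> over each
  predictable rectangle and hence vanishes.  And square-integrable right-continuous martingales are
  complete (\<open>M2_complete\<close>): by Doob's inequality convergence at \<open>T\<close> forces uniform convergence of
  almost all paths along a subsequence.  The time scale enters only through the nabla-measure of
  intervals and through one countable subset that determines suprema of right-continuous paths.\<close>

section \<open>Square-integrable functions and orthogonal projection\<close>

definition square_integrable :: "'a measure \<Rightarrow> ('a \<Rightarrow> real) \<Rightarrow> bool" where
  "square_integrable \<mu> f \<longleftrightarrow> f \<in> borel_measurable \<mu> \<and> integrable \<mu> (\<lambda>x. (f x)\<^sup>2)"

definition sq_dist :: "'a measure \<Rightarrow> ('a \<Rightarrow> real) \<Rightarrow> ('a \<Rightarrow> real) \<Rightarrow> real" where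
  "sq_dist \<mu> f g = (\<integral>x. (f x - g x)\<^sup>2 \<partial>\<mu>)"

definition L2_tendsto :: "'a measure \<Rightarrow> (nat \<Rightarrow> 'a \<Rightarrow> real) \<Rightarrow> ('a \<Rightarrow> real) \<Rightarrow> bool" where
  "L2_tendsto \<mu> f g \<longleftrightarrow>
     (\<forall>n. square_integrable \<mu> (f n)) \<and> square_integrable \<mu> g \<and> (\<lambda>n. sq_dist \<mu> (f n) g) \<longlonglongrightarrow> 0"

definition L2_Cauchy :: "'a measure \<Rightarrow> (nat \<Rightarrow> 'a \<Rightarrow> real) \<Rightarrow> bool" where
  "L2_Cauchy \<mu> f \<longleftrightarrow>
     (\<forall>n. square_integrable \<mu> (f n)) \<and> (\<forall>e>0. \<exists>N. \<forall>m\<ge>N. \<forall>n\<ge>N. sq_dist \<mu> (f m) (f n) < e)"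

lemma square_integrable_measurable [measurable_dest]:
  "square_integrable \<mu> f \<Longrightarrow> f \<in> borel_measurable \<mu>"
  by (simp add: square_integrable_def)

lemma square_integrable_power2: "square_integrable \<mu> f \<Longrightarrow> integrable \<mu> (\<lambda>x. (f x)\<^sup>2)"
  by (simp add: square_integrable_def)

lemma square_integrable_mult:
  assumes f: "square_integrable \<mu> f" and g: "square_integrable \<mu> g"
  shows "integrable \<mu> (\<lambda>x. f x * g x)"
proof (rule Bochner_Integration.integrable_bound)
  show "integrable \<mu> (\<lambda>x. (f x)\<^sup>2 + (g x)\<^sup>2)"
    using f g by (auto simp: square_integrable_def)
  show "(\<lambda>x. f x * g x) \<in> borel_measurable \<mu>"
    using f g by (auto simp: square_integrable_def)
  have "\<bar>a * b\<bar> \<le> a\<^sup>2 + b\<^sup>2" for a b :: real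
    using sum_squares_bound[of "\<bar>a\<bar>" "\<bar>b\<bar>"] mult_nonneg_nonneg[of "\<bar>a\<bar>" "\<bar>b\<bar>"]
    unfolding abs_mult power2_abs by linarith
  then show "AE x in \<mu>. norm (f x * g x) \<le> norm ((f x)\<^sup>2 + (g x)\<^sup>2)"
    by simp
qed

lemma square_integrable_cmult:
  "square_integrable \<mu> f \<Longrightarrow> square_integrable \<mu> (\<lambda>x. c * f x)"
  by (auto simp: square_integrable_def power_mult_distrib)

lemma square_integrable_add:
  assumes f: "square_integrable \<mu> f" and g: "square_integrable \<mu> g"
  shows "square_integrable \<mu> (\<lambda>x. f x + g x)"
  using square_integrable_mult[OF f g] f g
  by (auto simp: square_integrable_def power2_sum mult.assoc)

lemma square_integrable_diff:
  assumes f: "square_integrable \<mu> f" and g: "square_integrable \<mu> g"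
  shows "square_integrable \<mu> (\<lambda>x. f x - g x)"
  using square_integrable_add[OF f square_integrable_cmult[OF g, of "-1"]] by simp

lemma square_integrable_0 [simp]: "square_integrable \<mu> (\<lambda>x. 0)"
  by (simp add: square_integrable_def)

lemma square_integrable_sum:
  assumes "\<And>i. i \<in> I \<Longrightarrow> square_integrable \<mu> (f i)"
  shows "square_integrable \<mu> (\<lambda>x. \<Sum>i\<in>I. f i x)"
  using assms by (induction I rule: infinite_finite_induct) (auto intro: square_integrable_add)

lemma square_integrable_dominated:
  assumes g: "square_integrable \<mu> g" and f: "f \<in> borel_measurable \<mu>"
    and b: "AE x in \<mu>. \<bar>f x\<bar> \<le> \<bar>g x\<bar>"
  shows "square_integrable \<mu> f"
  unfolding square_integrable_def
proof
  show "integrable \<mu> (\<lambda>x. (f x)\<^sup>2)"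
  proof (rule Bochner_Integration.integrable_bound)
    show "integrable \<mu> (\<lambda>x. (g x)\<^sup>2)" using g by (rule square_integrable_power2)
    show "AE x in \<mu>. norm ((f x)\<^sup>2) \<le> norm ((g x)\<^sup>2)"
      using b by eventually_elim (simp add: abs_le_square_iff)
  qed (use f in measurable)
qed (rule f)

lemma square_integrable_bounded_mult:
  assumes f: "square_integrable \<mu> f" and g: "g \<in> borel_measurable \<mu>"
    and b: "\<And>x. x \<in> space \<mu> \<Longrightarrow> \<bar>g x\<bar> \<le> c"
  shows "square_integrable \<mu> (\<lambda>x. g x * f x)"
proof (rule square_integrable_dominated[OF square_integrable_cmult[OF f]])
  show "AE x in \<mu>. \<bar>g x * f x\<bar> \<le> \<bar>c * f x\<bar>"
    using b by (intro AE_I2) (force simp: abs_mult intro!: mult_right_mono)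
qed (use f g in \<open>auto simp: square_integrable_def\<close>)

lemma (in finite_measure) square_integrable_bounded:
  assumes g: "g \<in> borel_measurable M" and b: "\<And>x. x \<in> space M \<Longrightarrow> \<bar>g x\<bar> \<le> c"
  shows "square_integrable M g"
proof -
  have "square_integrable M (\<lambda>_. 1)" by (simp add: square_integrable_def)
  from square_integrable_bounded_mult[OF this g b] show ?thesis by simp
qed

lemma (in finite_measure) square_integrable_integrable:
  assumes "square_integrable M f" shows "integrable M f"
proof -
  have "square_integrable M (\<lambda>_. 1)" by (simp add: square_integrable_def)
  from square_integrable_mult[OF this assms] show ?thesis by simp
qed

lemma square_integrable_iff_nn_integral:
  "square_integrable \<mu> f \<longleftrightarrow>
     f \<in> borel_measurable \<mu> \<and> (\<integral>\<^sup>+x. ennreal ((f x)\<^sup>2) \<partial>\<mu>) < \<infinity>"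
  by (auto simp: square_integrable_def integrable_iff_bounded)

lemma nn_integral_power2:
  "square_integrable \<mu> f \<Longrightarrow> (\<integral>\<^sup>+x. ennreal ((f x)\<^sup>2) \<partial>\<mu>) = ennreal (\<integral>x. (f x)\<^sup>2 \<partial>\<mu>)"
  by (intro nn_integral_eq_integral) (auto simp: square_integrable_def)

lemma sq_dist_nonneg: "0 \<le> sq_dist \<mu> f g"
  by (simp add: sq_dist_def)

lemma sq_dist_commute: "sq_dist \<mu> f g = sq_dist \<mu> g f"
  by (simp add: sq_dist_def power2_commute)

lemma nn_integral_sq_dist:
  assumes "square_integrable \<mu> f" "square_integrable \<mu> g"
  shows "(\<integral>\<^sup>+x. ennreal ((f x - g x)\<^sup>2) \<partial>\<mu>) = ennreal (sq_dist \<mu> f g)"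
  unfolding sq_dist_def by (rule nn_integral_power2[OF square_integrable_diff[OF assms]])

lemma sq_dist_triangle:
  assumes f: "square_integrable \<mu> f" and g: "square_integrable \<mu> g" and h: "square_integrable \<mu> h"
  shows "sq_dist \<mu> f h \<le> 2 * sq_dist \<mu> f g + 2 * sq_dist \<mu> g h"
proof -
  note i = square_integrable_power2[OF square_integrable_diff]
  have "sq_dist \<mu> f h \<le> (\<integral>x. 2 * (f x - g x)\<^sup>2 + 2 * (g x - h x)\<^sup>2 \<partial>\<mu>)"
    unfolding sq_dist_def
  proof (rule integral_mono)
    fix x
    show "(f x - h x)\<^sup>2 \<le> 2 * (f x - g x)\<^sup>2 + 2 * (g x - h x)\<^sup>2"
      using zero_le_power2[of "f x - 2 * g x + h x"] by (simp add: power2_eq_square algebra_simps)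
  qed (use i[OF f g] i[OF g h] i[OF f h] in auto)
  also have "\<dots> = 2 * sq_dist \<mu> f g + 2 * sq_dist \<mu> g h"
    unfolding sq_dist_def using i[OF f g] i[OF g h] by simp
  finally show ?thesis .
qed

lemma integral_Cauchy_Schwarz:
  assumes f: "square_integrable \<mu> f" and g: "square_integrable \<mu> g"
  shows "(\<integral>x. f x * g x \<partial>\<mu>)\<^sup>2 \<le> (\<integral>x. (f x)\<^sup>2 \<partial>\<mu>) * (\<integral>x. (g x)\<^sup>2 \<partial>\<mu>)"
proof -
  let ?a = "\<integral>x. (f x)\<^sup>2 \<partial>\<mu>" and ?b = "\<integral>x. f x * g x \<partial>\<mu>" and ?c = "\<integral>x. (g x)\<^sup>2 \<partial>\<mu>"
  have q: "0 \<le> ?a + 2 * s * ?b + s\<^sup>2 * ?c" for s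
  proof -
    have "0 \<le> (\<integral>x. (f x + s * g x)\<^sup>2 \<partial>\<mu>)" by simp
    also have "\<dots> = (\<integral>x. (f x)\<^sup>2 + 2 * s * (f x * g x) + s\<^sup>2 * (g x)\<^sup>2 \<partial>\<mu>)"
      by (simp add: power2_eq_square algebra_simps)
    also have "\<dots> = ?a + 2 * s * ?b + s\<^sup>2 * ?c"
      using square_integrable_mult[OF f g] f g by (simp add: square_integrable_def)
    finally show ?thesis .
  qed
  show ?thesis
  proof (cases "?c = 0")
    case True
    have "?b = 0"
    proof (rule ccontr)
      assume "?b \<noteq> 0"
      then have "?a + 2 * (- (?a + 1) / (2 * ?b)) * ?b = - 1" by (simp add: field_simps)
      then show False using q[of "- (?a + 1) / (2 * ?b)"] True by simp
    qed
    then show ?thesis by simp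
  next
    case False
    moreover have "0 \<le> ?c" by simp
    ultimately have c: "?c > 0" by linarith
    have "0 \<le> (?a + 2 * (- ?b / ?c) * ?b + (- ?b / ?c)\<^sup>2 * ?c) * ?c"
      by (rule mult_nonneg_nonneg[OF q]) simp
    also have "\<dots> = ?a * ?c - ?b\<^sup>2"
      using c by (simp add: power2_eq_square field_simps)
    finally show ?thesis by simp
  qed
qed

lemma L2_tendsto_integral_mult:
  assumes l: "L2_tendsto \<mu> f g" and h: "square_integrable \<mu> h"
  shows "(\<lambda>n. \<integral>x. f n x * h x \<partial>\<mu>) \<longlonglongrightarrow> (\<integral>x. g x * h x \<partial>\<mu>)"
proof -
  have f: "square_integrable \<mu> (f n)" and g: "square_integrable \<mu> g" for n
    using l by (auto simp: L2_tendsto_def)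
  have "(\<lambda>n. (\<integral>x. f n x * h x \<partial>\<mu>) - (\<integral>x. g x * h x \<partial>\<mu>)) \<longlonglongrightarrow> 0"
  proof (rule Lim_null_comparison)
    have "\<bar>(\<integral>x. f n x * h x \<partial>\<mu>) - (\<integral>x. g x * h x \<partial>\<mu>)\<bar>
        \<le> sqrt (sq_dist \<mu> (f n) g * (\<integral>x. (h x)\<^sup>2 \<partial>\<mu>))" for n
    proof -
      have "(\<integral>x. f n x * h x \<partial>\<mu>) - (\<integral>x. g x * h x \<partial>\<mu>) = (\<integral>x. (f n x - g x) * h x \<partial>\<mu>)"
        using square_integrable_mult[OF f h] square_integrable_mult[OF g h]
        by (simp add: left_diff_distrib)
      then show ?thesis
        using integral_Cauchy_Schwarz[OF square_integrable_diff[OF f g] h, of n]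
        unfolding sq_dist_def by (intro real_le_rsqrt) (simp only: power2_abs)
    qed
    then show "\<forall>\<^sub>F n in sequentially. norm ((\<integral>x. f n x * h x \<partial>\<mu>) - (\<integral>x. g x * h x \<partial>\<mu>))
        \<le> sqrt (sq_dist \<mu> (f n) g * (\<integral>x. (h x)\<^sup>2 \<partial>\<mu>))"
      by simp
    have "(\<lambda>n. sqrt (sq_dist \<mu> (f n) g * (\<integral>x. (h x)\<^sup>2 \<partial>\<mu>)))
        \<longlonglongrightarrow> sqrt (0 * (\<integral>x. (h x)\<^sup>2 \<partial>\<mu>))"
      using l by (intro tendsto_intros) (auto simp: L2_tendsto_def)
    then show "(\<lambda>n. sqrt (sq_dist \<mu> (f n) g * (\<integral>x. (h x)\<^sup>2 \<partial>\<mu>))) \<longlonglongrightarrow> 0"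
      by simp
  qed
  then show ?thesis by (simp add: LIM_zero_iff)
qed

lemma L2_tendstoI_le:
  assumes "\<And>n. square_integrable \<mu> (f n)" "square_integrable \<mu> g"
    and "\<And>n. sq_dist \<mu> (f n) g \<le> a n" "a \<longlonglongrightarrow> 0"
  shows "L2_tendsto \<mu> f g"
proof -
  have "(\<lambda>n. sq_dist \<mu> (f n) g) \<longlonglongrightarrow> 0"
    by (rule tendsto_sandwich[of "\<lambda>_. 0" _ _ a]) (simp_all add: sq_dist_nonneg assms(3,4))
  with assms(1,2) show ?thesis by (simp add: L2_tendsto_def)
qed

lemma L2_tendsto_add:
  assumes "L2_tendsto \<mu> f g" "L2_tendsto \<mu> f' g'"
  shows "L2_tendsto \<mu> (\<lambda>n x. f n x + f' n x) (\<lambda>x. g x + g' x)"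
proof (rule L2_tendstoI_le)
  have s: "square_integrable \<mu> (f n)" "square_integrable \<mu> (f' n)" "square_integrable \<mu> g"
    "square_integrable \<mu> g'" for n
    using assms by (auto simp: L2_tendsto_def)
  show "square_integrable \<mu> (\<lambda>x. f n x + f' n x)" for n using s by (blast intro: square_integrable_add)
  show "square_integrable \<mu> (\<lambda>x. g x + g' x)" using s by (blast intro: square_integrable_add)
  show "sq_dist \<mu> (\<lambda>x. f n x + f' n x) (\<lambda>x. g x + g' x)
      \<le> 2 * sq_dist \<mu> (f n) g + 2 * sq_dist \<mu> (f' n) g'" for n
  proof -
    have "sq_dist \<mu> (\<lambda>x. f n x + f' n x) (\<lambda>x. g x + g' x)
        = sq_dist \<mu> (\<lambda>x. f n x - g x) (\<lambda>x. g' x - f' n x)"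
      by (simp add: sq_dist_def algebra_simps)
    also have "\<dots> \<le> 2 * sq_dist \<mu> (\<lambda>x. f n x - g x) (\<lambda>_. 0) + 2 * sq_dist \<mu> (\<lambda>_. 0) (\<lambda>x. g' x - f' n x)"
      by (intro sq_dist_triangle square_integrable_diff s square_integrable_0)
    finally show ?thesis by (simp add: sq_dist_def power2_commute)
  qed
  show "(\<lambda>n. 2 * sq_dist \<mu> (f n) g + 2 * sq_dist \<mu> (f' n) g') \<longlonglongrightarrow> 0"
    using assms by (auto simp: L2_tendsto_def intro!: tendsto_add_zero tendsto_mult_right_zero)
qed

lemma L2_tendsto_sum:
  assumes "\<And>i. i \<in> I \<Longrightarrow> L2_tendsto \<mu> (f i) (g i)"
  shows "L2_tendsto \<mu> (\<lambda>n x. \<Sum>i\<in>I. f i n x) (\<lambda>x. \<Sum>i\<in>I. g i x)"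
  using assms
proof (induction I rule: infinite_finite_induct)
  case (insert i I)
  then show ?case using L2_tendsto_add[of \<mu> "f i" "g i"] by auto
qed (auto simp: L2_tendsto_def sq_dist_def)

lemma L2_tendsto_imp_L2_Cauchy:
  assumes "L2_tendsto \<mu> f g" shows "L2_Cauchy \<mu> f"
  unfolding L2_Cauchy_def
proof (intro conjI allI impI)
  have s: "square_integrable \<mu> (f n)" "square_integrable \<mu> g" for n
    using assms by (auto simp: L2_tendsto_def)
  then show "square_integrable \<mu> (f n)" for n by simp
  fix e :: real assume "e > 0"
  then obtain N where N: "\<And>n. n \<ge> N \<Longrightarrow> sq_dist \<mu> (f n) g < e / 4"
    using assms LIMSEQ_D[of "\<lambda>n. sq_dist \<mu> (f n) g" 0 "e / 4"]
    by (auto simp: L2_tendsto_def sq_dist_nonneg abs_of_nonneg)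
  have "sq_dist \<mu> (f m) (f n) < e" if "m \<ge> N" "n \<ge> N" for m n
    using sq_dist_triangle[OF s(1)[of m] s(2) s(1)[of n]] N[OF that(1)] N[OF that(2)]
      sq_dist_commute[of \<mu> g "f n"] by linarith
  then show "\<exists>N. \<forall>m\<ge>N. \<forall>n\<ge>N. sq_dist \<mu> (f m) (f n) < e" by blast
qed

lemma L2_tendsto_unique:
  assumes "L2_tendsto \<mu> f g" "L2_tendsto \<mu> f h"
  shows "AE x in \<mu>. g x = h x"
proof -
  have s: "square_integrable \<mu> (f n)" "square_integrable \<mu> g" "square_integrable \<mu> h" for n
    using assms by (auto simp: L2_tendsto_def)
  have "(\<lambda>n. 2 * sq_dist \<mu> (f n) g + 2 * sq_dist \<mu> (f n) h) \<longlonglongrightarrow> 2 * 0 + 2 * 0"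
    using assms by (intro tendsto_intros) (auto simp: L2_tendsto_def)
  moreover have "sq_dist \<mu> g h \<le> 2 * sq_dist \<mu> (f n) g + 2 * sq_dist \<mu> (f n) h" for n
    using sq_dist_triangle[OF s(2) s(1) s(3), of n] sq_dist_commute[of \<mu> g "f n"] by linarith
  ultimately have "sq_dist \<mu> g h \<le> 0"
    using LIMSEQ_le_const[of _ 0 "sq_dist \<mu> g h"] by auto
  then have "(\<integral>x. (g x - h x)\<^sup>2 \<partial>\<mu>) = 0" 
    by (intro antisym) (simp_all add: sq_dist_def)
  then have "AE x in \<mu>. (g x - h x)\<^sup>2 = 0"
    using square_integrable_power2[OF square_integrable_diff[OF s(2,3)]]
    by (subst (asm) integral_nonneg_eq_0_iff_AE) auto
  then show ?thesis by simp
qed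

lemma L2_tendsto_AE_cong:
  assumes "L2_tendsto \<mu> f g" "AE x in \<mu>. g x = h x" "h \<in> borel_measurable \<mu>"
  shows "L2_tendsto \<mu> f h"
proof -
  have s: "square_integrable \<mu> (f n)" "square_integrable \<mu> g" for n
    using assms by (auto simp: L2_tendsto_def)
  have h: "square_integrable \<mu> h"
    by (rule square_integrable_dominated[OF s(2) assms(3)]) (use assms(2) in auto)
  have "sq_dist \<mu> (f n) h = sq_dist \<mu> (f n) g" for n
  proof -
    have [measurable]: "f n \<in> borel_measurable \<mu>" "g \<in> borel_measurable \<mu>" "h \<in> borel_measurable \<mu>"
      using s h by (auto simp: square_integrable_def)
    show ?thesis
      unfolding sq_dist_def by (rule integral_cong_AE) (use assms(2) in auto)
  qed
  then show ?thesis using assms(1) h by (simp add: L2_tendsto_def)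
qed

text \<open>By Fatou's lemma the distance from \<open>f n\<close> to the pointwise limit is at most the limit inferior
  of its distances to the subsequence, which the Cauchy property makes small.\<close>
lemma L2_Cauchy_tendsto_AE:
  assumes c: "L2_Cauchy \<mu> f" and g [measurable]: "g \<in> borel_measurable \<mu>"
    and r: "strict_mono (r :: nat \<Rightarrow> nat)" and ae: "AE x in \<mu>. (\<lambda>k. f (r k) x) \<longlonglongrightarrow> g x"
  shows "L2_tendsto \<mu> f g"
proof -
  have f: "square_integrable \<mu> (f n)" for n using c by (simp add: L2_Cauchy_def)
  have fm [measurable]: "f n \<in> borel_measurable \<mu>" for n using f by (simp add: square_integrable_def)
  have *: "\<exists>N. \<forall>n\<ge>N. square_integrable \<mu> (\<lambda>x. f n x - g x) \<and> sq_dist \<mu> (f n) g \<le> e" if e: "e > 0" for e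
  proof -
    obtain N where N: "\<And>m n. m \<ge> N \<Longrightarrow> n \<ge> N \<Longrightarrow> sq_dist \<mu> (f m) (f n) < e"
      using c e unfolding L2_Cauchy_def by blast
    have "square_integrable \<mu> (\<lambda>x. f n x - g x) \<and> sq_dist \<mu> (f n) g \<le> e" if n: "n \<ge> N" for n
    proof -
      have "(\<integral>\<^sup>+x. ennreal ((f n x - g x)\<^sup>2) \<partial>\<mu>)
          = (\<integral>\<^sup>+x. liminf (\<lambda>k. ennreal ((f n x - f (r k) x)\<^sup>2)) \<partial>\<mu>)"
      proof (rule nn_integral_cong_AE)
        show "AE x in \<mu>. ennreal ((f n x - g x)\<^sup>2) = liminf (\<lambda>k. ennreal ((f n x - f (r k) x)\<^sup>2))"
          using ae
        proof eventually_elim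
          case (elim x)
          have "(\<lambda>k. ennreal ((f n x - f (r k) x)\<^sup>2)) \<longlonglongrightarrow> ennreal ((f n x - g x)\<^sup>2)"
            by (intro tendsto_intros elim)
          then show ?case by (rule lim_imp_Liminf[OF trivial_limit_sequentially, symmetric])
        qed
      qed
      also have "\<dots> \<le> liminf (\<lambda>k. \<integral>\<^sup>+x. ennreal ((f n x - f (r k) x)\<^sup>2) \<partial>\<mu>)"
        by (rule nn_integral_liminf) measurable
      also have "\<dots> \<le> liminf (\<lambda>k. ennreal e)"
      proof (rule Liminf_mono)
        have "(\<integral>\<^sup>+x. ennreal ((f n x - f (r k) x)\<^sup>2) \<partial>\<mu>) \<le> ennreal e" if "k \<ge> N" for k
          using N[OF n, of "r k"] that seq_suble[OF r, of k]
          by (simp add: nn_integral_sq_dist[OF f f] ennreal_leI)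
        then show "\<forall>\<^sub>F k in sequentially. (\<integral>\<^sup>+x. ennreal ((f n x - f (r k) x)\<^sup>2) \<partial>\<mu>) \<le> ennreal e"
          by (auto simp: eventually_sequentially)
      qed
      also have "\<dots> = ennreal e" by (simp add: Liminf_const)
      finally have le: "(\<integral>\<^sup>+x. ennreal ((f n x - g x)\<^sup>2) \<partial>\<mu>) \<le> ennreal e" .
      then have s: "square_integrable \<mu> (\<lambda>x. f n x - g x)"
        by (auto simp: square_integrable_iff_nn_integral intro: le_less_trans)
      with le nn_integral_power2[OF s] e show ?thesis by (simp add: sq_dist_def)
    qed
    then show ?thesis by blast
  qed
  obtain n where "square_integrable \<mu> (\<lambda>x. f n x - g x)" using *[of 1] by fastforce
  from square_integrable_diff[OF f[of n] this] have g2: "square_integrable \<mu> g" by simp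
  have "(\<lambda>n. sq_dist \<mu> (f n) g) \<longlonglongrightarrow> 0"
  proof (rule LIMSEQ_I)
    fix e :: real assume "e > 0"
    then obtain N where "\<forall>n\<ge>N. sq_dist \<mu> (f n) g \<le> e / 2" using *[of "e / 2"] by auto
    with \<open>e > 0\<close> have "\<forall>n\<ge>N. norm (sq_dist \<mu> (f n) g - 0) < e" by (auto simp: sq_dist_nonneg abs_of_nonneg)
    then show "\<exists>N. \<forall>n\<ge>N. norm (sq_dist \<mu> (f n) g - 0) < e" by blast
  qed
  then show ?thesis using f g2 by (simp add: L2_tendsto_def)
qed

text \<open>The series with terms \<open>4\<^sup>k D\<^sub>k\<close> has integral at most the sum of the \<open>c / 2\<^sup>k\<close>; where its sum
  is finite, it bounds each of its terms.  This serves for completeness of \<open>L\<^sup>2\<close>, with \<open>D\<^sub>k\<close> a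
  squared difference, and for completeness of the martingale space, with \<open>D\<^sub>k\<close> the supremum
  of such squares over time.\<close>
lemma AE_geometric_bound:
  assumes [measurable]: "\<And>k. D k \<in> borel_measurable \<mu>"
    and b: "\<And>k. (\<integral>\<^sup>+x. D k x \<partial>\<mu>) \<le> ennreal (c * (1/8) ^ k)" and c: "c \<ge> 0"
  shows "AE x in \<mu>. \<exists>C\<ge>0. \<forall>k. D k x \<le> ennreal (C * (1/4) ^ k)"
proof -
  let ?E = "\<lambda>x. \<Sum>k. ennreal (4 ^ k) * D k x"
  have "(\<integral>\<^sup>+x. ?E x \<partial>\<mu>) = (\<Sum>k. \<integral>\<^sup>+x. ennreal (4 ^ k) * D k x \<partial>\<mu>)"
    by (rule nn_integral_suminf) measurable
  also have "\<dots> \<le> (\<Sum>k. ennreal (c * (1/2) ^ k))"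
  proof (intro suminf_le summableI allI)
    fix k
    have "(\<integral>\<^sup>+x. ennreal (4 ^ k) * D k x \<partial>\<mu>) \<le> ennreal (4 ^ k) * ennreal (c * (1/8) ^ k)"
      by (subst nn_integral_cmult) (auto intro: mult_left_mono b)
    also have "\<dots> = ennreal (4 ^ k * (c * (1/8) ^ k))"
      by (subst ennreal_mult'[symmetric]) simp_all
    also have "4 ^ k * (c * (1/8) ^ k) = c * (4 * (1/8)) ^ k"
      unfolding power_mult_distrib by simp
    also have "4 * (1/8) = (1/2 :: real)" by simp
    finally show "(\<integral>\<^sup>+x. ennreal (4 ^ k) * D k x \<partial>\<mu>) \<le> ennreal (c * (1/2) ^ k)" .
  qed
  also have "\<dots> = ennreal (\<Sum>k. c * (1/2) ^ k)"
    using c by (intro suminf_ennreal2) (auto intro!: summable_mult)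
  also have "\<dots> < \<infinity>" by simp
  finally have "(\<integral>\<^sup>+x. ?E x \<partial>\<mu>) \<noteq> \<infinity>" by simp
  then have "AE x in \<mu>. ?E x \<noteq> \<infinity>" by (intro nn_integral_noteq_infinite) measurable
  then show ?thesis
  proof eventually_elim
    case (elim x)
    have "D k x \<le> ennreal (enn2real (?E x) * (1/4) ^ k)" for k
    proof -
      have "ennreal (4 ^ k) * D k x \<le> ?E x" 
        using sum_le_suminf[OF summableI, of "{k}" "\<lambda>k. ennreal (4 ^ k) * D k x"] by simp
      then have "ennreal ((1/4) ^ k) * (ennreal (4 ^ k) * D k x) \<le> ennreal ((1/4) ^ k) * ?E x"
        by (rule mult_left_mono) simp
      also have "ennreal ((1/4) ^ k) * (ennreal (4 ^ k) * D k x) = D k x"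
        by (simp add: mult.assoc[symmetric] ennreal_mult'[symmetric] power_mult_distrib[symmetric])
      also have "ennreal ((1/4) ^ k) * ?E x = ennreal (enn2real (?E x) * (1/4) ^ k)"
        using elim by (simp add: ennreal_mult' mult.commute less_top)
      finally show ?thesis .
    qed
    then show ?case by (intro exI[of _ "enn2real (?E x)"]) auto
  qed
qed

lemma L2_Cauchy_fast_subseq:
  assumes "L2_Cauchy \<mu> f"
  obtains r :: "nat \<Rightarrow> nat" where "strict_mono r"
    "\<And>k. sq_dist \<mu> (f (r (Suc k))) (f (r k)) \<le> (1/8) ^ k"
proof -
  have "\<forall>k. \<exists>N. \<forall>m\<ge>N. \<forall>n\<ge>N. sq_dist \<mu> (f m) (f n) < (1/8) ^ k"
    using assms by (simp add: L2_Cauchy_def)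
  then obtain N where N: "\<And>k m n. m \<ge> N k \<Longrightarrow> n \<ge> N k \<Longrightarrow> sq_dist \<mu> (f m) (f n) < (1/8) ^ k"
    by metis
  define r where "r k = k + (\<Sum>i\<le>k. N i)" for k
  have rN: "r k \<ge> N k" for k unfolding r_def by (rule trans_le_add2) (rule member_le_sum, auto)
  have sm: "strict_mono r" unfolding strict_mono_Suc_iff r_def by simp
  have rN': "r (Suc k) \<ge> N k" for k using rN[of k] strict_monoD[OF sm, of k "Suc k"] by simp
  show ?thesis by (rule that[OF sm]) (use N[OF rN' rN] in \<open>auto intro: less_imp_le\<close>)
qed

lemma uniformly_convergent_geometric:
  fixes f :: "nat \<Rightarrow> 'a \<Rightarrow> real"
  assumes "\<And>k t. t \<in> A \<Longrightarrow> (f (Suc k) t - f k t)\<^sup>2 \<le> C * (1/4) ^ k" and C: "C \<ge> 0"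
  shows "uniformly_convergent_on A f"
proof -
  have b: "norm (f (Suc k) t - f k t) \<le> sqrt C * (1/2) ^ k" if "t \<in> A" for k t
  proof -
    have "\<bar>f (Suc k) t - f k t\<bar> \<le> sqrt (C * (1/4) ^ k)"
      using assms(1)[OF that, of k] by (simp add: real_le_rsqrt)
    also have "\<dots> = sqrt C * (1/2) ^ k"
      by (simp add: real_sqrt_mult real_sqrt_power real_sqrt_divide)
    finally show ?thesis by simp
  qed
  have "uniformly_convergent_on A (\<lambda>n t. \<Sum>i<n. f (Suc i) t - f i t)"
    by (rule Weierstrass_m_test'[OF b]) (auto intro!: summable_mult)
  then have "uniformly_convergent_on A (\<lambda>n t. f n t - f 0 t)"
    using sum_lessThan_telescope[of "\<lambda>i. f i t" for t] by simp
  then obtain l where "uniform_limit A (\<lambda>n t. f n t - f 0 t) l sequentially"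
    by (auto simp: uniformly_convergent_on_def)
  then have "uniform_limit A (\<lambda>n t. (f n t - f 0 t) + f 0 t) (\<lambda>t. l t + f 0 t) sequentially"
    by (intro uniform_limit_intros)
  then show ?thesis by (auto simp: uniformly_convergent_on_def)
qed

lemma L2_complete:
  assumes c: "L2_Cauchy \<mu> f"
  obtains g where "L2_tendsto \<mu> f g"
proof -
  have f: "square_integrable \<mu> (f n)" for n using c by (simp add: L2_Cauchy_def)
  have fm [measurable]: "f n \<in> borel_measurable \<mu>" for n using f by (simp add: square_integrable_def)
  obtain r where r: "strict_mono r" "\<And>k. sq_dist \<mu> (f (r (Suc k))) (f (r k)) \<le> (1/8) ^ k"
    using L2_Cauchy_fast_subseq[OF c] by blast
  have "AE x in \<mu>. \<exists>C\<ge>0. \<forall>k. ennreal ((f (r (Suc k)) x - f (r k) x)\<^sup>2) \<le> ennreal (C * (1/4) ^ k)"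
    by (rule AE_geometric_bound[where c = 1])
      (use r in \<open>auto simp: nn_integral_sq_dist[OF f f] intro!: ennreal_leI\<close>)
  then have "AE x in \<mu>. convergent (\<lambda>k. f (r k) x)"
  proof eventually_elim
    case (elim x)
    then obtain C where "C \<ge> 0" "\<And>k. (f (r (Suc k)) x - f (r k) x)\<^sup>2 \<le> C * (1/4) ^ k"
      by auto
    then have "uniformly_convergent_on {()} (\<lambda>k _. f (r k) x)"
      by (intro uniformly_convergent_geometric[of _ _ C]) auto
    then show ?case by (rule uniformly_convergent_imp_convergent) simp
  qed
  then have "AE x in \<mu>. (\<lambda>k. f (r k) x) \<longlonglongrightarrow> lim (\<lambda>k. f (r k) x)"
    by eventually_elim (simp add: convergent_LIMSEQ_iff)
  moreover have "(\<lambda>x. lim (\<lambda>k. f (r k) x)) \<in> borel_measurable \<mu>"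
    by (intro borel_measurable_lim_metric fm)
  ultimately show ?thesis
    using that L2_Cauchy_tendsto_AE[OF c _ r(1)] by blast
qed

text \<open>A sequence in \<open>V\<close> that minimises the distance to \<open>f\<close> is Cauchy by the parallelogram identity.
  Its limit \<open>g\<close> satisfies the variational inequality \<open>2 c \<langle>f - g, w\<rangle> \<le> c\<^sup>2 \<langle>w, w\<rangle>\<close> for all \<open>c\<close>, which
  forces \<open>\<langle>f - g, w\<rangle> = 0\<close>.\<close>
lemma L2_projection:
  assumes f: "square_integrable \<mu> f" and V: "\<And>v. v \<in> V \<Longrightarrow> square_integrable \<mu> v"
    and ne: "V \<noteq> {}" and lin: "\<And>v w c. v \<in> V \<Longrightarrow> w \<in> V \<Longrightarrow> (\<lambda>x. v x + c * w x) \<in> V"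
  obtains v g where "\<And>n. v n \<in> V" "L2_tendsto \<mu> v g"
    "\<And>w. w \<in> V \<Longrightarrow> (\<integral>x. (f x - g x) * w x \<partial>\<mu>) = 0"
proof -
  define d where "d = (INF v\<in>V. sq_dist \<mu> f v)"
  have bdd: "bdd_below (sq_dist \<mu> f ` V)" by (rule bdd_belowI[of _ 0]) (auto simp: sq_dist_nonneg)
  have d_le: "d \<le> sq_dist \<mu> f v" if "v \<in> V" for v
    unfolding d_def using bdd that by (rule cINF_lower)
  have "\<exists>v\<in>V. sq_dist \<mu> f v < d + inverse (real (Suc n))" for n
  proof -
    have "d < d + inverse (real (Suc n))" by simp
    then show ?thesis unfolding d_def using cINF_less_iff[OF ne bdd] by blast
  qed
  then obtain v where v: "\<And>n. v n \<in> V" and vd: "\<And>n. sq_dist \<mu> f (v n) < d + inverse (real (Suc n))"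
    by metis
  note vs = V[OF v]
  note sd = square_integrable_power2[OF square_integrable_diff]
  have par: "sq_dist \<mu> (v m) (v n) \<le> 2 * inverse (real (Suc m)) + 2 * inverse (real (Suc n))" for m n
  proof -
    let ?m = "\<lambda>x. (v m x + v n x) / 2"
    have "(\<lambda>x. v m x + (1/2) * (v n x + (-1) * v m x)) \<in> V" by (rule lin[OF v lin[OF v v]])
    then have mV: "?m \<in> V" by (simp add: field_simps)
    have "sq_dist \<mu> (v m) (v n) = (\<integral>x. 2 * (f x - v m x)\<^sup>2 + 2 * (f x - v n x)\<^sup>2 - 4 * (f x - ?m x)\<^sup>2 \<partial>\<mu>)"
      unfolding sq_dist_def by (intro Bochner_Integration.integral_cong refl) (simp add: power2_eq_square field_simps)
    also have "\<dots> = 2 * sq_dist \<mu> f (v m) + 2 * sq_dist \<mu> f (v n) - 4 * sq_dist \<mu> f ?m"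
      unfolding sq_dist_def using sd[OF f vs[of m]] sd[OF f vs[of n]] sd[OF f V[OF mV]] by simp
    also have "\<dots> \<le> 2 * inverse (real (Suc m)) + 2 * inverse (real (Suc n))"
      using vd[of m] vd[of n] d_le[OF mV] by linarith
    finally show ?thesis .
  qed
  have "L2_Cauchy \<mu> v"
    unfolding L2_Cauchy_def
  proof (intro conjI allI impI vs)
    fix e :: real assume e: "e > 0"
    then obtain N where N: "inverse (real (Suc N)) < e / 4" using reals_Archimedean[of "e / 4"] by auto
    have "sq_dist \<mu> (v m) (v n) < e" if mn: "m \<ge> N" "n \<ge> N" for m n
    proof -
      have "inverse (real (Suc k)) < e / 4" if "k \<ge> N" for k
      proof -
        have "inverse (real (Suc k)) \<le> inverse (real (Suc N))"
          by (rule le_imp_inverse_le) (use that in simp_all)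
        with N show ?thesis by linarith
      qed
      from this[OF mn(1)] this[OF mn(2)] par[of m n] show ?thesis
        by linarith
    qed
    then show "\<exists>N. \<forall>m\<ge>N. \<forall>n\<ge>N. sq_dist \<mu> (v m) (v n) < e" by blast
  qed
  then obtain g where g: "L2_tendsto \<mu> v g" by (rule L2_complete)
  have gs: "square_integrable \<mu> g" using g by (simp add: L2_tendsto_def)
  have "(\<integral>x. (f x - g x) * w x \<partial>\<mu>) = 0" if w: "w \<in> V" for w
  proof -
    note ws = V[OF w]
    let ?a = "\<integral>x. (f x - g x) * w x \<partial>\<mu>" and ?b = "\<integral>x. (w x)\<^sup>2 \<partial>\<mu>"
    have a: "(\<lambda>n. \<integral>x. (f x - v n x) * w x \<partial>\<mu>) \<longlonglongrightarrow> ?a"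
    proof -
      have "(\<lambda>n. (\<integral>x. f x * w x \<partial>\<mu>) - (\<integral>x. v n x * w x \<partial>\<mu>))
          \<longlonglongrightarrow> (\<integral>x. f x * w x \<partial>\<mu>) - (\<integral>x. g x * w x \<partial>\<mu>)"
        by (intro tendsto_intros L2_tendsto_integral_mult[OF g ws])
      then show ?thesis
        using square_integrable_mult[OF f ws] square_integrable_mult[OF gs ws]
          square_integrable_mult[OF vs ws] by (simp add: left_diff_distrib)
    qed
    \<comment> \<open>Moving from the minimising sequence in the direction \<open>w\<close> cannot go below \<open>d\<close>.\<close>
    have *: "2 * c * ?a \<le> c\<^sup>2 * ?b" for c
    proof -
      have "2 * c * (\<integral>x. (f x - v n x) * w x \<partial>\<mu>) \<le> inverse (real (Suc n)) + c\<^sup>2 * ?b" for n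
      proof -
        have "d \<le> sq_dist \<mu> f (\<lambda>x. v n x + c * w x)" by (rule d_le[OF lin[OF v w]])
        also have "\<dots> = (\<integral>x. (f x - v n x)\<^sup>2 - 2 * c * ((f x - v n x) * w x) + c\<^sup>2 * (w x)\<^sup>2 \<partial>\<mu>)"
          unfolding sq_dist_def by (intro Bochner_Integration.integral_cong refl) (simp add: power2_eq_square algebra_simps)
        also have "\<dots> = sq_dist \<mu> f (v n) - 2 * c * (\<integral>x. (f x - v n x) * w x \<partial>\<mu>) + c\<^sup>2 * ?b"
          unfolding sq_dist_def using sd[OF f vs[of n]] square_integrable_power2[OF ws]
            square_integrable_mult[OF square_integrable_diff[OF f vs[of n]] ws] by simp
        finally show ?thesis using vd[of n] by linarith
      qed
      moreover have "(\<lambda>n. 2 * c * (\<integral>x. (f x - v n x) * w x \<partial>\<mu>)) \<longlonglongrightarrow> 2 * c * ?a"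
        by (intro tendsto_intros a)
      moreover have "(\<lambda>n. inverse (real (Suc n)) + c\<^sup>2 * ?b) \<longlonglongrightarrow> 0 + c\<^sup>2 * ?b"
        using LIMSEQ_inverse_real_of_nat by (intro tendsto_intros)
      ultimately show ?thesis by (auto intro: LIMSEQ_le)
    qed
    show "?a = 0"
    proof (cases "?b = 0")
      case True
      with *[of 1] *[of "-1"] show ?thesis by simp
    next
      case False
      moreover have "0 \<le> ?b" by simp
      ultimately have b: "?b > 0" by linarith
      have aux: "a = 0" if "2 * (a / b) * a \<le> (a / b)\<^sup>2 * b" "b > 0" for a b :: real
      proof -
        have "2 * (a / b) * a * b = 2 * a\<^sup>2" "(a / b)\<^sup>2 * b * b = a\<^sup>2"
          using that(2) by (simp_all add: power2_eq_square)
        moreover have "2 * (a / b) * a * b \<le> (a / b)\<^sup>2 * b * b"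
          by (rule mult_right_mono[OF that(1)]) (use that(2) in simp)
        ultimately have "a\<^sup>2 \<le> 0" by linarith
        then show ?thesis by simp
      qed
      show ?thesis by (rule aux[OF *[of "?a / ?b"] b])
    qed
  qed
  with v g that show ?thesis by blast
qed

section \<open>Paths on a time scale\<close>

locale filtered_time_scale = prob_space P for P :: "'w measure" +
  fixes \<T> :: "real set" and T :: real and F :: "real \<Rightarrow> 'w measure"
  assumes time_scale: "time_scale \<T> T"
    and filtration: "filtration_on P \<T> F"
    and usual: "usual_conditions P \<T> F"
begin

lemma T_in: "T \<in> \<T>" and zero_in: "0 \<in> \<T>" and T_closed: "closed \<T>"
  and T_bounds: "t \<in> \<T> \<Longrightarrow> 0 \<le> t \<and> t \<le> T"
  using time_scale by (auto simp: time_scale_def)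

lemma subalg: "t \<in> \<T> \<Longrightarrow> subalgebra P (F t)"
  using filtration by (simp add: filtration_on_def)

lemma F_mono: "s \<in> \<T> \<Longrightarrow> t \<in> \<T> \<Longrightarrow> s \<le> t \<Longrightarrow> sets (F s) \<subseteq> sets (F t)"
  using filtration by (simp add: filtration_on_def)

lemma space_F: "t \<in> \<T> \<Longrightarrow> space (F t) = space P"
  using subalg by (auto simp: subalgebra_def)

lemma sets_F: "t \<in> \<T> \<Longrightarrow> A \<in> sets (F t) \<Longrightarrow> A \<in> sets P"
  using subalg by (auto simp: subalgebra_def)

lemma measurable_F_P: "t \<in> \<T> \<Longrightarrow> f \<in> borel_measurable (F t) \<Longrightarrow> f \<in> borel_measurable P"
  using subalg measurable_from_subalg by blast

lemma measurable_F_mono: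
  assumes "s \<in> \<T>" "t \<in> \<T>" "s \<le> t" "f \<in> borel_measurable (F s)"
  shows "f \<in> borel_measurable (F t)"
  using assms F_mono[OF assms(1-3)] space_F by (auto simp: measurable_def)

lemma null_sets_F: "t \<in> \<T> \<Longrightarrow> N \<in> null_sets P \<Longrightarrow> N \<in> sets (F t)"
  using usual by (auto simp: usual_conditions_def)

definition right_continuous_path :: "(real \<Rightarrow> 'e::real_normed_vector) \<Rightarrow> bool" where
  "right_continuous_path h \<longleftrightarrow> (\<forall>t\<in>\<T>. (h \<longlongrightarrow> h t) (at t within \<T> \<inter> {t<..}))"

text \<open>Rounding the positive rationals down into the time scale gives a countable set that has points
  in \<open>[t, t + e)\<close> for each time \<open>t\<close> and each \<open>e > 0\<close>.  In particular it contains every time that is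
  isolated from the right.\<close>
definition right_skeleton :: "real set" where
  "right_skeleton = (\<lambda>q. Sup {s\<in>\<T>. s \<le> q}) ` (\<rat> \<inter> {0<..})"

lemma countable_right_skeleton: "countable right_skeleton"
  unfolding right_skeleton_def using countable_rat by blast

lemma Sup_below_in:
  assumes "q \<ge> 0"
  shows "Sup {s\<in>\<T>. s \<le> q} \<in> \<T>" "Sup {s\<in>\<T>. s \<le> q} \<le> q" "\<And>t. t \<in> \<T> \<Longrightarrow> t \<le> q \<Longrightarrow> t \<le> Sup {s\<in>\<T>. s \<le> q}"
proof -
  have bdd: "bdd_above {s\<in>\<T>. s \<le> q}" by (rule bdd_aboveI[of _ q]) auto
  have ne: "{s\<in>\<T>. s \<le> q} \<noteq> {}" using zero_in assms by auto
  have cl: "closed {s\<in>\<T>. s \<le> q}"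
    using closed_Int[OF T_closed closed_atMost[of q]] by (simp add: Int_def)
  show "Sup {s\<in>\<T>. s \<le> q} \<in> \<T>" "Sup {s\<in>\<T>. s \<le> q} \<le> q"
    using closed_contains_Sup[OF ne bdd cl] by auto
  show "\<And>t. t \<in> \<T> \<Longrightarrow> t \<le> q \<Longrightarrow> t \<le> Sup {s\<in>\<T>. s \<le> q}"
    by (rule cSup_upper[OF _ bdd]) auto
qed

lemma right_skeleton_subset: "right_skeleton \<subseteq> \<T>"
  unfolding right_skeleton_def using Sup_below_in(1) by auto

lemma right_skeleton_dense:
  assumes t: "t \<in> \<T>" and e: "e > 0"
  obtains d where "d \<in> right_skeleton" "t \<le> d" "d < t + e"
proof -
  obtain q where q: "q \<in> \<rat>" "t < q" "q < t + e" using Rats_dense_in_real[of t "t + e"] e by auto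
  have "0 < q" using T_bounds[OF t] q by linarith
  then have "Sup {s\<in>\<T>. s \<le> q} \<in> right_skeleton" using q by (auto simp: right_skeleton_def)
  moreover have "t \<le> Sup {s\<in>\<T>. s \<le> q}" "Sup {s\<in>\<T>. s \<le> q} \<le> q"
    using Sup_below_in(2,3)[of q] t q \<open>0 < q\<close> by auto
  ultimately show ?thesis using that q(3) by fastforce
qed

lemma T_in_right_skeleton: "T \<in> right_skeleton"
proof -
  obtain d where d: "d \<in> right_skeleton" "T \<le> d" "d < T + 1"
    by (rule right_skeleton_dense[OF T_in, of 1]) simp
  then have "d = T" using T_bounds right_skeleton_subset by force
  with d show ?thesis by simp
qed

text \<open>Suprema over an uncountable set of times need not be measurable; for right-continuous paths
  they reduce to suprema over the skeleton.\<close>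
lemma SUP_right_continuous_path:
  assumes h: "right_continuous_path h"
  shows "(SUP t\<in>\<T>. ennreal ((norm (h t))\<^sup>2)) = (SUP t\<in>right_skeleton. ennreal ((norm (h t))\<^sup>2))"
proof (rule antisym)
  show "(SUP t\<in>right_skeleton. ennreal ((norm (h t))\<^sup>2)) \<le> (SUP t\<in>\<T>. ennreal ((norm (h t))\<^sup>2))"
    using right_skeleton_subset by (rule SUP_subset_mono) simp
  show "(SUP t\<in>\<T>. ennreal ((norm (h t))\<^sup>2)) \<le> (SUP t\<in>right_skeleton. ennreal ((norm (h t))\<^sup>2))"
  proof (rule SUP_least)
    fix t assume t: "t \<in> \<T>"
    let ?S = "SUP t\<in>right_skeleton. ennreal ((norm (h t))\<^sup>2)"
    show "ennreal ((norm (h t))\<^sup>2) \<le> ?S"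
    proof (cases "t \<in> right_skeleton")
      case True
      then show ?thesis by (rule SUP_upper)
    next
      case False
      have "((\<lambda>s. ennreal ((norm (h s))\<^sup>2)) \<longlongrightarrow> ennreal ((norm (h t))\<^sup>2)) (at t within \<T> \<inter> {t<..})"
        using h t by (intro tendsto_intros) (auto simp: right_continuous_path_def)
      moreover have "at t within right_skeleton \<inter> {t<..} \<le> at t within \<T> \<inter> {t<..}"
        by (rule at_le) (use right_skeleton_subset in auto)
      ultimately have lim: "((\<lambda>s. ennreal ((norm (h s))\<^sup>2)) \<longlongrightarrow> ennreal ((norm (h t))\<^sup>2))
          (at t within right_skeleton \<inter> {t<..})"
        by (meson tendsto_mono)
      have "t islimpt (right_skeleton \<inter> {t<..})"
        unfolding islimpt_approachable
      proof (intro allI impI)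
        fix e :: real assume "e > 0"
        then obtain d where d: "d \<in> right_skeleton" "t \<le> d" "d < t + e"
          by (rule right_skeleton_dense[OF t])
        moreover have "d \<noteq> t" using False d by auto
        ultimately show "\<exists>x'\<in>right_skeleton \<inter> {t<..}. x' \<noteq> t \<and> dist x' t < e"
          by (intro bexI[of _ d]) (auto simp: dist_real_def)
      qed
      then have nt: "\<not> trivial_limit (at t within right_skeleton \<inter> {t<..})"
        by (simp add: trivial_limit_within)
      show ?thesis
        by (rule tendsto_upperbound[OF lim _ nt])
          (auto simp: eventually_at_filter intro!: always_eventually SUP_upper)
    qed
  qed
qed

section \<open>Martingales and Doob's inequality\<close>

lemma sigma_finite_F: "t \<in> \<T> \<Longrightarrow> sigma_finite_subalgebra P (F t)"
  by (rule finite_measure_subalgebra_is_sigma_finite)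
    (simp add: finite_measure_subalgebra_def finite_measure_axioms finite_measure_subalgebra_axioms_def subalg)

lemma martingale_on_realI:
  fixes X :: "real \<Rightarrow> 'w \<Rightarrow> real"
  assumes ad: "\<And>t. t \<in> \<T> \<Longrightarrow> X t \<in> borel_measurable (F t)"
    and int: "\<And>t. t \<in> \<T> \<Longrightarrow> integrable P (X t)"
    and eq: "\<And>s t A. s \<in> \<T> \<Longrightarrow> t \<in> \<T> \<Longrightarrow> s \<le> t \<Longrightarrow> A \<in> sets (F s) \<Longrightarrow>
      (\<integral>\<omega>. indicator A \<omega> * X t \<omega> \<partial>P) = (\<integral>\<omega>. indicator A \<omega> * X s \<omega> \<partial>P)"
  shows "martingale_on P \<T> F X"
  unfolding martingale_on_def
proof (intro conjI ballI impI)
  show "adapted \<T> F X" using ad by (simp add: adapted_def)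
  show "integrable P (X t)" if "t \<in> \<T>" for t by (rule int[OF that])
  fix s t and e :: real assume st: "s \<in> \<T>" "t \<in> \<T>" "s \<le> t" and e: "e \<in> Basis"
  interpret G: sigma_finite_subalgebra P "F s" by (rule sigma_finite_F[OF st(1)])
  have "AE \<omega> in P. real_cond_exp P (F s) (X t) \<omega> = X s \<omega>"
  proof (rule G.real_cond_exp_charact)
    show "(\<integral>\<omega>\<in>A. X t \<omega> \<partial>P) = (\<integral>\<omega>\<in>A. X s \<omega> \<partial>P)" if "A \<in> sets (F s)" for A
      using eq[OF st that] by (simp add: set_lebesgue_integral_def)
  qed (rule int[OF st(2)] int[OF st(1)] ad[OF st(1)])+
  with e show "AE \<omega> in P. real_cond_exp P (F s) (\<lambda>\<omega>. X t \<omega> \<bullet> e) \<omega> = X s \<omega> \<bullet> e" by simp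
qed

lemma martingale_on_realD:
  fixes X :: "real \<Rightarrow> 'w \<Rightarrow> real"
  assumes m: "martingale_on P \<T> F X" and st: "s \<in> \<T>" "t \<in> \<T>" "s \<le> t"
    and Y: "Y \<in> borel_measurable (F s)"
    and i: "integrable P (\<lambda>\<omega>. Y \<omega> * X t \<omega>)" 
  shows "(\<integral>\<omega>. Y \<omega> * X t \<omega> \<partial>P) = (\<integral>\<omega>. Y \<omega> * X s \<omega> \<partial>P)"
proof -
  interpret G: sigma_finite_subalgebra P "F s" by (rule sigma_finite_F[OF st(1)])
  have X: "integrable P (X u)" if "u \<in> \<T>" for u using m that by (simp add: martingale_on_def)
  have [measurable]: "X t \<in> borel_measurable P" "X s \<in> borel_measurable P" "Y \<in> borel_measurable P"
    using X st measurable_F_P[OF st(1) Y] by auto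
  have ae: "AE \<omega> in P. real_cond_exp P (F s) (X t) \<omega> = X s \<omega>"
    using m st by (simp add: martingale_on_def)
  have "(\<integral>\<omega>. Y \<omega> * X t \<omega> \<partial>P) = (\<integral>\<omega>. Y \<omega> * real_cond_exp P (F s) (X t) \<omega> \<partial>P)"
    by (rule G.real_cond_exp_intg(2)[symmetric, OF i Y]) measurable
  also have "\<dots> = (\<integral>\<omega>. Y \<omega> * X s \<omega> \<partial>P)"
    by (rule integral_cong_AE) (use ae in \<open>auto intro!: borel_measurable_times borel_measurable_cond_exp2\<close>)
  finally show ?thesis .
qed

lemma martingale_on_Basis:
  fixes X :: "real \<Rightarrow> 'w \<Rightarrow> 'e::euclidean_space"
  shows "martingale_on P \<T> F X \<longleftrightarrow> (\<forall>e\<in>Basis. martingale_on P \<T> F (\<lambda>t \<omega>. X t \<omega> \<bullet> e))"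
proof -
  have a: "adapted \<T> F X \<longleftrightarrow> (\<forall>e\<in>Basis. adapted \<T> F (\<lambda>t \<omega>. X t \<omega> \<bullet> e))"
    unfolding adapted_def by (auto simp: borel_measurable_euclidean_space[where f = "X _"])
  have i: "integrable P f \<longleftrightarrow> (\<forall>e\<in>Basis. integrable P (\<lambda>\<omega>. f \<omega> \<bullet> e))" for f :: "'w \<Rightarrow> 'e"
  proof
    assume *: "\<forall>e\<in>Basis. integrable P (\<lambda>\<omega>. f \<omega> \<bullet> e)"
    have "integrable P (\<lambda>\<omega>. \<Sum>e\<in>Basis. (f \<omega> \<bullet> e) *\<^sub>R e)"
      by (rule Bochner_Integration.integrable_sum) (use * in auto)
    then show "integrable P f" by (simp add: euclidean_representation)
  qed auto
  show ?thesis
    unfolding martingale_on_def a i[of "X _"] by auto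
qed

text \<open>A discrete integral of the running maximum against the path itself, estimated pathwise.  If the
  maximum does not change in a step, both sides grow by the same amount; if it jumps to the new value
  \<open>y\<close> from \<open>m\<close>, the right-hand side gains an extra \<open>(y - m)\<^sup>2 / 2\<close>.\<close>
lemma maximal_sum_le:
  fixes x :: "nat \<Rightarrow> real"
  assumes "x 0 \<ge> 0"
  shows "(\<Sum>k<n. Max (x ` {..k}) * (x (Suc k) - x k)) \<le> Max (x ` {..n}) * x n - (Max (x ` {..n}))\<^sup>2 / 2"
proof (induction n)
  case 0
  then show ?case by (simp add: power2_eq_square)
next
  case (Suc n)
  let ?m = "Max (x ` {..n})" and ?y = "x (Suc n)"
  have M: "Max (x ` {..Suc n}) = max ?y ?m"
    by (simp add: atMost_Suc)
  have "(\<Sum>k<Suc n. Max (x ` {..k}) * (x (Suc k) - x k)) \<le> ?m * ?y - ?m\<^sup>2 / 2"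
    using Suc by (simp add: algebra_simps)
  also have "\<dots> \<le> max ?y ?m * ?y - (max ?y ?m)\<^sup>2 / 2"
    using zero_le_power2[of "?y - ?m"] by (auto simp: max_def power2_eq_square algebra_simps)
  finally show ?case by (simp only: M)
qed

text \<open>Let \<open>x\<^sub>k = \<bar>X\<^sub>k\<bar>\<close> and \<open>S\<^sub>k\<close> its running maximum.  The pathwise estimate and
  \<open>S\<^sub>n x\<^sub>n \<le> S\<^sub>n\<^sup>2 / 4 + x\<^sub>n\<^sup>2\<close> give \<open>S\<^sub>n\<^sup>2 \<le> 4 x\<^sub>n\<^sup>2 - 4 \<Sum>\<^sub>k S\<^sub>k (x\<^sub>k\<^sub>+\<^sub>1 - x\<^sub>k)\<close>.  Each summand has nonnegative
  expectation: it dominates \<open>S\<^sub>k sgn X\<^sub>k (X\<^sub>k\<^sub>+\<^sub>1 - X\<^sub>k)\<close>, which has mean \<open>0\<close>.\<close>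
lemma Doob_finite:
  fixes X :: "real \<Rightarrow> 'w \<Rightarrow> real" and \<tau> :: "nat \<Rightarrow> real"
  assumes m: "martingale_on P \<T> F X" and sq: "\<And>t. t \<in> \<T> \<Longrightarrow> square_integrable P (X t)"
    and \<tau>: "mono \<tau>" "\<And>k. \<tau> k \<in> \<T>"
  shows "(\<integral>\<^sup>+\<omega>. ennreal ((Max ((\<lambda>k. \<bar>X (\<tau> k) \<omega>\<bar>) ` {..n}))\<^sup>2) \<partial>P)
     \<le> 4 * (\<integral>\<^sup>+\<omega>. ennreal ((X (\<tau> n) \<omega>)\<^sup>2) \<partial>P)"
proof -
  define x where "x \<omega> k = \<bar>X (\<tau> k) \<omega>\<bar>" for \<omega> k
  define S where "S k \<omega> = Max (x \<omega> ` {..k})" for k \<omega>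
  have Xad: "X t \<in> borel_measurable (F t)" if "t \<in> \<T>" for t
    using m that by (simp add: martingale_on_def adapted_def)
  have S_ad: "S k \<in> borel_measurable (F (\<tau> k))" for k
  proof -
    have "(\<lambda>\<omega>. Max ((\<lambda>i. x \<omega> i) ` {..k})) \<in> borel_measurable (F (\<tau> k))"
    proof (rule borel_measurable_Max)
      fix i assume "i \<in> {..k}"
      then have "\<tau> i \<le> \<tau> k" using \<tau>(1) by (auto dest: monoD)
      then show "(\<lambda>\<omega>. x \<omega> i) \<in> borel_measurable (F (\<tau> k))"
        unfolding x_def using measurable_F_mono[OF \<tau>(2) \<tau>(2) _ Xad[OF \<tau>(2)]] by measurable
    qed auto
    then show ?thesis by (simp add: S_def[abs_def])
  qed
  have S_nn: "0 \<le> S k \<omega>" for k \<omega>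
    unfolding S_def by (rule order_trans[OF _ Max_ge[of _ "x \<omega> 0"]]) (auto simp: x_def)
  have S_le: "S k \<omega> \<le> (\<Sum>i\<le>k. \<bar>X (\<tau> i) \<omega>\<bar>)" for k \<omega>
    unfolding S_def x_def by (subst Max_le_iff) (auto intro!: member_le_sum)
  have abs_sq: "square_integrable P (\<lambda>\<omega>. \<bar>X (\<tau> k) \<omega>\<bar>)" for k
    using sq[OF \<tau>(2), of k] by (auto simp: square_integrable_def)
  have S_sq: "square_integrable P (S k)" for k
  proof (rule square_integrable_dominated)
    show "square_integrable P (\<lambda>\<omega>. \<Sum>i\<le>k. \<bar>X (\<tau> i) \<omega>\<bar>)"
      by (rule square_integrable_sum) (rule abs_sq)
    show "S k \<in> borel_measurable P" by (rule measurable_F_P[OF \<tau>(2) S_ad])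
    show "AE \<omega> in P. \<bar>S k \<omega>\<bar> \<le> \<bar>\<Sum>i\<le>k. \<bar>X (\<tau> i) \<omega>\<bar>\<bar>"
      using S_le S_nn by (auto simp: sum_nonneg)
  qed
  have step: "0 \<le> (\<integral>\<omega>. S k \<omega> * (x \<omega> (Suc k) - x \<omega> k) \<partial>P)" for k
  proof -
    let ?Y = "\<lambda>\<omega>. sgn (X (\<tau> k) \<omega>) * S k \<omega>"
    have le: "\<tau> k \<le> \<tau> (Suc k)" using \<tau>(1) by (simp add: monoD)
    have Y: "?Y \<in> borel_measurable (F (\<tau> k))"
      using S_ad[of k] Xad[OF \<tau>(2), of k] by measurable
    have Ysq: "square_integrable P ?Y"
      by (rule square_integrable_bounded_mult[OF S_sq, where c = 1])
        (use measurable_F_P[OF \<tau>(2) Xad[OF \<tau>(2)], of k] in \<open>auto simp: sgn_if\<close>)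
    note int = square_integrable_mult[OF Ysq sq[OF \<tau>(2)]]
    have "(\<integral>\<omega>. ?Y \<omega> * X (\<tau> (Suc k)) \<omega> \<partial>P) = (\<integral>\<omega>. ?Y \<omega> * X (\<tau> k) \<omega> \<partial>P)"
      by (rule martingale_on_realD[OF m \<tau>(2) \<tau>(2) le Y int])
    then have "0 = (\<integral>\<omega>. ?Y \<omega> * X (\<tau> (Suc k)) \<omega> - ?Y \<omega> * X (\<tau> k) \<omega> \<partial>P)"
      using int by simp
    also have "\<dots> \<le> (\<integral>\<omega>. S k \<omega> * (x \<omega> (Suc k) - x \<omega> k) \<partial>P)"
    proof (rule integral_mono)
      show "integrable P (\<lambda>\<omega>. ?Y \<omega> * X (\<tau> (Suc k)) \<omega> - ?Y \<omega> * X (\<tau> k) \<omega>)"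
        using int by simp
      show "integrable P (\<lambda>\<omega>. S k \<omega> * (x \<omega> (Suc k) - x \<omega> k))"
        unfolding x_def by (intro square_integrable_mult square_integrable_diff S_sq abs_sq)
      fix \<omega>
      have "sgn a * b - sgn a * a \<le> \<bar>b\<bar> - \<bar>a\<bar>" for a b :: real
        by (auto simp: sgn_if)
      from mult_left_mono[OF this S_nn[of k \<omega>], of "X (\<tau> k) \<omega>" "X (\<tau> (Suc k)) \<omega>"]
      show "?Y \<omega> * X (\<tau> (Suc k)) \<omega> - ?Y \<omega> * X (\<tau> k) \<omega> \<le> S k \<omega> * (x \<omega> (Suc k) - x \<omega> k)"
        by (simp add: x_def algebra_simps)
    qed
    finally show ?thesis .
  qed
  have int: "integrable P (\<lambda>\<omega>. S k \<omega> * (x \<omega> (Suc k) - x \<omega> k))" for k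
    unfolding x_def by (intro square_integrable_mult square_integrable_diff S_sq abs_sq)
  have "(\<integral>\<omega>. (S n \<omega>)\<^sup>2 \<partial>P) \<le> (\<integral>\<omega>. 4 * (X (\<tau> n) \<omega>)\<^sup>2 - 4 * (\<Sum>k<n. S k \<omega> * (x \<omega> (Suc k) - x \<omega> k)) \<partial>P)"
  proof (rule integral_mono)
    show "integrable P (\<lambda>\<omega>. (S n \<omega>)\<^sup>2)" using S_sq by (rule square_integrable_power2)
    show "integrable P (\<lambda>\<omega>. 4 * (X (\<tau> n) \<omega>)\<^sup>2 - 4 * (\<Sum>k<n. S k \<omega> * (x \<omega> (Suc k) - x \<omega> k)))"
      using int square_integrable_power2[OF sq[OF \<tau>(2)]] by simp
    fix \<omega>
    have "(\<Sum>k<n. S k \<omega> * (x \<omega> (Suc k) - x \<omega> k)) \<le> S n \<omega> * x \<omega> n - (S n \<omega>)\<^sup>2 / 2"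
      unfolding S_def by (rule maximal_sum_le) (simp add: x_def)
    moreover have "S n \<omega> * x \<omega> n \<le> (S n \<omega>)\<^sup>2 / 4 + (x \<omega> n)\<^sup>2"
      using zero_le_power2[of "S n \<omega> / 2 - x \<omega> n"] by (simp add: power2_eq_square algebra_simps)
    moreover have "(x \<omega> n)\<^sup>2 = (X (\<tau> n) \<omega>)\<^sup>2" by (simp add: x_def)
    ultimately show "(S n \<omega>)\<^sup>2 \<le> 4 * (X (\<tau> n) \<omega>)\<^sup>2 - 4 * (\<Sum>k<n. S k \<omega> * (x \<omega> (Suc k) - x \<omega> k))"
      by linarith
  qed
  also have "\<dots> = 4 * (\<integral>\<omega>. (X (\<tau> n) \<omega>)\<^sup>2 \<partial>P) - 4 * (\<Sum>k<n. \<integral>\<omega>. S k \<omega> * (x \<omega> (Suc k) - x \<omega> k) \<partial>P)"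
    using int square_integrable_power2[OF sq[OF \<tau>(2)]] by simp
  also have "\<dots> \<le> 4 * (\<integral>\<omega>. (X (\<tau> n) \<omega>)\<^sup>2 \<partial>P)"
    using step by (simp add: sum_nonneg)
  finally have "ennreal (\<integral>\<omega>. (S n \<omega>)\<^sup>2 \<partial>P) \<le> ennreal (4 * (\<integral>\<omega>. (X (\<tau> n) \<omega>)\<^sup>2 \<partial>P))"
    by (rule ennreal_leI)
  then have "(\<integral>\<^sup>+\<omega>. ennreal ((S n \<omega>)\<^sup>2) \<partial>P) \<le> 4 * (\<integral>\<^sup>+\<omega>. ennreal ((X (\<tau> n) \<omega>)\<^sup>2) \<partial>P)"
    by (simp add: nn_integral_power2[OF S_sq] nn_integral_power2[OF sq[OF \<tau>(2)]] ennreal_mult')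
  then show ?thesis by (simp add: S_def x_def)
qed

text \<open>Monotone convergence from finite sets of times, to each of which \<open>T\<close> is added so that the bound
  always refers to \<open>X T\<close>.\<close>
lemma Doob_skeleton:
  fixes X :: "real \<Rightarrow> 'w \<Rightarrow> real"
  assumes m: "martingale_on P \<T> F X" and sq: "\<And>t. t \<in> \<T> \<Longrightarrow> square_integrable P (X t)"
  shows "(\<integral>\<^sup>+\<omega>. (SUP t\<in>right_skeleton. ennreal ((X t \<omega>)\<^sup>2)) \<partial>P)
     \<le> 4 * (\<integral>\<^sup>+\<omega>. ennreal ((X T \<omega>)\<^sup>2) \<partial>P)"
proof -
  have ne: "right_skeleton \<noteq> {}" using T_in_right_skeleton by auto
  define d where "d = from_nat_into right_skeleton"
  have rd: "range d = right_skeleton" unfolding d_def by (rule range_from_nat_into[OF ne countable_right_skeleton])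
  have dT: "d k \<in> \<T>" for k using rd right_skeleton_subset by auto
  have Xm [measurable]: "X (d k) \<in> borel_measurable P" for k
    using sq[OF dT] by (simp add: square_integrable_def)
  let ?g = "\<lambda>n \<omega>. SUP i\<in>{..n}. ennreal ((X (d i) \<omega>)\<^sup>2)"
  have fin: "(\<integral>\<^sup>+\<omega>. ?g n \<omega> \<partial>P) \<le> 4 * (\<integral>\<^sup>+\<omega>. ennreal ((X T \<omega>)\<^sup>2) \<partial>P)" for n
  proof -
    define A where "A = insert T (d ` {..n})"
    define l where "l = sorted_list_of_set A"
    have A: "finite A" "A \<noteq> {}" "A \<subseteq> \<T>" using dT T_in by (auto simp: A_def)
    have l: "set l = A" "sorted l" "l \<noteq> []" using A by (auto simp: l_def)
    define L where "L = length l - 1"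
    define \<tau> where "\<tau> k = l ! min k L" for k
    have "L < length l" using l(3) by (cases l) (simp_all add: L_def)
    then have L: "min k L < length l" for k by (rule min.strict_coboundedI2)
    have \<tau>T: "\<tau> k \<in> \<T>" for k using A(3) l(1) nth_mem[OF L] by (auto simp: \<tau>_def)
    have mono: "mono \<tau>"
      unfolding \<tau>_def by (intro monoI sorted_nth_mono[OF l(2)] L) auto
    have img: "\<tau> ` {..L} = A"
    proof -
      have "\<tau> ` {..L} = (\<lambda>k. l ! k) ` {..<length l}"
        using l(3) unfolding \<tau>_def L_def by (intro image_cong) (auto simp: less_Suc_eq_le[symmetric] min_def)
      also have "\<dots> = A" using l(1) by (auto simp: set_conv_nth)
      finally show ?thesis .
    qed
    have "\<tau> L = T"
    proof -
      have "T \<in> \<tau> ` {..L}" unfolding img by (simp add: A_def)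
      then obtain k where "k \<le> L" "\<tau> k = T" by force
      then have "T \<le> \<tau> L" using mono by (auto dest: monoD)
      with T_bounds[OF \<tau>T[of L]] show ?thesis by simp
    qed
    have "(\<integral>\<^sup>+\<omega>. ?g n \<omega> \<partial>P) \<le> (\<integral>\<^sup>+\<omega>. ennreal ((Max ((\<lambda>k. \<bar>X (\<tau> k) \<omega>\<bar>) ` {..L}))\<^sup>2) \<partial>P)"
    proof (intro nn_integral_mono SUP_least)
      fix \<omega> i assume "i \<in> {..n}"
      then have "d i \<in> \<tau> ` {..L}" unfolding img by (simp add: A_def)
      then obtain k where k: "k \<le> L" "\<tau> k = d i" by force
      then have "\<bar>X (d i) \<omega>\<bar> \<le> Max ((\<lambda>k. \<bar>X (\<tau> k) \<omega>\<bar>) ` {..L})"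
        by (intro Max_ge) (auto intro!: image_eqI[of _ _ k])
      then show "ennreal ((X (d i) \<omega>)\<^sup>2) \<le> ennreal ((Max ((\<lambda>k. \<bar>X (\<tau> k) \<omega>\<bar>) ` {..L}))\<^sup>2)"
        by (intro ennreal_leI) (metis abs_ge_zero power2_abs power_mono)
    qed
    also have "\<dots> \<le> 4 * (\<integral>\<^sup>+\<omega>. ennreal ((X T \<omega>)\<^sup>2) \<partial>P)"
      using Doob_finite[OF m sq mono \<tau>T, of L] \<open>\<tau> L = T\<close> by simp
    finally show ?thesis .
  qed
  have "(\<integral>\<^sup>+\<omega>. (SUP t\<in>right_skeleton. ennreal ((X t \<omega>)\<^sup>2)) \<partial>P) = (\<integral>\<^sup>+\<omega>. (SUP n. ?g n \<omega>) \<partial>P)"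
  proof (rule nn_integral_cong)
    fix \<omega>
    show "(SUP t\<in>right_skeleton. ennreal ((X t \<omega>)\<^sup>2)) = (SUP n. ?g n \<omega>)"
      unfolding rd[symmetric] image_image
    proof (rule antisym)
      show "(SUP i. ennreal ((X (d i) \<omega>)\<^sup>2)) \<le> (SUP n. ?g n \<omega>)"
      proof (rule SUP_least)
        fix i :: nat
        have "ennreal ((X (d i) \<omega>)\<^sup>2) \<le> ?g i \<omega>" by (rule SUP_upper) simp
        also have "\<dots> \<le> (SUP n. ?g n \<omega>)" by (rule SUP_upper) simp
        finally show "ennreal ((X (d i) \<omega>)\<^sup>2) \<le> (SUP n. ?g n \<omega>)" .
      qed
      show "(SUP n. ?g n \<omega>) \<le> (SUP i. ennreal ((X (d i) \<omega>)\<^sup>2))"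
        by (intro SUP_least) (rule SUP_upper, simp)
    qed
  qed
  also have "\<dots> = (SUP n. \<integral>\<^sup>+\<omega>. ?g n \<omega> \<partial>P)"
  proof (rule nn_integral_monotone_convergence_SUP)
    show "incseq ?g" by (intro incseq_SucI le_funI SUP_subset_mono) auto
    show "?g n \<in> borel_measurable P" for n
      by (intro borel_measurable_SUP) (auto intro!: measurable_compose[OF Xm])
  qed
  also have "\<dots> \<le> 4 * (\<integral>\<^sup>+\<omega>. ennreal ((X T \<omega>)\<^sup>2) \<partial>P)"
    by (rule SUP_least) (rule fin)
  finally show ?thesis .
qed

section \<open>The space of square-integrable martingales\<close>

lemma martingale_on_lincomb:
  fixes X Y :: "real \<Rightarrow> 'w \<Rightarrow> real"
  assumes X: "martingale_on P \<T> F X" and Y: "martingale_on P \<T> F Y"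
  shows "martingale_on P \<T> F (\<lambda>t \<omega>. X t \<omega> + c * Y t \<omega>)"
proof (rule martingale_on_realI)
  have m: "X t \<in> borel_measurable (F t)" "Y t \<in> borel_measurable (F t)" if "t \<in> \<T>" for t
    using X Y that by (auto simp: martingale_on_def adapted_def)
  have i: "integrable P (X t)" "integrable P (Y t)" if "t \<in> \<T>" for t
    using X Y that by (auto simp: martingale_on_def)
  show "(\<lambda>\<omega>. X t \<omega> + c * Y t \<omega>) \<in> borel_measurable (F t)" if "t \<in> \<T>" for t
    using m[OF that] by measurable
  show "integrable P (\<lambda>\<omega>. X t \<omega> + c * Y t \<omega>)" if "t \<in> \<T>" for t
    using i[OF that] by simp
  fix s t A assume st: "s \<in> \<T>" "t \<in> \<T>" "s \<le> t" and A: "A \<in> sets (F s)"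
  have AP: "A \<in> sets P" by (rule sets_F[OF st(1) A])
  have iA: "integrable P (\<lambda>\<omega>. indicator A \<omega> * Z u \<omega>)" if "integrable P (Z u)" for u and Z :: "real \<Rightarrow> 'w \<Rightarrow> real"
    using integrable_mult_indicator[OF AP that] by simp
  have iAm: "(indicator A :: 'w \<Rightarrow> real) \<in> borel_measurable (F s)" using A by simp
  have "(\<integral>\<omega>. indicator A \<omega> * (X u \<omega> + c * Y u \<omega>) \<partial>P)
      = (\<integral>\<omega>. indicator A \<omega> * X u \<omega> \<partial>P) + c * (\<integral>\<omega>. indicator A \<omega> * Y u \<omega> \<partial>P)" if "u \<in> \<T>" for u
  proof -
    have "(\<integral>\<omega>. indicator A \<omega> * (X u \<omega> + c * Y u \<omega>) \<partial>P)
      = (\<integral>\<omega>. indicator A \<omega> * X u \<omega> + c * (indicator A \<omega> * Y u \<omega>) \<partial>P)"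
      by (simp add: algebra_simps)
    then show ?thesis using iA[of X u] iA[of Y u] i[OF that] by simp
  qed
  with st martingale_on_realD[OF X st iAm iA[of X t, OF i(1)[OF st(2)]]]
    martingale_on_realD[OF Y st iAm iA[of Y t, OF i(2)[OF st(2)]]]
  show "(\<integral>\<omega>. indicator A \<omega> * (X t \<omega> + c * Y t \<omega>) \<partial>P) = (\<integral>\<omega>. indicator A \<omega> * (X s \<omega> + c * Y s \<omega>) \<partial>P)"
    by simp
qed

lemma Doob:
  fixes X :: "real \<Rightarrow> 'w \<Rightarrow> real"
  assumes m: "martingale_on P \<T> F X" and sq: "\<And>t. t \<in> \<T> \<Longrightarrow> square_integrable P (X t)"
    and rc: "AE \<omega> in P. right_continuous_path (\<lambda>t. X t \<omega>)"
  shows "(\<integral>\<^sup>+\<omega>. (SUP t\<in>\<T>. ennreal ((X t \<omega>)\<^sup>2)) \<partial>P) \<le> 4 * (\<integral>\<^sup>+\<omega>. ennreal ((X T \<omega>)\<^sup>2) \<partial>P)"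
proof -
  have "(\<integral>\<^sup>+\<omega>. (SUP t\<in>\<T>. ennreal ((X t \<omega>)\<^sup>2)) \<partial>P)
      = (\<integral>\<^sup>+\<omega>. (SUP t\<in>right_skeleton. ennreal ((X t \<omega>)\<^sup>2)) \<partial>P)"
  proof (rule nn_integral_cong_AE)
    show "AE \<omega> in P. (SUP t\<in>\<T>. ennreal ((X t \<omega>)\<^sup>2)) = (SUP t\<in>right_skeleton. ennreal ((X t \<omega>)\<^sup>2))"
      using rc
    proof eventually_elim
      case (elim \<omega>)
      from SUP_right_continuous_path[OF this] show ?case by simp
    qed
  qed
  with Doob_skeleton[OF m sq] show ?thesis by simp
qed

text \<open>Doob's inequality replaces the condition on the supremum by square-integrability at each time, a
  condition that is visibly stable under linear combinations.\<close>
lemma M2_realI: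
  fixes X :: "real \<Rightarrow> 'w \<Rightarrow> real"
  assumes m: "martingale_on P \<T> F X" and sq: "\<And>t. t \<in> \<T> \<Longrightarrow> square_integrable P (X t)"
    and rc: "AE \<omega> in P. right_continuous_path (\<lambda>t. X t \<omega>)"
  shows "X \<in> M2 P \<T> F"
proof -
  have "(\<integral>\<^sup>+\<omega>. (SUP t\<in>\<T>. ennreal ((X t \<omega>)\<^sup>2)) \<partial>P) \<le> 4 * (\<integral>\<^sup>+\<omega>. ennreal ((X T \<omega>)\<^sup>2) \<partial>P)"
    by (rule Doob[OF m sq rc])
  also have "\<dots> < \<infinity>"
    using sq[OF T_in] by (simp add: nn_integral_power2 ennreal_mult_less_top)
  finally show ?thesis using m rc by (simp add: M2_def right_continuous_path_def)
qed

lemma M2_realD: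
  fixes X :: "real \<Rightarrow> 'w \<Rightarrow> real"
  assumes X: "X \<in> M2 P \<T> F"
  shows "martingale_on P \<T> F X" and "\<And>t. t \<in> \<T> \<Longrightarrow> square_integrable P (X t)"
    and "AE \<omega> in P. right_continuous_path (\<lambda>t. X t \<omega>)"
    and "\<And>t. t \<in> \<T> \<Longrightarrow> X t \<in> borel_measurable (F t)"
proof -
  show m: "martingale_on P \<T> F X" and "AE \<omega> in P. right_continuous_path (\<lambda>t. X t \<omega>)"
    using X by (auto simp: M2_def right_continuous_path_def)
  fix t assume t: "t \<in> \<T>"
  show "X t \<in> borel_measurable (F t)" using m t by (simp add: martingale_on_def adapted_def)
  have "(\<integral>\<^sup>+\<omega>. ennreal ((X t \<omega>)\<^sup>2) \<partial>P) \<le> (\<integral>\<^sup>+\<omega>. (SUP t\<in>\<T>. ennreal ((norm (X t \<omega>))\<^sup>2)) \<partial>P)"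
    by (rule nn_integral_mono) (rule SUP_upper2[OF t], simp)
  also have "\<dots> < \<infinity>" using X by (simp add: M2_def)
  finally show "square_integrable P (X t)"
    using m t by (simp add: square_integrable_iff_nn_integral martingale_on_def borel_measurable_integrable)
qed

text \<open>The supremum of the squared norm is dominated by the sum of the coordinate suprema.  Splitting
  the integral of that sum requires measurable summands, so the suprema are first reduced to the
  skeleton.\<close>
lemma M2_Basis:
  fixes X :: "real \<Rightarrow> 'w \<Rightarrow> 'e::euclidean_space"
  shows "X \<in> M2 P \<T> F \<longleftrightarrow> (\<forall>e\<in>Basis. (\<lambda>t \<omega>. X t \<omega> \<bullet> e) \<in> M2 P \<T> F)"
proof
  assume X: "X \<in> M2 P \<T> F"
  show "\<forall>e\<in>Basis. (\<lambda>t \<omega>. X t \<omega> \<bullet> e) \<in> M2 P \<T> F"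
  proof
    fix e :: 'e assume e: "e \<in> Basis"
    have m: "martingale_on P \<T> F (\<lambda>t \<omega>. X t \<omega> \<bullet> e)"
      using X e by (simp add: M2_def martingale_on_Basis[of X])
    have rc: "AE \<omega> in P. \<forall>t\<in>\<T>. ((\<lambda>s. X s \<omega>) \<longlongrightarrow> X t \<omega>) (at t within \<T> \<inter> {t<..})"
      using X by (simp add: M2_def)
    have "(\<integral>\<^sup>+\<omega>. (SUP t\<in>\<T>. ennreal ((norm (X t \<omega> \<bullet> e))\<^sup>2)) \<partial>P)
        \<le> (\<integral>\<^sup>+\<omega>. (SUP t\<in>\<T>. ennreal ((norm (X t \<omega>))\<^sup>2)) \<partial>P)"
    proof (intro nn_integral_mono SUP_mono)
      fix \<omega> t assume "t \<in> \<T>"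
      have "(norm (X t \<omega> \<bullet> e))\<^sup>2 \<le> (norm (X t \<omega>))\<^sup>2"
        using Basis_le_norm[OF e, of "X t \<omega>"] by (intro power_mono) simp_all
      with \<open>t \<in> \<T>\<close> show "\<exists>t'\<in>\<T>. ennreal ((norm (X t \<omega> \<bullet> e))\<^sup>2) \<le> ennreal ((norm (X t' \<omega>))\<^sup>2)"
        by (intro bexI[of _ t] ennreal_leI)
    qed
    also have "\<dots> < \<infinity>" using X by (simp add: M2_def)
    finally show "(\<lambda>t \<omega>. X t \<omega> \<bullet> e) \<in> M2 P \<T> F"
      using m rc by (auto simp: M2_def intro!: tendsto_intros elim!: eventually_mono)
  qed
next
  assume X: "\<forall>e\<in>Basis. (\<lambda>t \<omega>. X t \<omega> \<bullet> e) \<in> M2 P \<T> F"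
  let ?X = "\<lambda>e t \<omega>. X t \<omega> \<bullet> e"
  note D = M2_realD[OF X[rule_format]]
  have m: "martingale_on P \<T> F X" using D(1) by (simp add: martingale_on_Basis[of X])
  have rce: "AE \<omega> in P. \<forall>e\<in>Basis. right_continuous_path (\<lambda>t. ?X e t \<omega>)"
    using D(3) by (intro AE_finite_allI) auto
  then have rc: "AE \<omega> in P. \<forall>t\<in>\<T>. ((\<lambda>s. X s \<omega>) \<longlongrightarrow> X t \<omega>) (at t within \<T> \<inter> {t<..})"
  proof eventually_elim
    case (elim \<omega>)
    then show ?case by (auto simp: right_continuous_path_def tendsto_componentwise_iff[of "\<lambda>s. X s \<omega>"])
  qed
  let ?S = "\<lambda>e \<omega>. SUP t\<in>right_skeleton. ennreal ((?X e t \<omega>)\<^sup>2)"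
  have "(\<integral>\<^sup>+\<omega>. (SUP t\<in>\<T>. ennreal ((norm (X t \<omega>))\<^sup>2)) \<partial>P) \<le> (\<integral>\<^sup>+\<omega>. (\<Sum>e\<in>Basis. ?S e \<omega>) \<partial>P)"
  proof (rule nn_integral_mono_AE)
    show "AE \<omega> in P. (SUP t\<in>\<T>. ennreal ((norm (X t \<omega>))\<^sup>2)) \<le> (\<Sum>e\<in>Basis. ?S e \<omega>)"
      using rce
    proof eventually_elim
      case (elim \<omega>)
      show ?case
      proof (rule SUP_least)
        fix t assume t: "t \<in> \<T>"
        have "(norm (X t \<omega>))\<^sup>2 = (\<Sum>e\<in>Basis. (?X e t \<omega>)\<^sup>2)"
          unfolding power2_norm_eq_inner by (subst euclidean_inner) (simp add: power2_eq_square)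
        then have "ennreal ((norm (X t \<omega>))\<^sup>2) = (\<Sum>e\<in>Basis. ennreal ((?X e t \<omega>)\<^sup>2))"
          by (simp add: sum_ennreal)
        also have "\<dots> \<le> (\<Sum>e\<in>Basis. ?S e \<omega>)"
        proof (rule sum_mono)
          fix e :: 'e assume e: "e \<in> Basis"
          have "ennreal ((?X e t \<omega>)\<^sup>2) \<le> (SUP t\<in>\<T>. ennreal ((norm (?X e t \<omega>))\<^sup>2))"
            by (rule SUP_upper2[OF t]) simp
          also have "\<dots> = ?S e \<omega>"
            using SUP_right_continuous_path[OF elim[rule_format, OF e]] by simp
          finally show "ennreal ((?X e t \<omega>)\<^sup>2) \<le> ?S e \<omega>" .
        qed
        finally show "ennreal ((norm (X t \<omega>))\<^sup>2) \<le> (\<Sum>e\<in>Basis. ?S e \<omega>)" .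
      qed
    qed
  qed
  also have "\<dots> = (\<Sum>e\<in>Basis. \<integral>\<^sup>+\<omega>. ?S e \<omega> \<partial>P)"
  proof (intro nn_integral_sum borel_measurable_SUP countable_right_skeleton)
    fix e :: 'e and t assume "e \<in> Basis" "t \<in> right_skeleton"
    then have [measurable]: "?X e t \<in> borel_measurable P"
      using D(2)[of e t] right_skeleton_subset by (auto simp: square_integrable_def)
    show "(\<lambda>\<omega>. ennreal ((?X e t \<omega>)\<^sup>2)) \<in> borel_measurable P" by measurable
  qed
  also have "\<dots> < \<infinity>"
  proof -
    have "(\<integral>\<^sup>+\<omega>. ?S e \<omega> \<partial>P) < \<infinity>" if e: "e \<in> Basis" for e
    proof -
      have "(\<integral>\<^sup>+\<omega>. ?S e \<omega> \<partial>P) \<le> 4 * (\<integral>\<^sup>+\<omega>. ennreal ((?X e T \<omega>)\<^sup>2) \<partial>P)"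
        by (rule Doob_skeleton[OF D(1)[OF e] D(2)[OF e]])
      also have "\<dots> < \<infinity>"
        using D(2)[OF e T_in] by (simp add: nn_integral_power2 ennreal_mult_less_top)
      finally show ?thesis .
    qed
    then show ?thesis by simp
  qed
  finally show "X \<in> M2 P \<T> F" using m rc by (simp add: M2_def)
qed

lemma M2_real_lincomb:
  fixes X Y :: "real \<Rightarrow> 'w \<Rightarrow> real"
  assumes X: "X \<in> M2 P \<T> F" and Y: "Y \<in> M2 P \<T> F"
  shows "(\<lambda>t \<omega>. X t \<omega> + c * Y t \<omega>) \<in> M2 P \<T> F"
proof (rule M2_realI)
  show "martingale_on P \<T> F (\<lambda>t \<omega>. X t \<omega> + c * Y t \<omega>)"
    by (rule martingale_on_lincomb[OF M2_realD(1)[OF X] M2_realD(1)[OF Y]])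
  show "square_integrable P (\<lambda>\<omega>. X t \<omega> + c * Y t \<omega>)" if "t \<in> \<T>" for t
    by (intro square_integrable_add square_integrable_cmult M2_realD(2)[OF X that] M2_realD(2)[OF Y that])
  show "AE \<omega> in P. right_continuous_path (\<lambda>t. X t \<omega> + c * Y t \<omega>)"
    using M2_realD(3)[OF X] M2_realD(3)[OF Y]
    by eventually_elim (auto simp: right_continuous_path_def intro!: tendsto_intros)
qed

lemma M2_real_zero: "(\<lambda>t \<omega>. 0 :: real) \<in> M2 P \<T> F"
  by (rule M2_realI) (auto simp: right_continuous_path_def intro!: martingale_on_realI)

lemma M2_real_sum:
  fixes X :: "'i \<Rightarrow> real \<Rightarrow> 'w \<Rightarrow> real"
  assumes "\<And>i. i \<in> I \<Longrightarrow> X i \<in> M2 P \<T> F"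
  shows "(\<lambda>t \<omega>. \<Sum>i\<in>I. X i t \<omega>) \<in> M2 P \<T> F"
  using assms
proof (induction I rule: infinite_finite_induct)
  case (insert i I)
  then show ?case using M2_real_lincomb[of "X i" "\<lambda>t \<omega>. \<Sum>i\<in>I. X i t \<omega>" 1] by simp
qed (simp_all add: M2_real_zero)

text \<open>For the difference \<open>Z\<close> of the two martingales, \<open>E (Z\<^sub>T - Z\<^sub>t)\<^sup>2 = E Z\<^sub>T\<^sup>2 - E Z\<^sub>t\<^sup>2\<close>.\<close>
lemma M2_contraction:
  fixes X Y :: "real \<Rightarrow> 'w \<Rightarrow> real"
  assumes X: "X \<in> M2 P \<T> F" and Y: "Y \<in> M2 P \<T> F" and t: "t \<in> \<T>"
  shows "sq_dist P (X t) (Y t) \<le> sq_dist P (X T) (Y T)"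
proof -
  define Z where "Z t \<omega> = X t \<omega> + (-1) * Y t \<omega>" for t \<omega>
  have Z: "Z \<in> M2 P \<T> F" unfolding Z_def by (rule M2_real_lincomb[OF X Y])
  note sq = M2_realD(2)[OF Z]
  have tT: "t \<le> T" using T_bounds[OF t] by simp
  note i = square_integrable_mult[OF sq[OF t] sq[OF T_in]]
    square_integrable_power2[OF sq[OF t]] square_integrable_power2[OF sq[OF T_in]]
  have eq: "(\<integral>\<omega>. Z t \<omega> * Z T \<omega> \<partial>P) = (\<integral>\<omega>. (Z t \<omega>)\<^sup>2 \<partial>P)"
    unfolding power2_eq_square
    by (rule martingale_on_realD[OF M2_realD(1)[OF Z] t T_in tT M2_realD(4)[OF Z t] i(1)])
  have "0 \<le> (\<integral>\<omega>. (Z T \<omega> - Z t \<omega>)\<^sup>2 \<partial>P)" by simp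
  also have "\<dots> = (\<integral>\<omega>. (Z T \<omega>)\<^sup>2 - 2 * (Z t \<omega> * Z T \<omega>) + (Z t \<omega>)\<^sup>2 \<partial>P)"
    by (simp add: power2_eq_square algebra_simps)
  also have "\<dots> = (\<integral>\<omega>. (Z T \<omega>)\<^sup>2 \<partial>P) - (\<integral>\<omega>. (Z t \<omega>)\<^sup>2 \<partial>P)"
    using i eq by simp
  finally show ?thesis by (simp add: sq_dist_def Z_def)
qed

text \<open>Along a subsequence whose successive squared distances at \<open>T\<close> are at most \<open>8\<^sup>-\<^sup>k\<close>, Doob's
  inequality bounds the suprema over time of the differences, so almost all paths converge uniformly and right-continuity
  passes to the limit.  The limit is set to \<open>0\<close> on the exceptional null set, which belongs to every
  \<open>F\<^sub>t\<close> by completeness of the filtration; this keeps it adapted.\<close>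
theorem M2_complete:
  fixes Z :: "nat \<Rightarrow> real \<Rightarrow> 'w \<Rightarrow> real"
  assumes Z: "\<And>n. Z n \<in> M2 P \<T> F" and c: "L2_Cauchy P (\<lambda>n. Z n T)"
  obtains J where "J \<in> M2 P \<T> F" "\<And>t. t \<in> \<T> \<Longrightarrow> L2_tendsto P (\<lambda>n. Z n t) (J t)"
proof -
  note sq = M2_realD(2)[OF Z]
  obtain r where r: "strict_mono r"
    "\<And>k. sq_dist P (Z (r (Suc k)) T) (Z (r k) T) \<le> (1/8) ^ k"
    using L2_Cauchy_fast_subseq[OF c] by blast
  define \<Delta> where "\<Delta> k t \<omega> = Z (r (Suc k)) t \<omega> + (-1) * Z (r k) t \<omega>" for k t \<omega>
  have \<Delta>: "\<Delta> k \<in> M2 P \<T> F" for k unfolding \<Delta>_def by (rule M2_real_lincomb[OF Z Z])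
  define D where "D k \<omega> = (SUP t\<in>right_skeleton. ennreal ((\<Delta> k t \<omega>)\<^sup>2))" for k \<omega>
  have Dm: "D k \<in> borel_measurable P" for k
    unfolding D_def
  proof (intro borel_measurable_SUP countable_right_skeleton)
    fix t assume "t \<in> right_skeleton"
    then have [measurable]: "\<Delta> k t \<in> borel_measurable P"
      using M2_realD(2)[OF \<Delta>, of t k] right_skeleton_subset by (auto simp: square_integrable_def)
    show "(\<lambda>\<omega>. ennreal ((\<Delta> k t \<omega>)\<^sup>2)) \<in> borel_measurable P" by measurable
  qed
  have "(\<integral>\<^sup>+\<omega>. D k \<omega> \<partial>P) \<le> ennreal (4 * (1/8) ^ k)" for k
  proof -
    have "(\<integral>\<^sup>+\<omega>. D k \<omega> \<partial>P) \<le> 4 * (\<integral>\<^sup>+\<omega>. ennreal ((\<Delta> k T \<omega>)\<^sup>2) \<partial>P)"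
      unfolding D_def by (rule Doob_skeleton[OF M2_realD(1)[OF \<Delta>] M2_realD(2)[OF \<Delta>]])
    also have "(\<integral>\<^sup>+\<omega>. ennreal ((\<Delta> k T \<omega>)\<^sup>2) \<partial>P) = ennreal (sq_dist P (Z (r (Suc k)) T) (Z (r k) T))"
      using nn_integral_sq_dist[OF sq[OF T_in] sq[OF T_in]] by (simp add: \<Delta>_def)
    also have "4 * \<dots> \<le> 4 * ennreal ((1/8) ^ k)" by (intro mult_left_mono ennreal_leI r(2)) simp
    also have "\<dots> = ennreal (4 * (1/8) ^ k)" by (simp add: ennreal_mult')
    finally show ?thesis .
  qed
  from AE_geometric_bound[OF Dm this]
  have "AE \<omega> in P. \<exists>C\<ge>0. \<forall>k. D k \<omega> \<le> ennreal (C * (1/4) ^ k)" by simp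
  moreover have "AE \<omega> in P. \<forall>n. right_continuous_path (\<lambda>t. Z n t \<omega>)"
    using M2_realD(3)[OF Z] by (simp add: AE_all_countable)
  moreover have "AE \<omega> in P. \<forall>k. right_continuous_path (\<lambda>t. \<Delta> k t \<omega>)"
    using M2_realD(3)[OF \<Delta>] by (simp add: AE_all_countable)
  ultimately have "AE \<omega> in P. (\<forall>n. right_continuous_path (\<lambda>t. Z n t \<omega>)) \<and>
      uniformly_convergent_on \<T> (\<lambda>k t. Z (r k) t \<omega>)"
  proof eventually_elim
    case (elim \<omega>)
    then obtain C where C: "C \<ge> 0" "\<And>k. D k \<omega> \<le> ennreal (C * (1/4) ^ k)" by auto
    have "uniformly_convergent_on \<T> (\<lambda>k t. Z (r k) t \<omega>)"
    proof (rule uniformly_convergent_geometric[OF _ C(1)])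
      fix k t assume t: "t \<in> \<T>"
      have "ennreal ((\<Delta> k t \<omega>)\<^sup>2) \<le> (SUP t\<in>\<T>. ennreal ((norm (\<Delta> k t \<omega>))\<^sup>2))"
        by (rule SUP_upper2[OF t]) simp
      also have "\<dots> = D k \<omega>"
        using SUP_right_continuous_path[OF elim(3)[rule_format, of k]] by (simp add: D_def)
      also note C(2)
      finally show "(Z (r (Suc k)) t \<omega> - Z (r k) t \<omega>)\<^sup>2 \<le> C * (1/4) ^ k"
        using C(1) by (simp add: \<Delta>_def)
    qed
    with elim(2) show ?case by simp
  qed
  then obtain N where N1: "{\<omega>\<in>space P. \<not> ((\<forall>n. right_continuous_path (\<lambda>t. Z n t \<omega>)) \<and>
      uniformly_convergent_on \<T> (\<lambda>k t. Z (r k) t \<omega>))} \<subseteq> N" and "emeasure P N = 0" "N \<in> events"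
    by (rule AE_E)
  then have N: "N \<in> null_sets P" by (intro null_setsI)
  have good: "uniformly_convergent_on \<T> (\<lambda>k t. Z (r k) t \<omega>)" "\<And>n. right_continuous_path (\<lambda>t. Z n t \<omega>)"
    if "\<omega> \<in> space P" "\<omega> \<notin> N" for \<omega>
    using N1 that by auto
  have aeN: "AE \<omega> in P. \<omega> \<notin> N" by (rule AE_not_in[OF N])
  define J where "J t \<omega> = (if \<omega> \<in> N then 0 else lim (\<lambda>k. Z (r k) t \<omega>))" for t \<omega>
  have J_unif: "uniform_limit \<T> (\<lambda>k t. Z (r k) t \<omega>) (\<lambda>t. J t \<omega>) sequentially"
    if "\<omega> \<in> space P" "\<omega> \<notin> N" for \<omega>
    using good(1)[OF that] that(2) by (simp add: uniformly_convergent_uniform_limit_iff J_def)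
  have J_lim: "AE \<omega> in P. (\<lambda>k. Z (r k) t \<omega>) \<longlonglongrightarrow> J t \<omega>" if "t \<in> \<T>" for t
    using aeN AE_space
  proof eventually_elim
    case (elim \<omega>)
    then show ?case using tendsto_uniform_limitI[OF J_unif that] by simp
  qed
  have Jad: "J t \<in> borel_measurable (F t)" if t: "t \<in> \<T>" for t
  proof -
    have [measurable]: "N \<in> sets (F t)" by (rule null_sets_F[OF t N])
    have [measurable]: "Z n t \<in> borel_measurable (F t)" for n by (rule M2_realD(4)[OF Z t])
    show ?thesis unfolding J_def by measurable
  qed
  have conv: "L2_tendsto P (\<lambda>n. Z n t) (J t)" if t: "t \<in> \<T>" for t
  proof (rule L2_Cauchy_tendsto_AE[OF _ measurable_F_P[OF t Jad[OF t]] r(1) J_lim[OF t]])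
    show "L2_Cauchy P (\<lambda>n. Z n t)"
      using c sq[OF t] M2_contraction[OF Z Z t] unfolding L2_Cauchy_def by (meson le_less_trans)
  qed
  have "J \<in> M2 P \<T> F"
  proof (rule M2_realI)
    show Jsq: "square_integrable P (J t)" if "t \<in> \<T>" for t
      using conv[OF that] by (simp add: L2_tendsto_def)
    show "martingale_on P \<T> F J"
    proof (rule martingale_on_realI[OF Jad])
      show "integrable P (J t)" if "t \<in> \<T>" for t
        by (rule square_integrable_integrable[OF Jsq[OF that]])
      fix s t A assume st: "s \<in> \<T>" "t \<in> \<T>" "s \<le> t" and A: "A \<in> sets (F s)"
      have Asq: "square_integrable P (indicator A)"
        by (rule square_integrable_bounded[where c = 1]) (use sets_F[OF st(1) A] in auto)
      have l: "(\<lambda>n. \<integral>\<omega>. indicator A \<omega> * Z n u \<omega> \<partial>P) \<longlonglongrightarrow> (\<integral>\<omega>. indicator A \<omega> * J u \<omega> \<partial>P)"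
        if "u \<in> \<T>" for u
        using L2_tendsto_integral_mult[OF conv[OF that] Asq] by (simp add: mult.commute)
      have "(\<integral>\<omega>. indicator A \<omega> * Z n t \<omega> \<partial>P) = (\<integral>\<omega>. indicator A \<omega> * Z n s \<omega> \<partial>P)" for n
        by (rule martingale_on_realD[OF M2_realD(1)[OF Z] st])
          (use A square_integrable_mult[OF Asq sq[OF st(2)]] in auto)
      with l[OF st(1)] l[OF st(2)] show
        "(\<integral>\<omega>. indicator A \<omega> * J t \<omega> \<partial>P) = (\<integral>\<omega>. indicator A \<omega> * J s \<omega> \<partial>P)"
        by (auto intro: LIMSEQ_unique)
    qed
    show "AE \<omega> in P. right_continuous_path (\<lambda>t. J t \<omega>)"
      using aeN AE_space
    proof eventually_elim
      case (elim \<omega>)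
      show ?case
        unfolding right_continuous_path_def
      proof
        fix t assume t: "t \<in> \<T>"
        show "((\<lambda>s. J s \<omega>) \<longlongrightarrow> J t \<omega>) (at t within \<T> \<inter> {t<..})"
        proof (rule swap_uniform_limit[where f = "\<lambda>k s. Z (r k) s \<omega>" and g = "\<lambda>k. Z (r k) t \<omega>"])
          show "\<forall>\<^sub>F k in sequentially. ((\<lambda>s. Z (r k) s \<omega>) \<longlongrightarrow> Z (r k) t \<omega>) (at t within \<T> \<inter> {t<..})"
            using good(2)[of \<omega>] elim t by (auto simp: right_continuous_path_def)
          show "(\<lambda>k. Z (r k) t \<omega>) \<longlonglongrightarrow> J t \<omega>"
            using tendsto_uniform_limitI[OF J_unif t] elim by simp
          show "uniform_limit (\<T> \<inter> {t<..}) (\<lambda>k s. Z (r k) s \<omega>) (\<lambda>s. J s \<omega>) sequentially"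
            by (rule uniform_limit_on_subset[OF J_unif]) (use elim in auto)
        qed simp
      qed
    qed
  qed
  with conv that show ?thesis by blast
qed

end

section \<open>Brownian increments\<close>

lemma lborel_integral_prod_Basis:
  fixes f :: "'e::euclidean_space \<Rightarrow> real \<Rightarrow> real"
  assumes f: "\<And>b. b \<in> Basis \<Longrightarrow> integrable lborel (f b)"
  shows "integrable lborel (\<lambda>x::'e. \<Prod>b\<in>Basis. f b (x \<bullet> b))"
    and "(\<integral>x. (\<Prod>b\<in>Basis. f b (x \<bullet> b)) \<partial>(lborel :: 'e measure)) = (\<Prod>b\<in>Basis. \<integral>y. f b y \<partial>lborel)"
proof -
  interpret product_sigma_finite "\<lambda>_::'e. lborel :: real measure" by standard
  have [measurable]: "f b \<in> borel_measurable borel" if "b \<in> Basis" for b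
    using borel_measurable_integrable[OF f[OF that]] by simp
  have m: "(\<lambda>f. \<Sum>b\<in>Basis. f b *\<^sub>R b) \<in> measurable (\<Pi>\<^sub>M b\<in>Basis. lborel) (borel :: 'e measure)"
    by measurable
  have g: "(\<lambda>x::'e. \<Prod>b\<in>Basis. f b (x \<bullet> b)) \<in> borel_measurable borel"
    by measurable
  have eq: "(\<Prod>b\<in>Basis. f b ((\<Sum>c\<in>Basis. y c *\<^sub>R c) \<bullet> b)) = (\<Prod>b\<in>Basis. f b (y b))" for y :: "'e \<Rightarrow> real"
    by (intro prod.cong refl) simp
  show "integrable lborel (\<lambda>x::'e. \<Prod>b\<in>Basis. f b (x \<bullet> b))"
    unfolding lborel_eq[where 'a = 'e] integrable_distr_eq[OF m g] eq
    by (rule product_integrable_prod) (use f in auto)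
  show "(\<integral>x. (\<Prod>b\<in>Basis. f b (x \<bullet> b)) \<partial>(lborel :: 'e measure)) = (\<Prod>b\<in>Basis. \<integral>y. f b y \<partial>lborel)"
    unfolding lborel_eq[where 'a = 'e] integral_distr[OF m g] eq
    by (rule product_integral_prod) (use f in auto)
qed

lemma lborel_integral_prod_vec:
  fixes f :: "'d::finite \<Rightarrow> real \<Rightarrow> real"
  assumes f: "\<And>i. integrable lborel (f i)"
  shows "integrable lborel (\<lambda>x::real^'d. \<Prod>i\<in>UNIV. f i (x $ i))"
    and "(\<integral>x. (\<Prod>i\<in>UNIV. f i (x $ i)) \<partial>(lborel :: (real^'d) measure)) = (\<Prod>i\<in>UNIV. \<integral>y. f i y \<partial>lborel)"
proof -
  define \<iota> where "\<iota> b = (THE i. b = axis i (1::real))" for b :: "real^'d"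
  have \<iota>: "\<iota> (axis i 1) = i" for i by (auto simp: \<iota>_def axis_eq_axis)
  have B: "(Basis :: (real^'d) set) = (\<lambda>i. axis i 1) ` UNIV" by (auto simp: Basis_vec_def)
  have inj: "inj (\<lambda>i. axis i 1 :: real^'d)" by (auto simp: inj_on_def axis_eq_axis)
  have e: "(\<Prod>b\<in>(Basis :: (real^'d) set). g b) = (\<Prod>i\<in>UNIV. g (axis i 1))" for g :: "real^'d \<Rightarrow> real"
    unfolding B by (subst prod.reindex[OF inj]) simp
  show "integrable lborel (\<lambda>x::real^'d. \<Prod>i\<in>UNIV. f i (x $ i))"
    and "(\<integral>x. (\<Prod>i\<in>UNIV. f i (x $ i)) \<partial>(lborel :: (real^'d) measure)) = (\<Prod>i\<in>UNIV. \<integral>y. f i y \<partial>lborel)"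
    using lborel_integral_prod_Basis[of "\<lambda>b. f (\<iota> b)"] f by (simp_all add: e \<iota> inner_axis)
qed

text \<open>Both moments are integrals of products of functions of one coordinate each, so they factor into
  one-dimensional Gaussian integrals.\<close>
lemma gaussian_vector_moments:
  fixes X :: "'w \<Rightarrow> real^'d"
  assumes D: "distributed M lborel X (\<lambda>x. ennreal (\<Prod>i\<in>UNIV. normal_density 0 \<sigma> (x $ i)))"
    and \<sigma>: "\<sigma> > 0"
  shows "integrable M (\<lambda>\<omega>. X \<omega> $ i)" "(\<integral>\<omega>. X \<omega> $ i \<partial>M) = 0"
    and "integrable M (\<lambda>\<omega>. X \<omega> $ i * X \<omega> $ j)"
    and "(\<integral>\<omega>. X \<omega> $ i * X \<omega> $ j \<partial>M) = (if i = j then \<sigma>\<^sup>2 else 0)"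
proof -
  let ?p = "normal_density 0 \<sigma>"
  have *: "integrable M (\<lambda>\<omega>. \<Prod>k\<in>UNIV. h k (X \<omega> $ k))"
    "(\<integral>\<omega>. (\<Prod>k\<in>UNIV. h k (X \<omega> $ k)) \<partial>M) = (\<Prod>k\<in>UNIV. \<integral>y. ?p y * h k y \<partial>lborel)"
    if h: "\<And>k. integrable lborel (\<lambda>y. ?p y * h k y)" "\<And>k. h k \<in> borel_measurable borel"
    for h :: "'d \<Rightarrow> real \<Rightarrow> real"
  proof -
    note [measurable] = h(2)
    have g: "(\<lambda>x::real^'d. \<Prod>k\<in>UNIV. h k (x $ k)) \<in> borel_measurable lborel"
      by measurable
    have nn: "0 \<le> (\<Prod>i\<in>UNIV. ?p (x $ i))" for x :: "real^'d" by (intro prod_nonneg) simp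
    note P = lborel_integral_prod_vec[of "\<lambda>k y. ?p y * h k y", OF h(1)]
    show "integrable M (\<lambda>\<omega>. \<Prod>k\<in>UNIV. h k (X \<omega> $ k))"
      using distributed_integrable[OF D g nn] P(1) by (simp add: prod.distrib)
    show "(\<integral>\<omega>. (\<Prod>k\<in>UNIV. h k (X \<omega> $ k)) \<partial>M) = (\<Prod>k\<in>UNIV. \<integral>y. ?p y * h k y \<partial>lborel)"
      using distributed_integral[OF D g nn] P(2) by (simp add: prod.distrib)
  qed
  have i1: "integrable lborel (\<lambda>y. ?p y * y)" and i2: "integrable lborel (\<lambda>y. ?p y * (y * y))"
    and i0: "integrable lborel ?p"
    using integrable_normal_moment[OF \<sigma>, of 0 1] integrable_normal_moment[OF \<sigma>, of 0 2] \<sigma>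
    by (simp_all add: power2_eq_square)
  have m0: "(\<integral>y. ?p y \<partial>lborel) = 1" by (rule integral_normal_density[OF \<sigma>])
  have m1: "(\<integral>y. ?p y * y \<partial>lborel) = 0" by (rule integral_normal_moment_nz_1[OF \<sigma>])
  have m2: "(\<integral>y. ?p y * (y * y) \<partial>lborel) = \<sigma>\<^sup>2"
    using integral_normal_moment_even[OF \<sigma>, of 0 1] \<sigma> by (simp add: power2_eq_square)
  let ?h1 = "\<lambda>k y. if k = i then y else 1 :: real"
  have h1: "(\<Prod>k\<in>UNIV. ?h1 k (x $ k)) = x $ i" for x :: "real^'d"
    by (simp add: prod.delta)
  have e1: "integrable lborel (\<lambda>y. ?p y * ?h1 k y)" for k using i0 i1 by (cases "k = i") simp_all
  show "integrable M (\<lambda>\<omega>. X \<omega> $ i)" using *(1)[of ?h1, OF e1] unfolding h1 by simp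
  have "(\<Prod>k\<in>UNIV. \<integral>y. ?p y * ?h1 k y \<partial>lborel) = 0"
    by (intro prod_zero bexI[of _ i]) (simp_all add: m1)
  then show "(\<integral>\<omega>. X \<omega> $ i \<partial>M) = 0" using *(2)[of ?h1, OF e1] unfolding h1 by simp
  let ?h2 = "\<lambda>k y. (if k = i then y else 1) * (if k = j then y else 1 :: real)"
  have h2: "(\<Prod>k\<in>UNIV. ?h2 k (x $ k)) = x $ i * x $ j" for x :: "real^'d"
    by (simp add: prod.delta prod.distrib)
  have e2: "integrable lborel (\<lambda>y. ?p y * ?h2 k y)" for k
    using i0 i1 i2 by (cases "k = i"; cases "k = j") simp_all
  have h2m: "?h2 k \<in> borel_measurable borel" for k by measurable
  show "integrable M (\<lambda>\<omega>. X \<omega> $ i * X \<omega> $ j)" using *(1)[of ?h2, OF e2 h2m] unfolding h2 by simp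
  have "(\<Prod>k\<in>UNIV. \<integral>y. ?p y * ?h2 k y \<partial>lborel) = (if i = j then \<sigma>\<^sup>2 else 0)"
  proof (cases "i = j")
    case True
    have "(\<integral>y. ?p y * ?h2 k y \<partial>lborel) = (if k = i then \<sigma>\<^sup>2 else 1)" for k
      using True m0 m2 by simp
    then show ?thesis using True by (simp add: prod.delta)
  next
    case False
    then have "(\<integral>y. ?p y * ?h2 i y \<partial>lborel) = 0" using m1 by simp
    then show ?thesis using False by (intro trans[OF prod_zero] bexI[of _ i]) simp_all
  qed
  then show "(\<integral>\<omega>. X \<omega> $ i * X \<omega> $ j \<partial>M) = (if i = j then \<sigma>\<^sup>2 else 0)"
    using *(2)[of ?h2, OF e2 h2m] unfolding h2 by simp
qed

lemma vec_nth_borel: "(\<lambda>x::real^'d. x $ j) \<in> borel_measurable borel"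
  by (intro borel_measurable_continuous_onI continuous_intros)

lemma (in prob_space) indep_set_vimage_product:
  fixes X :: "'a \<Rightarrow> 'e::topological_space" and Y :: "'a \<Rightarrow> real" and g :: "'e \<Rightarrow> real"
  assumes ind: "indep_set (sets G) {X -` B \<inter> space M | B. B \<in> sets borel}"
    and G: "subalgebra M G"
    and Y: "Y \<in> borel_measurable G" "integrable M Y"
    and X: "X \<in> borel_measurable M" and g: "g \<in> borel_measurable borel" "integrable M (\<lambda>\<omega>. g (X \<omega>))"
  shows "integrable M (\<lambda>\<omega>. Y \<omega> * g (X \<omega>))"
    and "(\<integral>\<omega>. Y \<omega> * g (X \<omega>) \<partial>M) = (\<integral>\<omega>. Y \<omega> \<partial>M) * (\<integral>\<omega>. g (X \<omega>) \<partial>M)"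
proof -
  have sp: "space G = space M" using G by (simp add: subalgebra_def)
  let ?V = "vimage_algebra (space M) X borel"
  have V: "sets ?V = {X -` B \<inter> space M | B. B \<in> sets borel}"
    by (rule sets_vimage_algebra2) auto
  have gV: "(\<lambda>\<omega>. g (X \<omega>)) \<in> borel_measurable ?V"
    by (rule measurable_compose[OF measurable_vimage_algebra1 g(1)]) auto
  have sub: "sigma_sets (space M) {f -` A \<inter> space M | A. A \<in> sets borel} \<subseteq> sets N"
    if "f \<in> borel_measurable N" "space N = space M" for f :: "'a \<Rightarrow> real" and N
    using that(2) measurable_sets[OF that(1)]
    by (subst that(2)[symmetric], intro sets.sigma_sets_subset) auto
  have "indep_var borel Y borel (\<lambda>\<omega>. g (X \<omega>))"
    unfolding indep_var_eq
  proof (intro conjI)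
    show "random_variable borel Y" using Y(2) by auto
    show "random_variable borel (\<lambda>\<omega>. g (X \<omega>))" using g(2) by auto
    show "indep_set (sigma_sets (space M) {Y -` A \<inter> space M |A. A \<in> sets borel})
       (sigma_sets (space M) {(\<lambda>\<omega>. g (X \<omega>)) -` A \<inter> space M |A. A \<in> sets borel})"
      using ind unfolding indep_set_def V[symmetric]
      by (rule indep_sets_mono_sets) (use sub[OF Y(1) sp] sub[OF gV] in \<open>auto split: bool.split\<close>)
  qed
  from indep_var_integrable[OF this Y(2) g(2)] indep_var_lebesgue_integral[OF this Y(2) g(2)]
  show "integrable M (\<lambda>\<omega>. Y \<omega> * g (X \<omega>))"
    and "(\<integral>\<omega>. Y \<omega> * g (X \<omega>) \<partial>M) = (\<integral>\<omega>. Y \<omega> \<partial>M) * (\<integral>\<omega>. g (X \<omega>) \<partial>M)" by auto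
qed

locale brownian_time_scale = filtered_time_scale P \<T> T F
  for P :: "'w measure" and \<T> T F +
  fixes W :: "real \<Rightarrow> 'w \<Rightarrow> real^'d"
  assumes T_pos: "0 < T" and brownian: "brownian_motion_on P \<T> F W"
begin

definition inc :: "'d \<Rightarrow> real \<Rightarrow> real \<Rightarrow> 'w \<Rightarrow> real" where
  "inc j a b \<omega> = W b \<omega> $ j - W a \<omega> $ j"

definition bounded_at :: "real \<Rightarrow> ('w \<Rightarrow> real) \<Rightarrow> bool" where
  "bounded_at a \<xi> \<longleftrightarrow> \<xi> \<in> borel_measurable (F a) \<and> (\<exists>c. \<forall>\<omega>\<in>space P. \<bar>\<xi> \<omega>\<bar> \<le> c)"

lemma bounded_at_mult:
  assumes "bounded_at a \<xi>" "bounded_at a \<eta>" shows "bounded_at a (\<lambda>\<omega>. \<xi> \<omega> * \<eta> \<omega>)"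
proof -
  obtain c d where "\<And>\<omega>. \<omega> \<in> space P \<Longrightarrow> \<bar>\<xi> \<omega>\<bar> \<le> c" "\<And>\<omega>. \<omega> \<in> space P \<Longrightarrow> \<bar>\<eta> \<omega>\<bar> \<le> d"
    using assms unfolding bounded_at_def by meson
  then have "\<bar>\<xi> \<omega> * \<eta> \<omega>\<bar> \<le> c * d" if "\<omega> \<in> space P" for \<omega>
    using that unfolding abs_mult by (intro mult_mono) (auto intro: order_trans[OF abs_ge_zero])
  with assms show ?thesis unfolding bounded_at_def by (auto intro!: borel_measurable_times)
qed

lemma bounded_at_mono: "a \<in> \<T> \<Longrightarrow> b \<in> \<T> \<Longrightarrow> a \<le> b \<Longrightarrow> bounded_at a \<xi> \<Longrightarrow> bounded_at b \<xi>"
  unfolding bounded_at_def using measurable_F_mono by blast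

lemma bounded_at_indicator: "A \<in> sets (F a) \<Longrightarrow> bounded_at a (indicator A)"
  unfolding bounded_at_def by (auto intro!: exI[of _ 1])

lemma bounded_at_cmult: "bounded_at a \<xi> \<Longrightarrow> bounded_at a (\<lambda>\<omega>. c * \<xi> \<omega>)"
  by (rule bounded_at_mult) (auto simp: bounded_at_def)

lemma bounded_at_square_integrable:
  assumes "bounded_at a \<xi>" "a \<in> \<T>" shows "square_integrable P \<xi>"
  using assms measurable_F_P[of a \<xi>] square_integrable_bounded[of \<xi>] unfolding bounded_at_def by blast

lemma bounded_at_times_square_integrable:
  assumes "bounded_at a \<xi>" "a \<in> \<T>" "square_integrable P X"
  shows "square_integrable P (\<lambda>\<omega>. \<xi> \<omega> * X \<omega>)"
  using assms measurable_F_P[of a \<xi>] square_integrable_bounded_mult[of P X \<xi>] unfolding bounded_at_def by blast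

lemma inc_measurable:
  assumes "a \<in> \<T>" "b \<in> \<T>" "a \<le> b" shows "inc j a b \<in> borel_measurable (F b)"
proof -
  have "W t \<in> borel_measurable (F t)" if "t \<in> \<T>" for t
    using brownian that by (simp add: brownian_motion_on_def adapted_def)
  then have "W b \<in> borel_measurable (F b)" "W a \<in> borel_measurable (F b)"
    using assms measurable_F_mono by auto
  then show ?thesis
    unfolding inc_def[abs_def]
    by (intro borel_measurable_diff measurable_compose[OF _ vec_nth_borel])
qed

text \<open>The two consequences of independence from the past on which everything rests: increments are
  orthogonal to the past, and, given the past, their covariance is the length of the interval times the
  identity.\<close>
lemma increment_moments:
  assumes st: "s \<in> \<T>" "t \<in> \<T>" "s < t"
  shows "square_integrable P (inc i s t)"
    and "\<And>Y. square_integrable P Y \<Longrightarrow> Y \<in> borel_measurable (F s) \<Longrightarrow> (\<integral>\<omega>. Y \<omega> * inc i s t \<omega> \<partial>P) = 0"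
    and "\<And>Z. bounded_at s Z \<Longrightarrow>
      (\<integral>\<omega>. Z \<omega> * (inc i s t \<omega> * inc j s t \<omega>) \<partial>P) = (if i = j then t - s else 0) * (\<integral>\<omega>. Z \<omega> \<partial>P)"
proof -
  let ?X = "\<lambda>\<omega>. W t \<omega> - W s \<omega>"
  have ind: "indep_set (sets (F s)) {?X -` B \<inter> space P | B. B \<in> sets borel}"
    and D: "distributed P lborel ?X (\<lambda>x. ennreal (\<Prod>i\<in>UNIV. normal_density 0 (sqrt (t - s)) (x $ i)))"
    using brownian st by (auto simp: brownian_motion_on_def)
  have X: "?X \<in> borel_measurable P" using distributed_measurable[OF D] by simp
  note mom = gaussian_vector_moments[OF D]
  have pos: "sqrt (t - s) > 0" using st by simp
  have e: "inc k s t = (\<lambda>\<omega>. ?X \<omega> $ k)" for k by (auto simp: inc_def)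
  show sq: "square_integrable P (inc i s t)"
    unfolding square_integrable_def power2_eq_square using mom(1)[OF pos, of i] mom(3)[OF pos, of i i]
    by (simp add: e borel_measurable_integrable)
  show "(\<integral>\<omega>. Y \<omega> * inc i s t \<omega> \<partial>P) = 0" if "square_integrable P Y" "Y \<in> borel_measurable (F s)" for Y
    using indep_set_vimage_product(2)[OF ind subalg[OF st(1)] that(2) square_integrable_integrable[OF that(1)] X, of "\<lambda>x. x $ i"]
      mom(1,2)[OF pos, of i] by (simp add: e vec_nth_borel)
  show "(\<integral>\<omega>. Z \<omega> * (inc i s t \<omega> * inc j s t \<omega>) \<partial>P) = (if i = j then t - s else 0) * (\<integral>\<omega>. Z \<omega> \<partial>P)"
    if "bounded_at s Z" for Z
  proof -
    have "Z \<in> borel_measurable (F s)" "integrable P Z"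
      using that square_integrable_integrable[OF bounded_at_square_integrable[OF that st(1)]]
      by (auto simp: bounded_at_def)
    from indep_set_vimage_product(2)[OF ind subalg[OF st(1)] this X, of "\<lambda>x. x $ i * x $ j"]
      mom(3,4)[OF pos, of i j] st show ?thesis
      by (simp add: e vec_nth_borel)
  qed
qed

lemma inc_square_integrable:
  assumes "a \<in> \<T>" "b \<in> \<T>" "a \<le> b" shows "square_integrable P (inc j a b)"
  using increment_moments(1)[OF assms(1,2), of j] assms(3) by (cases "a = b") (auto simp: inc_def[abs_def])

lemma integral_mult_inc:
  assumes "a \<in> \<T>" "b \<in> \<T>" "a \<le> b" "square_integrable P Y" "Y \<in> borel_measurable (F a)"
  shows "(\<integral>\<omega>. Y \<omega> * inc j a b \<omega> \<partial>P) = 0"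
  using increment_moments(2)[OF assms(1,2), of Y j] assms(3-) by (cases "a = b") (auto simp: inc_def)

text \<open>Both intervals are cut at \<open>a'\<close> and at \<open>c = min b b'\<close>.  After expansion only the product of the two
  increments over the common part \<open>(a', c]\<close> contributes; of the two tails beyond \<open>c\<close> one
  is empty, and in every other product one factor is an increment that starts when the others have
  ended.\<close>
lemma inc_covariance_ordered:
  assumes ab: "a \<in> \<T>" "b \<in> \<T>" "a < b" and ab': "a' \<in> \<T>" "b' \<in> \<T>" "a' < b'"
    and \<xi>: "bounded_at a \<xi>" and \<eta>: "bounded_at a' \<eta>" and le: "a \<le> a'"
  shows "(\<integral>\<omega>. (\<xi> \<omega> * inc i a b \<omega>) * (\<eta> \<omega> * inc j a' b' \<omega>) \<partial>P)
    = (if i = j then max 0 (min b b' - a') else 0) * (\<integral>\<omega>. \<xi> \<omega> * \<eta> \<omega> \<partial>P)"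
proof -
  define Z where "Z \<omega> = \<xi> \<omega> * \<eta> \<omega>" for \<omega>
  have Z: "bounded_at a' Z" unfolding Z_def
    by (rule bounded_at_mult[OF bounded_at_mono[OF ab(1) ab'(1) le \<xi>] \<eta>])
  have Zsq: "square_integrable P (\<lambda>\<omega>. Z \<omega> * X \<omega>)" if "square_integrable P X" for X
    by (rule bounded_at_times_square_integrable[OF Z ab'(1) that])
  have Zm: "Z \<in> borel_measurable (F u)" if "u \<in> \<T>" "a' \<le> u" for u
    using bounded_at_mono[OF ab'(1) that Z] by (simp add: bounded_at_def)
  have zero: "(\<integral>\<omega>. (Z \<omega> * inc k u v \<omega>) * inc l v x \<omega> \<partial>P) = 0"
    if "u \<in> \<T>" "v \<in> \<T>" "x \<in> \<T>" "u \<le> v" "v \<le> x" "a' \<le> v" for k l u v x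
    by (rule integral_mult_inc[OF that(2,3,5) Zsq[OF inc_square_integrable[OF that(1,2,4)]]])
      (intro borel_measurable_times Zm inc_measurable that)
  have int: "integrable P (\<lambda>\<omega>. (Z \<omega> * inc k u v \<omega>) * inc l x y \<omega>)"
    if "u \<in> \<T>" "v \<in> \<T>" "x \<in> \<T>" "y \<in> \<T>" "u \<le> v" "x \<le> y" for k l u v x y
    by (rule square_integrable_mult[OF Zsq]) (intro inc_square_integrable that)+
  have "(\<integral>\<omega>. (\<xi> \<omega> * inc i a b \<omega>) * (\<eta> \<omega> * inc j a' b' \<omega>) \<partial>P)
      = (\<integral>\<omega>. (Z \<omega> * inc i a b \<omega>) * inc j a' b' \<omega> \<partial>P)"
    by (simp add: Z_def algebra_simps)
  also have "\<dots> = (if i = j then max 0 (min b b' - a') else 0) * (\<integral>\<omega>. Z \<omega> \<partial>P)"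
  proof (cases "b \<le> a'")
    case True
    have "(\<integral>\<omega>. (Z \<omega> * inc i a b \<omega>) * inc j a' b' \<omega> \<partial>P) = 0"
      by (rule integral_mult_inc[OF ab'(1,2) less_imp_le[OF ab'(3)] Zsq[OF inc_square_integrable[OF ab(1,2) less_imp_le[OF ab(3)]]]])
        (intro borel_measurable_times Zm order_refl ab' measurable_F_mono[OF ab(2) ab'(1) True inc_measurable] ab less_imp_le)
    then show ?thesis using True by simp
  next
    case False
    define c where "c = min b b'"
    have c: "c \<in> \<T>" "a' < c" "c \<le> b" "c \<le> b'" using False ab ab' by (auto simp: c_def min_def)
    have split: "(Z \<omega> * inc i a b \<omega>) * inc j a' b' \<omega>
        = (Z \<omega> * inc i a a' \<omega>) * inc j a' b' \<omega> + (Z \<omega> * inc i a' c \<omega>) * inc j a' c \<omega>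
          + (Z \<omega> * inc i a' c \<omega>) * inc j c b' \<omega> + (Z \<omega> * inc j a' c \<omega>) * inc i c b \<omega>
          + (Z \<omega> * inc i c b \<omega>) * inc j c b' \<omega>" for \<omega>
      by (simp add: inc_def algebra_simps)
    \<comment> \<open>One of the two tails beyond \<open>c\<close> is empty.\<close>
    have last: "(Z \<omega> * inc i c b \<omega>) * inc j c b' \<omega> = 0" for \<omega>
      by (auto simp: c_def min_def inc_def)
    have "(\<integral>\<omega>. (Z \<omega> * inc i a b \<omega>) * inc j a' b' \<omega> \<partial>P)
        = (\<integral>\<omega>. (Z \<omega> * inc i a a' \<omega>) * inc j a' b' \<omega> \<partial>P) + (\<integral>\<omega>. (Z \<omega> * inc i a' c \<omega>) * inc j a' c \<omega> \<partial>P)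
          + (\<integral>\<omega>. (Z \<omega> * inc i a' c \<omega>) * inc j c b' \<omega> \<partial>P) + (\<integral>\<omega>. (Z \<omega> * inc j a' c \<omega>) * inc i c b \<omega> \<partial>P)"
      unfolding split last using ab ab' c le by (simp add: int less_imp_le)
    also have "\<dots> = (\<integral>\<omega>. Z \<omega> * (inc i a' c \<omega> * inc j a' c \<omega>) \<partial>P)"
      using ab ab' c le by (simp add: zero[unfolded mult.assoc] less_imp_le mult.assoc)
    also have "\<dots> = (if i = j then c - a' else 0) * (\<integral>\<omega>. Z \<omega> \<partial>P)"
      by (rule increment_moments(3)[OF ab'(1) c(1,2) Z])
    finally show ?thesis using c(2) by (simp add: c_def)
  qed
  finally show ?thesis by (simp add: Z_def)
qed

lemma inc_covariance:
  assumes ab: "a \<in> \<T>" "b \<in> \<T>" "a < b" and ab': "a' \<in> \<T>" "b' \<in> \<T>" "a' < b'"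
    and \<xi>: "bounded_at a \<xi>" and \<eta>: "bounded_at a' \<eta>"
  shows "(\<integral>\<omega>. (\<xi> \<omega> * inc i a b \<omega>) * (\<eta> \<omega> * inc j a' b' \<omega>) \<partial>P)
    = (if i = j then max 0 (min b b' - max a a') else 0) * (\<integral>\<omega>. \<xi> \<omega> * \<eta> \<omega> \<partial>P)"
proof (cases "a \<le> a'")
  case True
  then show ?thesis using inc_covariance_ordered[OF ab ab' \<xi> \<eta> True, of i j] by (simp add: max_def)
next
  case False
  then show ?thesis using inc_covariance_ordered[OF ab' ab \<eta> \<xi>, of j i]
    by (simp add: max_def min.commute mult.commute eq_commute[of i j])
qed

section \<open>The product of nabla-measure and probability\<close>

text \<open>The product measure, restricted to the predictable \<open>\<sigma>\<close>-algebra, so that limits taken in its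
  \<open>L\<^sup>2\<close> space are predictable by construction.\<close>
definition predictable_measure :: "(real \<times> 'w) measure" where
  "predictable_measure = distr (nabla_measure \<T> \<Otimes>\<^sub>M P) (predictable_sigma P \<T> F) (\<lambda>x. x)"

lemma space_nabla: "space (nabla_measure \<T>) = \<T> \<inter> {0<..}"
  by (simp add: nabla_measure_def space_restrict_space)

lemma sets_nabla: "sets (nabla_measure \<T>) = sets (restrict_space borel (\<T> \<inter> {0<..}))"
  unfolding nabla_measure_def by (rule sets_restrict_space_cong) simp

lemma Ioc_in_sets_nabla: "a \<in> \<T> \<Longrightarrow> {a<..b} \<inter> \<T> \<in> sets (nabla_measure \<T>)"
  unfolding sets_nabla using T_closed T_bounds[of a]
  by (subst sets_restrict_space_iff) auto

lemma emeasure_nabla_space: "emeasure (nabla_measure \<T>) (space (nabla_measure \<T>)) = ennreal T"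
proof -
  have "space (nabla_measure \<T>) = {0<..T} \<inter> \<T>" using T_bounds by (auto simp: space_nabla)
  then show ?thesis
    using emeasure_nabla_measure_Ioc[OF time_scale zero_in T_in T_pos] by simp
qed

lemma finite_measure_nabla: "finite_measure (nabla_measure \<T>)"
  by (rule finite_measureI) (simp add: emeasure_nabla_space)

lemma pair_sigma_finite_nabla: "pair_sigma_finite (nabla_measure \<T>) P"
  using finite_measure.axioms(1)[OF finite_measure_nabla] sigma_finite_measure_axioms
  by (simp add: pair_sigma_finite_def)

lemma predictable_generator_subset:
  "{({s<..t} \<inter> \<T>) \<times> A | s t A. s \<in> \<T> \<and> t \<in> \<T> \<and> s < t \<and> A \<in> sets (F s)}
    \<subseteq> Pow ((\<T> \<inter> {0<..}) \<times> space P)"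
proof clarify
  fix s t A x \<omega> assume "s \<in> \<T>" "A \<in> sets (F s)" "x \<in> {s<..t}" "x \<in> \<T>" "\<omega> \<in> A"
  then show "x \<in> \<T> \<inter> {0<..} \<and> \<omega> \<in> space P"
    using T_bounds[of s] sets.sets_into_space[OF sets_F, of s A] by auto
qed

lemma space_predictable: "space (predictable_sigma P \<T> F) = (\<T> \<inter> {0<..}) \<times> space P"
  unfolding predictable_sigma_def using predictable_generator_subset by (rule space_measure_of)

lemma sets_predictable: "sets (predictable_sigma P \<T> F) = sigma_sets ((\<T> \<inter> {0<..}) \<times> space P)
   {({s<..t} \<inter> \<T>) \<times> A | s t A. s \<in> \<T> \<and> t \<in> \<T> \<and> s < t \<and> A \<in> sets (F s)}"
  unfolding predictable_sigma_def using predictable_generator_subset by (rule sets_measure_of)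

lemma predictable_rectangle:
  "s \<in> \<T> \<Longrightarrow> t \<in> \<T> \<Longrightarrow> s < t \<Longrightarrow> A \<in> sets (F s) \<Longrightarrow>
     ({s<..t} \<inter> \<T>) \<times> A \<in> sets (predictable_sigma P \<T> F)"
  unfolding sets_predictable by (rule sigma_sets.Basic) blast

lemma measurable_id_predictable:
  "(\<lambda>x. x) \<in> measurable (nabla_measure \<T> \<Otimes>\<^sub>M P) (predictable_sigma P \<T> F)"
  unfolding predictable_sigma_def
proof (rule measurable_measure_of[OF predictable_generator_subset])
  show "(\<lambda>x. x) \<in> space (nabla_measure \<T> \<Otimes>\<^sub>M P) \<rightarrow> (\<T> \<inter> {0<..}) \<times> space P"
    by (simp add: space_pair_measure space_nabla)
  fix y assume "y \<in> {({s<..t} \<inter> \<T>) \<times> A | s t A. s \<in> \<T> \<and> t \<in> \<T> \<and> s < t \<and> A \<in> sets (F s)}"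
  then obtain s t A where y: "y = ({s<..t} \<inter> \<T>) \<times> A" "s \<in> \<T>" "A \<in> sets (F s)" by blast
  then have "y \<in> sets (nabla_measure \<T> \<Otimes>\<^sub>M P)"
    by (auto intro!: pair_measureI Ioc_in_sets_nabla sets_F)
  then show "(\<lambda>x. x) -` y \<inter> space (nabla_measure \<T> \<Otimes>\<^sub>M P) \<in> sets (nabla_measure \<T> \<Otimes>\<^sub>M P)"
    by simp
qed

lemma space_predictable_measure: "space predictable_measure = (\<T> \<inter> {0<..}) \<times> space P"
  and sets_predictable_measure [measurable_cong]: "sets predictable_measure = sets (predictable_sigma P \<T> F)"
  by (simp_all add: predictable_measure_def space_predictable)

lemma nn_integral_predictable_measure:
  assumes g: "g \<in> borel_measurable (predictable_sigma P \<T> F)"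
  shows "(\<integral>\<^sup>+x. g x \<partial>predictable_measure) = (\<integral>\<^sup>+\<omega>. (\<integral>\<^sup>+s. g (s, \<omega>) \<partial>nabla_measure \<T>) \<partial>P)"
proof -
  interpret N: pair_sigma_finite "nabla_measure \<T>" P by (rule pair_sigma_finite_nabla)
  have "g \<in> borel_measurable (nabla_measure \<T> \<Otimes>\<^sub>M P)"
    using measurable_compose[OF measurable_id_predictable g] .
  from N.nn_integral_snd[OF this] show ?thesis
    using g by (simp add: predictable_measure_def nn_integral_distr[OF measurable_id_predictable])
qed

lemma emeasure_predictable_measure_space:
  "emeasure predictable_measure (space predictable_measure) = ennreal T"
proof -
  have "emeasure predictable_measure (space predictable_measure) = (\<integral>\<^sup>+x. 1 \<partial>predictable_measure)"
    by simp
  also have "\<dots> = ennreal T"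
    by (subst nn_integral_predictable_measure)
      (simp_all add: emeasure_nabla_space emeasure_space_1)
  finally show ?thesis .
qed

lemma finite_measure_predictable_measure: "finite_measure predictable_measure"
  by (rule finite_measureI) (simp add: emeasure_predictable_measure_space)

text \<open>A superlevel set at a level \<open>c \<ge> 0\<close> is a predictable rectangle, and at a level \<open>c < 0\<close> the
  complement of one.\<close>
lemma elementary_predictable:
  fixes \<xi> :: "'w \<Rightarrow> real"
  assumes ab: "a \<in> \<T>" "b \<in> \<T>" "a < b" and \<xi>: "\<xi> \<in> borel_measurable (F a)"
  shows "(\<lambda>(s, \<omega>). \<xi> \<omega> * indicator {a<..b} s) \<in> borel_measurable (predictable_sigma P \<T> F)"
proof (subst borel_measurable_iff_greater, intro allI)
  fix c :: real
  let ?M = "predictable_sigma P \<T> F" and ?f = "\<lambda>(s, \<omega>). \<xi> \<omega> * indicator {a<..b} s :: real"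
  note m = borel_measurable_iff_greater[THEN iffD1, OF \<xi>, rule_format] borel_measurable_iff_le[THEN iffD1, OF \<xi>, rule_format]
  have sp: "space (F a) = space P" by (rule space_F[OF ab(1)])
  have a0: "0 \<le> a" using T_bounds[OF ab(1)] by simp
  show "{w \<in> space ?M. c < ?f w} \<in> sets ?M"
  proof (cases "c \<ge> 0")
    case True
    then have "{w \<in> space ?M. c < ?f w} = ({a<..b} \<inter> \<T>) \<times> {\<omega>\<in>space (F a). c < \<xi> \<omega>}"
      using a0 by (auto simp: space_predictable sp split: split_indicator split_indicator_asm)
    then show ?thesis using predictable_rectangle[OF ab m(1)] by simp
  next
    case False
    then have "{w \<in> space ?M. c < ?f w} = space ?M - ({a<..b} \<inter> \<T>) \<times> {\<omega>\<in>space (F a). \<xi> \<omega> \<le> c}"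
      using a0 by (auto simp: space_predictable sp split: split_indicator split_indicator_asm)
    then show ?thesis using predictable_rectangle[OF ab m(2)] by simp
  qed
qed

lemma integral_elementary:
  assumes ab: "a \<in> \<T>" "b \<in> \<T>" and \<xi>: "bounded_at a \<xi>"
  shows "(\<integral>(s, \<omega>). \<xi> \<omega> * indicator {a<..b} s \<partial>predictable_measure) = max 0 (b - a) * (\<integral>\<omega>. \<xi> \<omega> \<partial>P)"
proof (cases "a < b")
  case True
  interpret N: pair_sigma_finite "nabla_measure \<T>" P by (rule pair_sigma_finite_nabla)
  interpret NF: finite_measure "nabla_measure \<T>" by (rule finite_measure_nabla)
  interpret NP: finite_measure predictable_measure by (rule finite_measure_predictable_measure)
  let ?f = "\<lambda>(s, \<omega>). \<xi> \<omega> * indicator {a<..b} s :: real"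
  have fm: "?f \<in> borel_measurable (predictable_sigma P \<T> F)"
    using elementary_predictable[OF ab True] \<xi> by (simp add: bounded_at_def)
  have fm': "?f \<in> borel_measurable predictable_measure"
    using fm by (simp add: measurable_cong_sets[OF sets_predictable_measure refl])
  obtain c where c: "\<And>\<omega>. \<omega> \<in> space P \<Longrightarrow> \<bar>\<xi> \<omega>\<bar> \<le> c" using \<xi> by (auto simp: bounded_at_def)
  have "integrable predictable_measure ?f"
  proof (rule NP.integrable_const_bound[where B = "\<bar>c\<bar>"])
    show "AE x in predictable_measure. norm (?f x) \<le> \<bar>c\<bar>"
      by (intro AE_I2) (use c in \<open>force simp: space_predictable_measure indicator_def split: if_splits\<close>)
  qed (rule fm')
  then have i: "integrable (nabla_measure \<T> \<Otimes>\<^sub>M P) ?f"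
    unfolding predictable_measure_def using integrable_distr_eq[OF measurable_id_predictable fm] by simp
  have "(\<integral>x. ?f x \<partial>predictable_measure) = (\<integral>x. ?f x \<partial>(nabla_measure \<T> \<Otimes>\<^sub>M P))"
    unfolding predictable_measure_def by (rule integral_distr[OF measurable_id_predictable fm])
  also have "\<dots> = (\<integral>s. (\<integral>\<omega>. \<xi> \<omega> * indicator {a<..b} s \<partial>P) \<partial>nabla_measure \<T>)"
    using N.integral_fst[OF i] by simp
  also have "\<dots> = (\<integral>s. indicator ({a<..b} \<inter> \<T>) s \<partial>nabla_measure \<T>) * (\<integral>\<omega>. \<xi> \<omega> \<partial>P)"
    by (subst integral_mult_left_zero[symmetric])
      (auto intro!: Bochner_Integration.integral_cong simp: space_nabla indicator_def)
  also have "(\<integral>s. indicator ({a<..b} \<inter> \<T>) s \<partial>nabla_measure \<T>) = measure (nabla_measure \<T>) ({a<..b} \<inter> \<T>)"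
    using Ioc_in_sets_nabla[OF ab(1)] by simp
  also have "\<dots> = b - a"
    using emeasure_nabla_measure_Ioc[OF time_scale ab True] True by (simp add: measure_def)
  finally show ?thesis using True by simp
next
  case False
  then have "(\<lambda>(s, \<omega>). \<xi> \<omega> * indicator {a<..b} s) = (\<lambda>_. 0 :: real)"
    by (auto simp: fun_eq_iff)
  then show ?thesis using False by simp
qed

section \<open>Integrals of simple integrands\<close>

lemma simple_integrand_Nil [simp]: "simple_integrand P \<T> F []"
  by (simp add: simple_integrand_def)

lemma simple_integrand_Cons [simp]: "simple_integrand P \<T> F ((a, b, \<xi>) # S) \<longleftrightarrow>
    a \<in> \<T> \<and> b \<in> \<T> \<and> a < b \<and> bounded_at a \<xi> \<and> simple_integrand P \<T> F S"
  by (auto simp: simple_integrand_def bounded_at_def)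

lemma simple_process_Nil [simp]: "simple_process [] = (\<lambda>s \<omega>. 0)"
  and simple_process_Cons [simp]: "simple_process ((a, b, \<xi>) # S) =
    (\<lambda>s \<omega>. \<xi> \<omega> * indicator {a<..b} s + simple_process S s \<omega>)"
  by (auto simp: simple_process_def fun_eq_iff)

lemma simple_integral_Nil [simp]: "simple_integral w [] = (\<lambda>t \<omega>. 0)"
  and simple_integral_Cons [simp]: "simple_integral w ((a, b, \<xi>) # S) =
    (\<lambda>t \<omega>. \<xi> \<omega> * (w (min b t) \<omega> - w (min a t) \<omega>) + simple_integral w S t \<omega>)"
  by (auto simp: simple_integral_def fun_eq_iff)

abbreviation W_comp :: "'d \<Rightarrow> real \<Rightarrow> 'w \<Rightarrow> real" where
  "W_comp j s \<omega> \<equiv> W s \<omega> $ j"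

definition add_scaled :: "(real \<times> real \<times> ('w \<Rightarrow> real)) list \<Rightarrow> real \<Rightarrow> (real \<times> real \<times> ('w \<Rightarrow> real)) list
    \<Rightarrow> (real \<times> real \<times> ('w \<Rightarrow> real)) list" where
  "add_scaled S c S' = S @ map (\<lambda>(a, b, \<xi>). (a, b, \<lambda>\<omega>. c * \<xi> \<omega>)) S'"

lemma add_scaled_integrand:
  "simple_integrand P \<T> F S \<Longrightarrow> simple_integrand P \<T> F S' \<Longrightarrow> simple_integrand P \<T> F (add_scaled S c S')"
proof -
  assume S: "simple_integrand P \<T> F S" and S': "simple_integrand P \<T> F S'"
  have "simple_integrand P \<T> F (map (\<lambda>(a, b, \<xi>). (a, b, \<lambda>\<omega>. c * \<xi> \<omega>)) S')"
    using S' by (induction S') (auto intro: bounded_at_cmult)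
  with S show ?thesis by (auto simp: simple_integrand_def add_scaled_def)
qed

lemma add_scaled_process: "simple_process (add_scaled S c S') s \<omega> = simple_process S s \<omega> + c * simple_process S' s \<omega>"
proof -
  have "simple_process (map (\<lambda>(a, b, \<xi>). (a, b, \<lambda>\<omega>. c * \<xi> \<omega>)) S') s \<omega> = c * simple_process S' s \<omega>"
    by (induction S') (auto simp: algebra_simps)
  then show ?thesis by (simp add: simple_process_def add_scaled_def)
qed

lemma add_scaled_integral: "simple_integral w (add_scaled S c S') t \<omega> = simple_integral w S t \<omega> + c * simple_integral w S' t \<omega>"
proof -
  have "simple_integral w (map (\<lambda>(a, b, \<xi>). (a, b, \<lambda>\<omega>. c * \<xi> \<omega>)) S') t \<omega> = c * simple_integral w S' t \<omega>"
    by (induction S') (auto simp: algebra_simps)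
  then show ?thesis by (simp add: simple_integral_def add_scaled_def)
qed

text \<open>The integrand \<open>S\<close> cut down to \<open>(s, t] \<times> A\<close>.  Intervals that miss \<open>(s, t]\<close> are dropped, because
  entries of simple integrands have \<open>a < b\<close>.\<close>
definition restrict_integrand :: "real \<Rightarrow> real \<Rightarrow> 'w set \<Rightarrow> (real \<times> real \<times> ('w \<Rightarrow> real)) list
    \<Rightarrow> (real \<times> real \<times> ('w \<Rightarrow> real)) list" where
  "restrict_integrand s t A S = map (\<lambda>(a, b, \<xi>). (max a s, min b t, \<lambda>\<omega>. indicator A \<omega> * \<xi> \<omega>))
     (filter (\<lambda>(a, b, \<xi>). max a s < min b t) S)"

lemma max_in: "a \<in> \<T> \<Longrightarrow> b \<in> \<T> \<Longrightarrow> max a b \<in> \<T>" and min_in: "a \<in> \<T> \<Longrightarrow> b \<in> \<T> \<Longrightarrow> min a b \<in> \<T>"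
  by (auto simp: max_def min_def)

lemma restrict_integrand_integrand:
  assumes st: "s \<in> \<T>" "t \<in> \<T>" and A: "A \<in> sets (F s)" and S: "simple_integrand P \<T> F S"
  shows "simple_integrand P \<T> F (restrict_integrand s t A S)"
  using S
proof (induction S)
  case (Cons x S)
  obtain a b \<xi> where x: "x = (a, b, \<xi>)" by (cases x)
  have "bounded_at (max a s) (\<lambda>\<omega>. indicator A \<omega> * \<xi> \<omega>)"
    using Cons.prems st bounded_at_mono[OF _ _ _ bounded_at_indicator[OF A], of "max a s"]
      bounded_at_mono[of a "max a s" \<xi>]
    by (intro bounded_at_mult) (auto simp: x max_in)
  with Cons st show ?case by (auto simp: x restrict_integrand_def max_in min_in)
qed (simp add: restrict_integrand_def)

text \<open>Localised increments of an integral are again terminal values of integrals.  Hence statements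
  about the terminal value of all simple integrals, such as mean zero or orthogonality to a martingale,
  extend to intermediate times.\<close>
lemma restrict_integrand_integral:
  assumes st: "s \<in> \<T>" "t \<in> \<T>" "s \<le> t" and S: "simple_integrand P \<T> F S"
  shows "simple_integral w (restrict_integrand s t A S) T \<omega>
    = indicator A \<omega> * (simple_integral w S t \<omega> - simple_integral w S s \<omega>)"
  using S
proof (induction S)
  case (Cons x S)
  obtain a b \<xi> where x: "x = (a, b, \<xi>)" by (cases x)
  have ab: "a \<in> \<T>" "b \<in> \<T>" "a < b" and S: "simple_integrand P \<T> F S" using Cons.prems by (auto simp: x)
  have le: "a \<le> T" "b \<le> T" "s \<le> T" "t \<le> T" using T_bounds ab st by auto
  have *: "simple_integral w (restrict_integrand s t A (x # S)) T \<omega>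
      = (if max a s < min b t then indicator A \<omega> * \<xi> \<omega> * (w (min b t) \<omega> - w (max a s) \<omega>) else 0)
        + simple_integral w (restrict_integrand s t A S) T \<omega>"
    using le by (simp add: x restrict_integrand_def min_absorb1)
  consider "b \<le> s" | "t \<le> a" | "s < b" "a < t" by linarith
  then have "(if max a s < min b t then indicator A \<omega> * \<xi> \<omega> * (w (min b t) \<omega> - w (max a s) \<omega>) else 0)
      = indicator A \<omega> * (\<xi> \<omega> * (w (min b t) \<omega> - w (min a t) \<omega>) - \<xi> \<omega> * (w (min b s) \<omega> - w (min a s) \<omega>))"
  proof cases
    case 1
    then show ?thesis using ab st(3) by (simp add: min_absorb1)
  next
    case 2
    then show ?thesis using ab st(3) by (simp add: min_absorb2)
  next
    case 3
    then show ?thesis using ab st(3) by (cases "a \<le> s") (simp_all add: min_absorb1 min_absorb2 max_absorb1 max_absorb2 right_diff_distrib)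
  qed
  with * Cons.IH[OF S] show ?case by (simp add: x right_diff_distrib distrib_left)
qed (simp add: restrict_integrand_def)

lemma simple_process_predictable:
  assumes "simple_integrand P \<T> F S"
  shows "(\<lambda>(s, \<omega>). simple_process S s \<omega>) \<in> borel_measurable (predictable_sigma P \<T> F)"
  using assms
proof (induction S)
  case (Cons x S)
  obtain a b \<xi> where x: "x = (a, b, \<xi>)" by (cases x)
  have "(\<lambda>z. (\<lambda>(s, \<omega>). \<xi> \<omega> * indicator {a<..b} s) z + (\<lambda>(s, \<omega>). simple_process S s \<omega>) z)
      \<in> borel_measurable (predictable_sigma P \<T> F)"
    using Cons by (intro borel_measurable_add elementary_predictable) (auto simp: x bounded_at_def)
  then show ?case by (simp add: x case_prod_beta')
qed simp

lemma simple_process_square_integrable: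
  assumes S: "simple_integrand P \<T> F S"
  shows "square_integrable predictable_measure (\<lambda>(s, \<omega>). simple_process S s \<omega>)"
proof -
  have "\<exists>c. \<forall>s. \<forall>\<omega>\<in>space P. \<bar>simple_process S s \<omega>\<bar> \<le> c"
    using S
  proof (induction S)
    case (Cons x S)
    obtain a b \<xi> where x: "x = (a, b, \<xi>)" by (cases x)
    obtain c where "\<And>s \<omega>. \<omega> \<in> space P \<Longrightarrow> \<bar>simple_process S s \<omega>\<bar> \<le> c"
      using Cons by (auto simp: x)
    moreover obtain d where "\<And>\<omega>. \<omega> \<in> space P \<Longrightarrow> \<bar>\<xi> \<omega>\<bar> \<le> d"
      using Cons.prems by (auto simp: x bounded_at_def)
    ultimately have "\<bar>simple_process (x # S) s \<omega>\<bar> \<le> \<bar>d\<bar> + c" if "\<omega> \<in> space P" for s \<omega>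
      using that unfolding x simple_process_Cons
      by (intro order_trans[OF abs_triangle_ineq] add_mono) (force simp: indicator_def)+
    then show ?case by blast
  qed (auto intro!: exI[of _ 0])
  then obtain c where c: "\<And>s \<omega>. \<omega> \<in> space P \<Longrightarrow> \<bar>simple_process S s \<omega>\<bar> \<le> c" by blast
  show ?thesis
    by (rule finite_measure.square_integrable_bounded[OF finite_measure_predictable_measure, where c = c])
      (use c simple_process_predictable[OF S] in
        \<open>auto simp: space_predictable_measure measurable_cong_sets[OF sets_predictable_measure refl]\<close>)
qed

lemma simple_integral_adapted:
  assumes S: "simple_integrand P \<T> F S" and t: "t \<in> \<T>"
  shows "simple_integral (W_comp j) S t \<in> borel_measurable (F t)"
    and "square_integrable P (simple_integral (W_comp j) S t)"
proof -
  have "simple_integral (W_comp j) S t \<in> borel_measurable (F t) \<and>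
      square_integrable P (simple_integral (W_comp j) S t)"
    using S
  proof (induction S)
    case (Cons x S)
    obtain a b \<xi> where x: "x = (a, b, \<xi>)" by (cases x)
    have ab: "a \<in> \<T>" "b \<in> \<T>" "a < b" "bounded_at a \<xi>" using Cons.prems by (auto simp: x)
    have IH: "simple_integral (W_comp j) S t \<in> borel_measurable (F t)"
        "square_integrable P (simple_integral (W_comp j) S t)"
      using Cons by (auto simp: x)
    show ?case
    proof (cases "a < t")
      case True
      have m: "min b t \<in> \<T>" "a \<le> min b t" "min b t \<le> t" using ab True t by (auto simp: min_in)
      have eq: "simple_integral (W_comp j) (x # S) t =
          (\<lambda>\<omega>. \<xi> \<omega> * inc j a (min b t) \<omega> + simple_integral (W_comp j) S t \<omega>)"
        using True by (auto simp: x inc_def)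
      have "\<xi> \<in> borel_measurable (F t)"
        using bounded_at_mono[OF ab(1) t _ ab(4)] True by (simp add: bounded_at_def)
      moreover have "inc j a (min b t) \<in> borel_measurable (F t)"
        by (rule measurable_F_mono[OF m(1) t m(3) inc_measurable[OF ab(1) m(1,2)]])
      moreover have "square_integrable P (\<lambda>\<omega>. \<xi> \<omega> * inc j a (min b t) \<omega>)"
        by (rule bounded_at_times_square_integrable[OF ab(4,1) inc_square_integrable[OF ab(1) m(1,2)]])
      ultimately show ?thesis unfolding eq using IH by (auto intro: square_integrable_add)
    next
      case False
      then have "simple_integral (W_comp j) (x # S) t = simple_integral (W_comp j) S t"
        using ab by (auto simp: x)
      with IH show ?thesis by simp
    qed
  qed (simp_all add: simple_integral_def[abs_def])
  then show "simple_integral (W_comp j) S t \<in> borel_measurable (F t)"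
    and "square_integrable P (simple_integral (W_comp j) S t)" by auto
qed

lemma simple_integral_mean:
  assumes S: "simple_integrand P \<T> F S"
  shows "(\<integral>\<omega>. simple_integral (W_comp j) S T \<omega> \<partial>P) = 0"
  using S
proof (induction S)
  case (Cons x S)
  obtain a b \<xi> where x: "x = (a, b, \<xi>)" by (cases x)
  have ab: "a \<in> \<T>" "b \<in> \<T>" "a < b" "bounded_at a \<xi>" and S: "simple_integrand P \<T> F S"
    using Cons.prems by (auto simp: x)
  have le: "min b T = b" "min a T = a" using T_bounds ab by auto
  have sq: "square_integrable P (\<lambda>\<omega>. \<xi> \<omega> * inc j a b \<omega>)"
    by (rule bounded_at_times_square_integrable[OF ab(4,1) inc_square_integrable[OF ab(1,2)]]) (use ab in simp)
  have "(\<integral>\<omega>. \<xi> \<omega> * inc j a b \<omega> \<partial>P) = 0"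
    by (rule integral_mult_inc[OF ab(1,2) _ bounded_at_square_integrable[OF ab(4,1)]])
      (use ab in \<open>auto simp: bounded_at_def\<close>)
  with Cons.IH[OF S] square_integrable_integrable[OF sq]
    square_integrable_integrable[OF simple_integral_adapted(2)[OF S T_in, of j]]
  show ?case by (simp add: x le inc_def)
qed simp

lemma simple_integral_right_continuous:
  assumes S: "simple_integrand P \<T> F S"
  shows "AE \<omega> in P. right_continuous_path (\<lambda>t. simple_integral (W_comp j) S t \<omega>)"
proof -
  have "AE \<omega> in P. continuous_on \<T> (\<lambda>t. W t \<omega>)"
    using brownian by (simp add: brownian_motion_on_def)
  then show ?thesis
  proof eventually_elim
    case (elim \<omega>)
    have w: "continuous_on \<T> (\<lambda>t. W (min b t) \<omega> $ j)" if "b \<in> \<T>" for b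
    proof -
      have "continuous_on \<T> (\<lambda>t. W (min b t) \<omega>)"
        by (rule continuous_on_compose2[OF elim]) (use that in \<open>auto intro!: continuous_intros simp: min_in\<close>)
      then show ?thesis by (intro continuous_intros)
    qed
    have "continuous_on \<T> (\<lambda>t. simple_integral (W_comp j) S t \<omega>)"
      using S
    proof (induction S)
      case (Cons x S)
      obtain a b \<xi> where x: "x = (a, b, \<xi>)" by (cases x)
      show ?case unfolding x simple_integral_Cons
        using Cons by (intro continuous_intros w) (auto simp: x)
    qed simp
    then show ?case
      unfolding right_continuous_path_def continuous_on_def
      by (auto intro: tendsto_within_subset)
  qed
qed

text \<open>The martingale property amounts to mean zero of \<open>1\<^sub>A (I\<^sub>t(S) - I\<^sub>s(S))\<close>, the terminal value of
  the restricted integrand.\<close>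
lemma simple_integral_M2:
  assumes S: "simple_integrand P \<T> F S"
  shows "simple_integral (W_comp j) S \<in> M2 P \<T> F"
proof (rule M2_realI[OF martingale_on_realI])
  note sq = simple_integral_adapted(2)[OF S]
  show "simple_integral (W_comp j) S t \<in> borel_measurable (F t)" if "t \<in> \<T>" for t
    by (rule simple_integral_adapted(1)[OF S that])
  show "square_integrable P (simple_integral (W_comp j) S t)" if "t \<in> \<T>" for t
    by (rule sq[OF that])
  then show "integrable P (simple_integral (W_comp j) S t)" if "t \<in> \<T>" for t
    using square_integrable_integrable that by blast
  show "AE \<omega> in P. right_continuous_path (\<lambda>t. simple_integral (W_comp j) S t \<omega>)"
    by (rule simple_integral_right_continuous[OF S])
  fix s t A assume st: "s \<in> \<T>" "t \<in> \<T>" "s \<le> t" and A: "A \<in> sets (F s)"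
  have Asq: "square_integrable P (indicator A)"
    by (rule bounded_at_square_integrable[OF bounded_at_indicator[OF A] st(1)])
  have "0 = (\<integral>\<omega>. simple_integral (W_comp j) (restrict_integrand s t A S) T \<omega> \<partial>P)"
    using simple_integral_mean[OF restrict_integrand_integrand[OF st(1,2) A S]] by simp
  also have "\<dots> = (\<integral>\<omega>. indicator A \<omega> * simple_integral (W_comp j) S t \<omega>
      - indicator A \<omega> * simple_integral (W_comp j) S s \<omega> \<partial>P)"
    unfolding restrict_integrand_integral[OF st S] by (simp add: algebra_simps)
  also have "\<dots> = (\<integral>\<omega>. indicator A \<omega> * simple_integral (W_comp j) S t \<omega> \<partial>P)
      - (\<integral>\<omega>. indicator A \<omega> * simple_integral (W_comp j) S s \<omega> \<partial>P)"
    using square_integrable_mult[OF Asq sq[OF st(1)]] square_integrable_mult[OF Asq sq[OF st(2)]] by simp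
  finally show "(\<integral>\<omega>. indicator A \<omega> * simple_integral (W_comp j) S t \<omega> \<partial>P)
      = (\<integral>\<omega>. indicator A \<omega> * simple_integral (W_comp j) S s \<omega> \<partial>P)" by simp
qed

lemma elementary_isometry:
  assumes ab: "a \<in> \<T>" "b \<in> \<T>" "a < b" "bounded_at a \<xi>" and ab': "a' \<in> \<T>" "b' \<in> \<T>" "a' < b'" "bounded_at a' \<eta>"
  shows "(\<integral>\<omega>. (\<xi> \<omega> * inc i a b \<omega>) * (\<eta> \<omega> * inc j a' b' \<omega>) \<partial>P)
    = (if i = j then \<integral>(s, \<omega>). (\<xi> \<omega> * indicator {a<..b} s) * (\<eta> \<omega> * indicator {a'<..b'} s) \<partial>predictable_measure else 0)"
proof -
  have "bounded_at (max a a') (\<lambda>\<omega>. \<xi> \<omega> * \<eta> \<omega>)"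
    by (intro bounded_at_mult bounded_at_mono[OF ab(1) _ _ ab(4)] bounded_at_mono[OF ab'(1) _ _ ab'(4)])
      (auto simp: max_in ab ab')
  from integral_elementary[OF max_in[OF ab(1) ab'(1)] min_in[OF ab(2) ab'(2)] this]
  have "(\<integral>(s, \<omega>). (\<xi> \<omega> * \<eta> \<omega>) * indicator {max a a'<..min b b'} s \<partial>predictable_measure)
      = max 0 (min b b' - max a a') * (\<integral>\<omega>. \<xi> \<omega> * \<eta> \<omega> \<partial>P)" .
  moreover have "(\<xi> \<omega> * \<eta> \<omega>) * indicator {max a a'<..min b b'} s
      = (\<xi> \<omega> * indicator {a<..b} s) * (\<eta> \<omega> * indicator {a'<..b'} s)" for s \<omega>
    by (auto simp: indicator_def)
  ultimately show ?thesis using inc_covariance[OF ab(1-3) ab'(1-3) ab(4) ab'(4), of i j] by simp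
qed

text \<open>Bilinear extension of the elementary case, by induction over both lists; the entries may overlap
  arbitrarily.  Integrals against different coordinates of \<open>W\<close> are orthogonal.\<close>
theorem simple_integral_isometry:
  assumes S: "simple_integrand P \<T> F S" and S': "simple_integrand P \<T> F S'"
  shows "(\<integral>\<omega>. simple_integral (W_comp i) S T \<omega> * simple_integral (W_comp j) S' T \<omega> \<partial>P)
    = (if i = j then \<integral>(s, \<omega>). simple_process S s \<omega> * simple_process S' s \<omega> \<partial>predictable_measure else 0)"
proof -
  have min_T: "min u T = u" if "u \<in> \<T>" for u using T_bounds[OF that] by simp
  have el: "square_integrable P (\<lambda>\<omega>. \<xi> \<omega> * inc k a b \<omega>)"
    "square_integrable predictable_measure (\<lambda>(s, \<omega>). \<xi> \<omega> * indicator {a<..b} s)"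
    if "a \<in> \<T>" "b \<in> \<T>" "a < b" "bounded_at a \<xi>" for a b \<xi> k
    using bounded_at_times_square_integrable[OF that(4,1) inc_square_integrable[OF that(1,2)]] that
      simple_process_square_integrable[of "[(a, b, \<xi>)]"] by auto
  note sq = simple_integral_adapted(2)[OF _ T_in] 
  note psq = simple_process_square_integrable
  have one: "(\<integral>\<omega>. (\<xi> \<omega> * inc i a b \<omega>) * simple_integral (W_comp j) S' T \<omega> \<partial>P)
    = (if i = j then \<integral>(s, \<omega>). (\<xi> \<omega> * indicator {a<..b} s) * simple_process S' s \<omega> \<partial>predictable_measure else 0)"
    if ab: "a \<in> \<T>" "b \<in> \<T>" "a < b" "bounded_at a \<xi>" for a b \<xi>
    using S'
  proof (induction S')
    case (Cons x S')
    obtain a' b' \<eta> where x: "x = (a', b', \<eta>)" by (cases x)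
    have ab': "a' \<in> \<T>" "b' \<in> \<T>" "a' < b'" "bounded_at a' \<eta>" and S': "simple_integrand P \<T> F S'"
      using Cons.prems by (auto simp: x)
    have "(\<integral>\<omega>. (\<xi> \<omega> * inc i a b \<omega>) * simple_integral (W_comp j) (x # S') T \<omega> \<partial>P)
      = (\<integral>\<omega>. (\<xi> \<omega> * inc i a b \<omega>) * (\<eta> \<omega> * inc j a' b' \<omega>)
          + (\<xi> \<omega> * inc i a b \<omega>) * simple_integral (W_comp j) S' T \<omega> \<partial>P)"
      by (simp add: x min_T ab' inc_def algebra_simps)
    also have "\<dots> = (\<integral>\<omega>. (\<xi> \<omega> * inc i a b \<omega>) * (\<eta> \<omega> * inc j a' b' \<omega>) \<partial>P)
          + (\<integral>\<omega>. (\<xi> \<omega> * inc i a b \<omega>) * simple_integral (W_comp j) S' T \<omega> \<partial>P)"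
      by (intro Bochner_Integration.integral_add square_integrable_mult el(1)[OF ab] el(1)[OF ab'] sq[OF S'])
    also have "\<dots> = (if i = j then (\<integral>(s, \<omega>). (\<xi> \<omega> * indicator {a<..b} s) * (\<eta> \<omega> * indicator {a'<..b'} s) \<partial>predictable_measure)
        + (\<integral>(s, \<omega>). (\<xi> \<omega> * indicator {a<..b} s) * simple_process S' s \<omega> \<partial>predictable_measure) else 0)"
      unfolding elementary_isometry[OF ab ab'] Cons.IH[OF S'] by simp
    also have "(\<integral>(s, \<omega>). (\<xi> \<omega> * indicator {a<..b} s) * (\<eta> \<omega> * indicator {a'<..b'} s) \<partial>predictable_measure)
        + (\<integral>(s, \<omega>). (\<xi> \<omega> * indicator {a<..b} s) * simple_process S' s \<omega> \<partial>predictable_measure)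
      = (\<integral>(s, \<omega>). (\<xi> \<omega> * indicator {a<..b} s) * simple_process (x # S') s \<omega> \<partial>predictable_measure)"
      using square_integrable_mult[OF el(2)[OF ab] el(2)[OF ab']]
        square_integrable_mult[OF el(2)[OF ab] psq[OF S']]
      by (simp add: x case_prod_beta' distrib_left)
    finally show ?case .
  qed (simp add: case_prod_beta')
  show ?thesis
    using S
  proof (induction S)
    case (Cons x S)
    obtain a b \<xi> where x: "x = (a, b, \<xi>)" by (cases x)
    have ab: "a \<in> \<T>" "b \<in> \<T>" "a < b" "bounded_at a \<xi>" and S: "simple_integrand P \<T> F S"
      using Cons.prems by (auto simp: x)
    have "(\<integral>\<omega>. simple_integral (W_comp i) (x # S) T \<omega> * simple_integral (W_comp j) S' T \<omega> \<partial>P)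
      = (\<integral>\<omega>. (\<xi> \<omega> * inc i a b \<omega>) * simple_integral (W_comp j) S' T \<omega>
          + simple_integral (W_comp i) S T \<omega> * simple_integral (W_comp j) S' T \<omega> \<partial>P)"
      by (simp add: x min_T ab inc_def algebra_simps)
    also have "\<dots> = (\<integral>\<omega>. (\<xi> \<omega> * inc i a b \<omega>) * simple_integral (W_comp j) S' T \<omega> \<partial>P)
          + (\<integral>\<omega>. simple_integral (W_comp i) S T \<omega> * simple_integral (W_comp j) S' T \<omega> \<partial>P)"
      by (intro Bochner_Integration.integral_add square_integrable_mult el(1)[OF ab] sq[OF S'] sq[OF S])
    also have "\<dots> = (if i = j then (\<integral>(s, \<omega>). (\<xi> \<omega> * indicator {a<..b} s) * simple_process S' s \<omega> \<partial>predictable_measure)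
        + (\<integral>(s, \<omega>). simple_process S s \<omega> * simple_process S' s \<omega> \<partial>predictable_measure) else 0)"
      unfolding one[OF ab] Cons.IH[OF S] by simp
    also have "(\<integral>(s, \<omega>). (\<xi> \<omega> * indicator {a<..b} s) * simple_process S' s \<omega> \<partial>predictable_measure)
        + (\<integral>(s, \<omega>). simple_process S s \<omega> * simple_process S' s \<omega> \<partial>predictable_measure)
      = (\<integral>(s, \<omega>). simple_process (x # S) s \<omega> * simple_process S' s \<omega> \<partial>predictable_measure)"
      using square_integrable_mult[OF el(2)[OF ab] psq[OF S']]
        square_integrable_mult[OF psq[OF S] psq[OF S']]
      by (simp add: x case_prod_beta' distrib_right)
    finally show ?case .
  qed (simp add: case_prod_beta')
qed

section \<open>Density of simple processes\<close>

abbreviation process_fun :: "(real \<Rightarrow> 'w \<Rightarrow> real) \<Rightarrow> real \<times> 'w \<Rightarrow> real" where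
  "process_fun H \<equiv> \<lambda>(s, \<omega>). H s \<omega>"

lemma predictable_generator_Int_stable:
  "Int_stable {({s<..t} \<inter> \<T>) \<times> A | s t A. s \<in> \<T> \<and> t \<in> \<T> \<and> s < t \<and> A \<in> sets (F s)}" (is "Int_stable ?G")
proof (rule Int_stableI)
  fix B B' assume "B \<in> ?G" "B' \<in> ?G"
  then obtain s t A s' t' A' where B: "B = ({s<..t} \<inter> \<T>) \<times> A" "s \<in> \<T>" "t \<in> \<T>" "A \<in> sets (F s)"
    and B': "B' = ({s'<..t'} \<inter> \<T>) \<times> A'" "s' \<in> \<T>" "t' \<in> \<T>" "A' \<in> sets (F s')"
    by blast
  have eq: "B \<inter> B' = ({max s s'<..min t t'} \<inter> \<T>) \<times> (A \<inter> A')"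
    by (auto simp: B(1) B'(1))
  show "B \<inter> B' \<in> ?G"
  proof (cases "max s s' < min t t'")
    case True
    have "A \<in> sets (F (max s s'))" "A' \<in> sets (F (max s s'))"
      using F_mono[OF B(2) max_in[OF B(2) B'(2)]] F_mono[OF B'(2) max_in[OF B(2) B'(2)]] B(4) B'(4) by auto
    then have "A \<inter> A' \<in> sets (F (max s s'))" by blast
    then show ?thesis
      unfolding eq using True max_in[OF B(2) B'(2)] min_in[OF B(3) B'(3)] by blast
  next
    case False
    then have "B \<inter> B' = ({0<..T} \<inter> \<T>) \<times> {}" unfolding eq by auto
    then show ?thesis using zero_in T_in T_pos by blast
  qed
qed

text \<open>The sets over which \<open>h\<close> has integral \<open>0\<close> form a Dynkin system, and the rectangles are stable under
  intersection.\<close>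
lemma AE_zero_if_orthogonal_to_rectangles:
  fixes h :: "real \<times> 'w \<Rightarrow> real"
  assumes h: "integrable predictable_measure h"
    and ortho: "\<And>s t A. s \<in> \<T> \<Longrightarrow> t \<in> \<T> \<Longrightarrow> s < t \<Longrightarrow> A \<in> sets (F s) \<Longrightarrow>
      (\<integral>x\<in>({s<..t} \<inter> \<T>) \<times> A. h x \<partial>predictable_measure) = 0"
  shows "AE x in predictable_measure. h x = 0"
proof -
  let ?\<Omega> = "(\<T> \<inter> {0<..}) \<times> space P"
  let ?G = "{({s<..t} \<inter> \<T>) \<times> A | s t A. s \<in> \<T> \<and> t \<in> \<T> \<and> s < t \<and> A \<in> sets (F s)}"
  have sets: "sets predictable_measure = sigma_sets ?\<Omega> ?G"
    by (simp add: sets_predictable_measure sets_predictable)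
  have si: "set_integrable predictable_measure B h" if "B \<in> sets predictable_measure" for B
    unfolding set_integrable_def by (rule integrable_mult_indicator[OF that h])
  have \<Omega>: "?\<Omega> \<in> sets predictable_measure" using sets.top[of predictable_measure] by (simp add: space_predictable_measure)
  have top: "(\<integral>x\<in>?\<Omega>. h x \<partial>predictable_measure) = 0"
  proof -
    have "?\<Omega> = ({0<..T} \<inter> \<T>) \<times> space P" using T_bounds by auto
    moreover have "space P \<in> sets (F 0)" using sets.top[of "F 0"] space_F[OF zero_in] by simp
    ultimately show ?thesis using ortho[OF zero_in T_in T_pos] by simp
  qed
  have zero: "(\<integral>x\<in>B. h x \<partial>predictable_measure) = 0" if "B \<in> sets predictable_measure" for B
    using predictable_generator_Int_stable predictable_generator_subset that[unfolded sets]
  proof (induction rule: sigma_sets_induct_disjoint)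
    case (basic B)
    then show ?case using ortho by blast
  next
    case empty
    then show ?case by (simp add: set_lebesgue_integral_def)
  next
    case (compl B)
    then have B: "B \<in> sets predictable_measure" by (simp add: sets)
    then have "B \<subseteq> ?\<Omega>" using sets.sets_into_space[OF B] by (simp add: space_predictable_measure)
    then have "?\<Omega> = B \<union> (?\<Omega> - B)" by auto
    moreover have "(\<integral>x\<in>B \<union> (?\<Omega> - B). h x \<partial>predictable_measure)
        = (\<integral>x\<in>B. h x \<partial>predictable_measure) + (\<integral>x\<in>?\<Omega> - B. h x \<partial>predictable_measure)"
      by (rule set_integral_Un) (use B \<Omega> in \<open>auto intro!: si\<close>)
    ultimately show ?case using top compl by simp
  next
    case (union A)
    then have A: "A i \<in> sets predictable_measure" for i by (auto simp: sets)
    have "(\<integral>x\<in>(\<Union>i. A i). h x \<partial>predictable_measure) = (\<Sum>i. \<integral>x\<in>A i. h x \<partial>predictable_measure)"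
      by (rule lebesgue_integral_countable_add)
        (use A union(1) in \<open>auto intro!: si simp: disjoint_family_on_def\<close>)
    then show ?case using union by simp
  qed
  have "AE x in predictable_measure. h x = (\<lambda>_. 0) x"
  proof (rule density_unique_real[OF h])
    show "(\<integral>x\<in>B. h x \<partial>predictable_measure) = (\<integral>x\<in>B. 0 \<partial>predictable_measure)"
      if "B \<in> sets predictable_measure" for B
      using zero[OF that] by (simp add: set_lebesgue_integral_def)
  qed simp
  then show ?thesis by simp
qed

text \<open>The residual of the projection of \<open>H\<close> on the simple processes is orthogonal to the indicators of
  predictable rectangles, which are simple processes themselves.\<close>
theorem simple_processes_dense:
  assumes H: "square_integrable predictable_measure H"
  obtains S where "\<And>n. simple_integrand P \<T> F (S n)"
    "L2_tendsto predictable_measure (\<lambda>n. process_fun (simple_process (S n))) H"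
proof -
  let ?V = "{process_fun (simple_process S) | S. simple_integrand P \<T> F S}"
  have lin: "(\<lambda>x. v x + c * w x) \<in> ?V" if vw: "v \<in> ?V" "w \<in> ?V" for v w c
  proof -
    obtain S S' where S: "simple_integrand P \<T> F S" "v = process_fun (simple_process S)"
      and S': "simple_integrand P \<T> F S'" "w = process_fun (simple_process S')" using vw by blast
    have "(\<lambda>x. v x + c * w x) = process_fun (simple_process (add_scaled S c S'))"
      unfolding S S' by (simp add: add_scaled_process case_prod_beta')
    then show ?thesis using add_scaled_integrand[OF S(1) S'(1)] by blast
  qed
  have "simple_integrand P \<T> F []" by simp
  then have ne: "?V \<noteq> {}" by blast
  have "square_integrable predictable_measure v" if "v \<in> ?V" for v
    using that simple_process_square_integrable by blast
  from L2_projection[OF H this ne lin]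
  obtain v g where v: "\<And>n. v n \<in> ?V" and g: "L2_tendsto predictable_measure v g"
    and ortho: "\<And>w. w \<in> ?V \<Longrightarrow> (\<integral>x. (H x - g x) * w x \<partial>predictable_measure) = 0"
    by blast
  have "\<forall>n. \<exists>S. simple_integrand P \<T> F S \<and> v n = process_fun (simple_process S)" using v by blast
  then obtain S where S: "\<And>n. simple_integrand P \<T> F (S n)" "\<And>n. v n = process_fun (simple_process (S n))"
    by metis
  have gs: "square_integrable predictable_measure g" using g by (simp add: L2_tendsto_def)
  interpret NP: finite_measure predictable_measure by (rule finite_measure_predictable_measure)
  have "AE x in predictable_measure. H x - g x = 0"
  proof (rule AE_zero_if_orthogonal_to_rectangles)
    show "integrable predictable_measure (\<lambda>x. H x - g x)"
      by (rule NP.square_integrable_integrable[OF square_integrable_diff[OF H gs]])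
    fix s t A assume st: "s \<in> \<T>" "t \<in> \<T>" "s < t" and A: "A \<in> sets (F s)"
    have "simple_integrand P \<T> F [(s, t, indicator A)]"
      using st bounded_at_indicator[OF A] by simp
    then have "process_fun (simple_process [(s, t, indicator A)]) \<in> ?V" by blast
    from ortho[OF this] have "(\<integral>x. (H x - g x) * process_fun (simple_process [(s, t, indicator A)]) x \<partial>predictable_measure) = 0" .
    moreover have "(\<integral>x\<in>({s<..t} \<inter> \<T>) \<times> A. H x - g x \<partial>predictable_measure)
        = (\<integral>x. (H x - g x) * process_fun (simple_process [(s, t, indicator A)]) x \<partial>predictable_measure)"
      unfolding set_lebesgue_integral_def
      by (rule Bochner_Integration.integral_cong)
        (auto simp: space_predictable_measure indicator_def)
    ultimately show "(\<integral>x\<in>({s<..t} \<inter> \<T>) \<times> A. H x - g x \<partial>predictable_measure) = 0" by simp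
  qed
  then have "AE x in predictable_measure. g x = H x" by eventually_elim simp
  then have "L2_tendsto predictable_measure v H"
    using L2_tendsto_AE_cong[OF g] H by (simp add: square_integrable_def)
  moreover have "v = (\<lambda>n. process_fun (simple_process (S n)))" using S(2) by blast
  ultimately show ?thesis using that[OF S(1)] by simp
qed

section \<open>The stochastic integral\<close>

lemma simple_integral_sq_dist:
  assumes S: "simple_integrand P \<T> F S" and S': "simple_integrand P \<T> F S'"
  shows "sq_dist P (simple_integral (W_comp j) S T) (simple_integral (W_comp j) S' T)
    = sq_dist predictable_measure (process_fun (simple_process S)) (process_fun (simple_process S'))"
proof -
  have D: "simple_integrand P \<T> F (add_scaled S (-1) S')" by (rule add_scaled_integrand[OF S S'])
  have "sq_dist P (simple_integral (W_comp j) S T) (simple_integral (W_comp j) S' T)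
      = (\<integral>\<omega>. simple_integral (W_comp j) (add_scaled S (-1) S') T \<omega> * simple_integral (W_comp j) (add_scaled S (-1) S') T \<omega> \<partial>P)"
    by (simp add: sq_dist_def add_scaled_integral power2_eq_square)
  also have "\<dots> = sq_dist predictable_measure (process_fun (simple_process S)) (process_fun (simple_process S'))"
    unfolding simple_integral_isometry[OF D D]
    by (simp add: sq_dist_def add_scaled_process power2_eq_square case_prod_beta')
  finally show ?thesis .
qed

lemma nn_integral_process_sq_dist:
  assumes "square_integrable predictable_measure (process_fun G)" "square_integrable predictable_measure (process_fun H)"
  shows "(\<integral>\<^sup>+\<omega>. (\<integral>\<^sup>+s. ennreal ((G s \<omega> - H s \<omega>)\<^sup>2) \<partial>nabla_measure \<T>) \<partial>P)
    = ennreal (sq_dist predictable_measure (process_fun G) (process_fun H))"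
proof -
  have m: "(\<lambda>x. ennreal ((process_fun G x - process_fun H x)\<^sup>2)) \<in> borel_measurable predictable_measure"
    using square_integrable_measurable[OF square_integrable_diff[OF assms]]
    by (intro measurable_compose[OF _ measurable_ennreal] borel_measurable_power)
  then have "(\<lambda>x. ennreal ((process_fun G x - process_fun H x)\<^sup>2)) \<in> borel_measurable (predictable_sigma P \<T> F)"
    by (simp add: measurable_cong_sets[OF sets_predictable_measure refl])
  from nn_integral_predictable_measure[OF this] nn_integral_sq_dist[OF assms]
  show ?thesis by simp
qed

text \<open>The extended nonnegative integrals in the definition, rewritten as convergence in the two \<open>L\<^sup>2\<close>
  spaces.\<close>
lemma is_scalar_integral_iff:
  assumes H: "square_integrable predictable_measure (process_fun H)"
  shows "is_scalar_integral P \<T> F (W_comp j) H J \<longleftrightarrow> J \<in> M2 P \<T> F \<and>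
    (\<exists>S. (\<forall>n. simple_integrand P \<T> F (S n)) \<and>
      L2_tendsto predictable_measure (\<lambda>n. process_fun (simple_process (S n))) (process_fun H) \<and>
      (\<forall>t\<in>\<T>. L2_tendsto P (\<lambda>n. simple_integral (W_comp j) (S n) t) (J t)))"
proof -
  have e0: "(\<lambda>n. ennreal (a n)) \<longlonglongrightarrow> 0 \<longleftrightarrow> a \<longlonglongrightarrow> 0" if "\<And>n. 0 \<le> a n" for a :: "nat \<Rightarrow> real"
    using tendsto_ennreal_iff[of a sequentially 0] that by simp
  have 1: "(\<lambda>n. \<integral>\<^sup>+\<omega>. (\<integral>\<^sup>+s. ennreal ((simple_process (S n) s \<omega> - H s \<omega>)\<^sup>2) \<partial>nabla_measure \<T>) \<partial>P) \<longlonglongrightarrow> 0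
      \<longleftrightarrow> L2_tendsto predictable_measure (\<lambda>n. process_fun (simple_process (S n))) (process_fun H)"
    if "\<forall>n. simple_integrand P \<T> F (S n)" for S
    using that H simple_process_square_integrable
    by (simp add: nn_integral_process_sq_dist L2_tendsto_def e0 sq_dist_nonneg)
  have 2: "(\<lambda>n. \<integral>\<^sup>+\<omega>. ennreal ((simple_integral (W_comp j) (S n) t \<omega> - J t \<omega>)\<^sup>2) \<partial>P) \<longlonglongrightarrow> 0
      \<longleftrightarrow> L2_tendsto P (\<lambda>n. simple_integral (W_comp j) (S n) t) (J t)"
    if "\<forall>n. simple_integrand P \<T> F (S n)" "J \<in> M2 P \<T> F" "t \<in> \<T>" for S t
    using that M2_realD(2)[OF that(2,3)] simple_integral_adapted(2)[OF that(1)[rule_format] that(3), of j]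
    by (simp add: nn_integral_sq_dist L2_tendsto_def e0 sq_dist_nonneg)
  show ?thesis
    unfolding is_scalar_integral_def using 1 2 by (intro conj_cong refl ex_cong1) auto
qed

text \<open>By the isometry the integrals of an approximating sequence are Cauchy at time \<open>T\<close>, so
  completeness of the martingale space provides the limit.\<close>
lemma scalar_integral_exists:
  assumes H: "square_integrable predictable_measure (process_fun H)"
  shows "\<exists>J. is_scalar_integral P \<T> F (W_comp j) H J"
proof -
  obtain S where S: "\<And>n. simple_integrand P \<T> F (S n)"
    and lim: "L2_tendsto predictable_measure (\<lambda>n. process_fun (simple_process (S n))) (process_fun H)"
    using simple_processes_dense[OF H] by blast
  have "L2_Cauchy P (\<lambda>n. simple_integral (W_comp j) (S n) T)"
    using L2_tendsto_imp_L2_Cauchy[OF lim] simple_integral_adapted(2)[OF S T_in]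
    by (simp add: L2_Cauchy_def simple_integral_sq_dist S)
  from M2_complete[OF simple_integral_M2[OF S] this]
  obtain J where "J \<in> M2 P \<T> F" "\<And>t. t \<in> \<T> \<Longrightarrow> L2_tendsto P (\<lambda>n. simple_integral (W_comp j) (S n) t) (J t)"
    by blast
  with S lim show ?thesis unfolding is_scalar_integral_iff[OF H] by blast
qed

lemma scalar_integral_is:
  assumes "square_integrable predictable_measure (process_fun H)"
  shows "is_scalar_integral P \<T> F (W_comp j) H (scalar_integral P \<T> F (W_comp j) H)"
  unfolding scalar_integral_def by (rule someI_ex[OF scalar_integral_exists[OF assms]])

text \<open>The definition fixes one approximating sequence; by the isometry any other one has the same
  limit at \<open>T\<close>.\<close>
lemma scalar_integral_continuous:
  assumes H: "square_integrable predictable_measure (process_fun H)"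
    and J: "is_scalar_integral P \<T> F (W_comp j) H J"
    and S: "\<And>n. simple_integrand P \<T> F (S n)"
    and lim: "L2_tendsto predictable_measure (\<lambda>n. process_fun (simple_process (S n))) (process_fun H)"
  shows "L2_tendsto P (\<lambda>n. simple_integral (W_comp j) (S n) T) (J T)"
proof -
  obtain R where R: "\<And>n. simple_integrand P \<T> F (R n)"
    and limR: "L2_tendsto predictable_measure (\<lambda>n. process_fun (simple_process (R n))) (process_fun H)"
    and limJ: "L2_tendsto P (\<lambda>n. simple_integral (W_comp j) (R n) T) (J T)"
    using J T_in unfolding is_scalar_integral_iff[OF H] by blast
  note sq = simple_integral_adapted(2)[OF _ T_in] and psq = simple_process_square_integrable
  have JT: "square_integrable P (J T)" using limJ by (simp add: L2_tendsto_def)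
  let ?p = "\<lambda>S. process_fun (simple_process S)" and ?h = "process_fun H"
  let ?I = "\<lambda>S. simple_integral (W_comp j) S T"
  show ?thesis
  proof (rule L2_tendstoI_le[OF sq[OF S] JT])
    show "sq_dist P (?I (S n)) (J T) \<le> 4 * sq_dist predictable_measure (?p (S n)) ?h
        + 4 * sq_dist predictable_measure (?p (R n)) ?h + 2 * sq_dist P (?I (R n)) (J T)" for n
      using sq_dist_triangle[OF sq[OF S] sq[OF R] JT, of j n j n]
        sq_dist_triangle[OF psq[OF S] H psq[OF R], of n n]
      unfolding simple_integral_sq_dist[OF S R] sq_dist_commute[of predictable_measure ?h] by linarith
    have "(\<lambda>n. 4 * sq_dist predictable_measure (?p (S n)) ?h
        + 4 * sq_dist predictable_measure (?p (R n)) ?h + 2 * sq_dist P (?I (R n)) (J T))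
        \<longlonglongrightarrow> 4 * 0 + 4 * 0 + 2 * 0"
      using lim limR limJ by (intro tendsto_intros) (auto simp: L2_tendsto_def)
    then show "(\<lambda>n. 4 * sq_dist predictable_measure (?p (S n)) ?h
        + 4 * sq_dist predictable_measure (?p (R n)) ?h + 2 * sq_dist P (?I (R n)) (J T)) \<longlonglongrightarrow> 0"
      by simp
  qed
qed

lemma scalar_integral_at_0:
  assumes H: "square_integrable predictable_measure (process_fun H)"
    and J: "is_scalar_integral P \<T> F (W_comp j) H J"
  shows "AE \<omega> in P. J 0 \<omega> = 0"
proof -
  obtain S where S: "\<And>n. simple_integrand P \<T> F (S n)"
    and lim: "L2_tendsto P (\<lambda>n. simple_integral (W_comp j) (S n) 0) (J 0)"
    using J zero_in unfolding is_scalar_integral_iff[OF H] by blast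
  have zero: "simple_integral (W_comp j) R 0 = (\<lambda>_. 0)" if "simple_integrand P \<T> F R" for R
    using that
  proof (induction R)
    case (Cons x R)
    obtain a b \<xi> where x: "x = (a, b, \<xi>)" by (cases x)
    with Cons T_bounds[of a] T_bounds[of b] show ?case by (simp add: min_absorb2)
  qed simp
  have "L2_tendsto P (\<lambda>n _. 0) (\<lambda>_. 0)" by (simp add: L2_tendsto_def sq_dist_def)
  moreover have "L2_tendsto P (\<lambda>n _. 0) (J 0)" using lim by (simp add: zero[OF S])
  ultimately show ?thesis using L2_tendsto_unique by blast
qed

text \<open>For a simple \<open>R\<close> and \<open>A \<in> F\<^sub>s\<close> the variable \<open>Y = 1\<^sub>A (I\<^sub>t(R) - I\<^sub>s(R))\<close> is a terminal value, so
  \<open>0 = E N\<^sub>T Y = E N\<^sub>t Y\<close>; and \<open>E 1\<^sub>A I\<^sub>s(R) N\<^sub>t = E 1\<^sub>A I\<^sub>s(R) N\<^sub>s\<close> because \<open>N\<close> is a martingale.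
  Together they give the martingale identity for \<open>N I(R)\<close>, which passes to \<open>L\<^sup>2\<close> limits.\<close>
lemma martingale_mult_scalar_integral:
  assumes H: "square_integrable predictable_measure (process_fun H)"
    and J: "is_scalar_integral P \<T> F (W_comp j) H J"
    and N: "N \<in> M2 P \<T> F"
    and ortho: "\<And>S. simple_integrand P \<T> F S \<Longrightarrow> (\<integral>\<omega>. N T \<omega> * simple_integral (W_comp j) S T \<omega> \<partial>P) = 0"
  shows "martingale_on P \<T> F (\<lambda>t \<omega>. N t \<omega> * J t \<omega>)"
proof -
  obtain S where S: "\<And>n. simple_integrand P \<T> F (S n)" and JM: "J \<in> M2 P \<T> F"
    and lim: "\<And>t. t \<in> \<T> \<Longrightarrow> L2_tendsto P (\<lambda>n. simple_integral (W_comp j) (S n) t) (J t)"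
    using J unfolding is_scalar_integral_iff[OF H] by blast
  note Nsq = M2_realD(2)[OF N] and Jsq = M2_realD(2)[OF JM]
  show ?thesis
  proof (rule martingale_on_realI)
    show "(\<lambda>\<omega>. N t \<omega> * J t \<omega>) \<in> borel_measurable (F t)" if "t \<in> \<T>" for t
      by (intro borel_measurable_times M2_realD(4)[OF N that] M2_realD(4)[OF JM that])
    show "integrable P (\<lambda>\<omega>. N t \<omega> * J t \<omega>)" if "t \<in> \<T>" for t
      by (rule square_integrable_mult[OF Nsq[OF that] Jsq[OF that]])
    fix s t A assume st: "s \<in> \<T>" "t \<in> \<T>" "s \<le> t" and A: "A \<in> sets (F s)"
    have tT: "t \<le> T" using T_bounds[OF st(2)] by simp
    have bA: "bounded_at s (indicator A)" by (rule bounded_at_indicator[OF A])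
    have AX: "square_integrable P (\<lambda>\<omega>. indicator A \<omega> * X \<omega>)" if "square_integrable P X" for X
      by (rule bounded_at_times_square_integrable[OF bA st(1) that])
    have simple: "(\<integral>\<omega>. (indicator A \<omega> * N t \<omega>) * simple_integral (W_comp j) R t \<omega> \<partial>P)
        = (\<integral>\<omega>. (indicator A \<omega> * N s \<omega>) * simple_integral (W_comp j) R s \<omega> \<partial>P)"
      if R: "simple_integrand P \<T> F R" for R
    proof -
      let ?I = "\<lambda>t. simple_integral (W_comp j) R t"
      note Isq = simple_integral_adapted(2)[OF R, of _ j] and Im = simple_integral_adapted(1)[OF R, of _ j]
      have Am: "(indicator A :: 'w \<Rightarrow> real) \<in> borel_measurable (F u)" if "u \<in> \<T>" "s \<le> u" for u
        using bounded_at_mono[OF st(1) that bA] by (simp add: bounded_at_def)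
      define Y where "Y \<omega> = indicator A \<omega> * (?I t \<omega> - ?I s \<omega>)" for \<omega>
      have Ysq: "square_integrable P Y"
        unfolding Y_def by (intro AX square_integrable_diff Isq st)
      have Ym: "Y \<in> borel_measurable (F t)"
        unfolding Y_def
        by (intro borel_measurable_times borel_measurable_diff Am Im st measurable_F_mono[OF st Im[OF st(1)]])
      have "0 = (\<integral>\<omega>. N T \<omega> * Y \<omega> \<partial>P)"
        using ortho[OF restrict_integrand_integrand[OF st(1,2) A R]]
        by (simp add: Y_def restrict_integrand_integral[OF st R])
      also have "\<dots> = (\<integral>\<omega>. Y \<omega> * N T \<omega> \<partial>P)" by (simp add: mult.commute)
      also have "\<dots> = (\<integral>\<omega>. Y \<omega> * N t \<omega> \<partial>P)"
        by (rule martingale_on_realD[OF M2_realD(1)[OF N] st(2) T_in tT Ym square_integrable_mult[OF Ysq Nsq[OF T_in]]])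
      also have "\<dots> = (\<integral>\<omega>. (indicator A \<omega> * N t \<omega>) * ?I t \<omega> - (indicator A \<omega> * ?I s \<omega>) * N t \<omega> \<partial>P)"
        by (simp add: Y_def algebra_simps)
      also have "\<dots> = (\<integral>\<omega>. (indicator A \<omega> * N t \<omega>) * ?I t \<omega> \<partial>P) - (\<integral>\<omega>. (indicator A \<omega> * ?I s \<omega>) * N t \<omega> \<partial>P)"
        by (intro Bochner_Integration.integral_diff square_integrable_mult AX Nsq Isq st)
      also have "(\<integral>\<omega>. (indicator A \<omega> * ?I s \<omega>) * N t \<omega> \<partial>P) = (\<integral>\<omega>. (indicator A \<omega> * ?I s \<omega>) * N s \<omega> \<partial>P)"
        by (rule martingale_on_realD[OF M2_realD(1)[OF N] st])
          (intro borel_measurable_times Am Im st order_refl square_integrable_mult AX Nsq Isq)+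
      finally show ?thesis by (simp add: ac_simps)
    qed
    have l: "(\<lambda>n. \<integral>\<omega>. (indicator A \<omega> * N u \<omega>) * simple_integral (W_comp j) (S n) u \<omega> \<partial>P)
        \<longlonglongrightarrow> (\<integral>\<omega>. indicator A \<omega> * (N u \<omega> * J u \<omega>) \<partial>P)" if "u \<in> \<T>" for u
      using L2_tendsto_integral_mult[OF lim[OF that] AX[OF Nsq[OF that]]]
      by (simp add: mult.commute mult.left_commute)
    show "(\<integral>\<omega>. indicator A \<omega> * (N t \<omega> * J t \<omega>) \<partial>P) = (\<integral>\<omega>. indicator A \<omega> * (N s \<omega> * J s \<omega>) \<partial>P)"
      using LIMSEQ_unique[OF l[OF st(1)]] l[OF st(2)] unfolding simple[OF S] by simp
  qed
qed

section \<open>Projection onto the stochastic integrals\<close>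

lemma sum_simple_integral_sq_dist:
  assumes S: "\<And>j. simple_integrand P \<T> F (S j)" and S': "\<And>j. simple_integrand P \<T> F (S' j)"
  shows "sq_dist P (\<lambda>\<omega>. \<Sum>j\<in>UNIV. simple_integral (W_comp j) (S j) T \<omega>) (\<lambda>\<omega>. \<Sum>j\<in>UNIV. simple_integral (W_comp j) (S' j) T \<omega>)
    = (\<Sum>j\<in>UNIV. sq_dist predictable_measure (process_fun (simple_process (S j))) (process_fun (simple_process (S' j))))"
proof -
  define D where "D j = add_scaled (S j) (-1) (S' j)" for j
  have D: "simple_integrand P \<T> F (D j)" for j unfolding D_def by (rule add_scaled_integrand[OF S S'])
  let ?I = "\<lambda>j. simple_integral (W_comp j) (D j) T"
  have int: "integrable P (\<lambda>\<omega>. ?I i \<omega> * ?I j \<omega>)" for i j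
    by (rule square_integrable_mult[OF simple_integral_adapted(2)[OF D T_in] simple_integral_adapted(2)[OF D T_in]])
  have "sq_dist P (\<lambda>\<omega>. \<Sum>j\<in>UNIV. simple_integral (W_comp j) (S j) T \<omega>) (\<lambda>\<omega>. \<Sum>j\<in>UNIV. simple_integral (W_comp j) (S' j) T \<omega>)
      = (\<integral>\<omega>. (\<Sum>i\<in>UNIV. \<Sum>j\<in>UNIV. ?I i \<omega> * ?I j \<omega>) \<partial>P)"
    unfolding sq_dist_def sum_product[symmetric] power2_eq_square
    by (simp add: D_def add_scaled_integral sum_subtractf)
  also have "\<dots> = (\<Sum>i\<in>UNIV. \<Sum>j\<in>UNIV. \<integral>\<omega>. ?I i \<omega> * ?I j \<omega> \<partial>P)"
    using int by (simp add: Bochner_Integration.integral_sum Bochner_Integration.integrable_sum)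
  also have "\<dots> = (\<Sum>i\<in>UNIV. sq_dist predictable_measure (process_fun (simple_process (S i))) (process_fun (simple_process (S' i))))"
    unfolding simple_integral_isometry[OF D D]
    by (simp add: sum.delta D_def add_scaled_process sq_dist_def power2_eq_square case_prod_beta' cong: if_cong)
  finally show ?thesis .
qed

text \<open>The projection is the limit of simple integrals \<open>v n\<close>.  Their integrands are Cauchy coordinate by
  coordinate, and continuity of the integral identifies the limit of \<open>v n\<close> with the sum of the
  integrals of the limits \<open>H j\<close>.  Quantifying over all \<open>J\<close> makes the result independent of which version
  of the integral is chosen.\<close>
theorem projection_onto_stochastic_integrals:
  assumes \<zeta>: "square_integrable P \<zeta>"
  obtains H :: "'d \<Rightarrow> real \<Rightarrow> 'w \<Rightarrow> real" where "\<And>j. square_integrable predictable_measure (process_fun (H j))"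
    "\<And>J j S. (\<And>j. is_scalar_integral P \<T> F (W_comp j) (H j) (J j)) \<Longrightarrow> simple_integrand P \<T> F S \<Longrightarrow>
      (\<integral>\<omega>. (\<zeta> \<omega> - (\<Sum>j\<in>UNIV. J j T \<omega>)) * simple_integral (W_comp j) S T \<omega> \<partial>P) = 0"
proof -
  define I where "I S \<omega> = (\<Sum>j\<in>UNIV. simple_integral (W_comp j) (S j) T \<omega>)" for S \<omega>
  let ?V = "{I S | S. \<forall>j. simple_integrand P \<T> F (S j)}"
  have sq: "square_integrable P (I S)" if "\<forall>j. simple_integrand P \<T> F (S j)" for S
    unfolding I_def using that by (intro square_integrable_sum simple_integral_adapted(2) T_in) auto
  have lin: "(\<lambda>x. v x + c * w x) \<in> ?V" if vw: "v \<in> ?V" "w \<in> ?V" for v w c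
  proof -
    obtain S S' where S: "\<forall>j. simple_integrand P \<T> F (S j)" "v = I S"
      and S': "\<forall>j. simple_integrand P \<T> F (S' j)" "w = I S'" using vw by blast
    have "(\<lambda>x. v x + c * w x) = I (\<lambda>j. add_scaled (S j) c (S' j))"
      unfolding S S' I_def by (simp add: add_scaled_integral sum.distrib sum_distrib_left)
    moreover have "\<forall>j. simple_integrand P \<T> F (add_scaled (S j) c (S' j))"
      using add_scaled_integrand S(1) S'(1) by blast
    ultimately show ?thesis by blast
  qed
  have ne: "?V \<noteq> {}"
  proof -
    have "I (\<lambda>_. []) \<in> ?V" by (rule CollectI, rule exI[of _ "\<lambda>_. []"]) simp
    then show ?thesis by blast
  qed
  have "square_integrable P v" if "v \<in> ?V" for v using that sq by blast
  from L2_projection[OF \<zeta> this ne lin]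
  obtain v g where v: "\<And>n. v n \<in> ?V" and g: "L2_tendsto P v g"
    and ortho: "\<And>w. w \<in> ?V \<Longrightarrow> (\<integral>x. (\<zeta> x - g x) * w x \<partial>P) = 0"
    by blast
  have "\<forall>n. \<exists>S. (\<forall>j. simple_integrand P \<T> F (S j)) \<and> v n = I S" using v by blast
  then obtain S where S: "\<And>n j. simple_integrand P \<T> F (S n j)" and vS: "\<And>n. v n = I (S n)"
    by metis
  let ?p = "\<lambda>n j. process_fun (simple_process (S n j))"
  have "\<exists>h. L2_tendsto predictable_measure (\<lambda>n. ?p n j) h" for j
  proof -
    have "sq_dist predictable_measure (?p m j) (?p n j) \<le> sq_dist P (v m) (v n)" for m n
    proof -
      have "sq_dist predictable_measure (?p m j) (?p n j) \<le> (\<Sum>j\<in>UNIV. sq_dist predictable_measure (?p m j) (?p n j))"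
        by (rule member_le_sum) (auto simp: sq_dist_nonneg)
      also have "\<dots> = sq_dist P (v m) (v n)"
        unfolding vS I_def by (rule sum_simple_integral_sq_dist[symmetric]) (rule S)+
      finally show ?thesis .
    qed
    then have "L2_Cauchy predictable_measure (\<lambda>n. ?p n j)"
      using L2_tendsto_imp_L2_Cauchy[OF g] simple_process_square_integrable[OF S]
      unfolding L2_Cauchy_def by (meson le_less_trans)
    then show ?thesis using L2_complete by blast
  qed
  then obtain h where h: "\<And>j. L2_tendsto predictable_measure (\<lambda>n. ?p n j) (h j)" by metis
  define H where "H j s \<omega> = h j (s, \<omega>)" for j s \<omega>
  have Hh: "process_fun (H j) = h j" for j by (auto simp: H_def)
  have Hsq: "square_integrable predictable_measure (process_fun (H j))" for j
    unfolding Hh using h by (simp add: L2_tendsto_def)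
  show ?thesis
  proof (rule that[of H, OF Hsq])
    fix J and j :: 'd and R assume J: "\<And>j. is_scalar_integral P \<T> F (W_comp j) (H j) (J j)" and R: "simple_integrand P \<T> F R"
    have "L2_tendsto P (\<lambda>n. simple_integral (W_comp j) (S n j) T) (J j T)" for j
      by (rule scalar_integral_continuous[OF Hsq J S]) (simp add: Hh h)
    then have lJ: "L2_tendsto P v (\<lambda>\<omega>. \<Sum>j\<in>UNIV. J j T \<omega>)"
      unfolding vS I_def[abs_def] by (intro L2_tendsto_sum)
    have ae: "AE \<omega> in P. g \<omega> = (\<Sum>j\<in>UNIV. J j T \<omega>)" by (rule L2_tendsto_unique[OF g lJ])
    define Q where "Q k = (if k = j then R else [])" for k
    have IQ: "I Q = simple_integral (W_comp j) R T"
    proof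
      fix \<omega>
      have "I Q \<omega> = (\<Sum>k\<in>UNIV. if k = j then simple_integral (W_comp j) R T \<omega> else 0)"
        unfolding I_def Q_def by (intro sum.cong) auto
      then show "I Q \<omega> = simple_integral (W_comp j) R T \<omega>" by simp
    qed
    have "\<forall>k. simple_integrand P \<T> F (Q k)" using R by (simp add: Q_def)
    then have "I Q \<in> ?V" by blast
    then have "simple_integral (W_comp j) R T \<in> ?V" by (simp only: IQ)
    from ortho[OF this] have 0: "(\<integral>\<omega>. (\<zeta> \<omega> - g \<omega>) * simple_integral (W_comp j) R T \<omega> \<partial>P) = 0" .
    have [measurable]: "\<zeta> \<in> borel_measurable P" "g \<in> borel_measurable P" "(\<lambda>\<omega>. \<Sum>j\<in>UNIV. J j T \<omega>) \<in> borel_measurable P"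
      "simple_integral (W_comp j) R T \<in> borel_measurable P"
      using \<zeta> g lJ simple_integral_adapted(2)[OF R T_in, of j] by (simp_all add: L2_tendsto_def square_integrable_def)
    have "(\<integral>\<omega>. (\<zeta> \<omega> - (\<Sum>j\<in>UNIV. J j T \<omega>)) * simple_integral (W_comp j) R T \<omega> \<partial>P)
        = (\<integral>\<omega>. (\<zeta> \<omega> - g \<omega>) * simple_integral (W_comp j) R T \<omega> \<partial>P)"
      by (rule integral_cong_AE) (use ae in auto)
    with 0 show "(\<integral>\<omega>. (\<zeta> \<omega> - (\<Sum>j\<in>UNIV. J j T \<omega>)) * simple_integral (W_comp j) R T \<omega> \<partial>P) = 0" by simp
  qed
qed

lemma Basis_vec_ball: "(\<forall>e\<in>(Basis :: (real^'k) set). Q e) \<longleftrightarrow> (\<forall>i. Q (axis i 1))"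
  by (auto simp: Basis_vec_def)

lemma M2_vec:
  fixes X :: "real \<Rightarrow> 'w \<Rightarrow> real^'k"
  shows "X \<in> M2 P \<T> F \<longleftrightarrow> (\<forall>i. (\<lambda>t \<omega>. X t \<omega> $ i) \<in> M2 P \<T> F)"
  unfolding M2_Basis[of X] Basis_vec_ball by (simp add: inner_axis)

lemma L2_matrix_iff:
  fixes X :: "real \<Rightarrow> 'w \<Rightarrow> real^'d^'k"
  shows "X \<in> L2 P \<T> F \<longleftrightarrow>
    (\<forall>i j. square_integrable predictable_measure (process_fun (\<lambda>s \<omega>. X s \<omega> $ i $ j)))"
proof -
  let ?f = "\<lambda>(s, \<omega>). X s \<omega>" and ?M = "predictable_sigma P \<T> F"
  have "(\<forall>e\<in>(Basis :: (real^'d^'k) set). (\<lambda>x. ?f x \<bullet> e) \<in> borel_measurable ?M)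
      \<longleftrightarrow> (\<forall>i j. (\<lambda>x. ?f x $ i $ j) \<in> borel_measurable ?M)"
    by (auto simp: Basis_vec_def inner_axis)
  then have m: "?f \<in> borel_measurable ?M \<longleftrightarrow> (\<forall>i j. (\<lambda>x. ?f x $ i $ j) \<in> borel_measurable ?M)"
    using borel_measurable_euclidean_space[of ?f ?M] by simp
  have nrm: "ennreal ((norm z)\<^sup>2) = (\<Sum>i\<in>UNIV. \<Sum>j\<in>UNIV. ennreal ((z $ i $ j)\<^sup>2))" for z :: "real^'d^'k"
    by (simp add: norm_vec_def L2_set_def sum_nonneg sum_ennreal)
  have "(\<integral>\<^sup>+\<omega>. (\<integral>\<^sup>+s. ennreal ((norm (X s \<omega>))\<^sup>2) \<partial>nabla_measure \<T>) \<partial>P)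
      = (\<Sum>i\<in>UNIV. \<Sum>j\<in>UNIV. \<integral>\<^sup>+x. ennreal ((?f x $ i $ j)\<^sup>2) \<partial>predictable_measure)"
    if *: "\<And>i j. (\<lambda>x. ?f x $ i $ j) \<in> borel_measurable ?M"
  proof -
    note [measurable] = *
    have "(\<lambda>x. ennreal ((norm (?f x))\<^sup>2)) \<in> borel_measurable ?M"
      unfolding nrm by measurable
    from nn_integral_predictable_measure[OF this]
    have "(\<integral>\<^sup>+\<omega>. (\<integral>\<^sup>+s. ennreal ((norm (X s \<omega>))\<^sup>2) \<partial>nabla_measure \<T>) \<partial>P)
        = (\<integral>\<^sup>+x. ennreal ((norm (?f x))\<^sup>2) \<partial>predictable_measure)" by simp
    also have "\<dots> = (\<Sum>i\<in>UNIV. \<Sum>j\<in>UNIV. \<integral>\<^sup>+x. ennreal ((?f x $ i $ j)\<^sup>2) \<partial>predictable_measure)"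
    proof -
      have m: "(\<lambda>x. ennreal ((?f x $ i $ j)\<^sup>2)) \<in> borel_measurable predictable_measure" for i j
        unfolding measurable_cong_sets[OF sets_predictable_measure refl] by measurable
      show ?thesis
        unfolding nrm by (subst nn_integral_sum) (intro borel_measurable_sum m sum.cong refl nn_integral_sum)+
    qed
    finally show ?thesis .
  qed
  then show ?thesis
    unfolding L2_def mem_Collect_eq m square_integrable_iff_nn_integral
      measurable_cong_sets[OF sets_predictable_measure refl]
    by (auto simp: case_prod_beta')
qed

lemma martingale_on_sum:
  fixes X :: "'i \<Rightarrow> real \<Rightarrow> 'w \<Rightarrow> real"
  assumes "\<And>i. i \<in> I \<Longrightarrow> martingale_on P \<T> F (X i)"
  shows "martingale_on P \<T> F (\<lambda>t \<omega>. \<Sum>i\<in>I. X i t \<omega>)"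
  using assms
proof (induction I rule: infinite_finite_induct)
  case (insert i I)
  then show ?case using martingale_on_lincomb[of "X i" "\<lambda>t \<omega>. \<Sum>i\<in>I. X i t \<omega>" 1] by simp
qed (use M2_realD(1)[OF M2_real_zero] in simp_all)

text \<open>The projection is applied to each coordinate of \<open>M T\<close>.  Orthogonality also holds coordinatewise:
  the inner product of \<open>N\<close> with an integral is a sum of products of one coordinate of \<open>N\<close> and one
  scalar integral, each of them a martingale.\<close>
theorem martingale_decomposition:
  fixes M :: "real \<Rightarrow> 'w \<Rightarrow> real^'k"
  assumes M: "M \<in> M2 P \<T> F" and M0: "AE \<omega> in P. M 0 \<omega> = 0"
  shows "\<exists>(X :: real \<Rightarrow> 'w \<Rightarrow> real^'d^'k) N.
    X \<in> L2 P \<T> F \<and>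
    stoch_integral P \<T> F W X \<in> M2_star P \<T> F W \<and>
    N \<in> M2 P \<T> F \<and> (AE \<omega> in P. N 0 \<omega> = 0) \<and>
    (AE \<omega> in P. \<forall>t\<in>\<T>. M t \<omega> = stoch_integral P \<T> F W X t \<omega> + N t \<omega>) \<and>
    (\<forall>L \<in> M2_star P \<T> F W. orthogonal_martingales P \<T> F N L)"
proof -
  have Mi: "(\<lambda>t \<omega>. M t \<omega> $ i) \<in> M2 P \<T> F" for i using M by (simp add: M2_vec)
  let ?Q = "\<lambda>i (H :: 'd \<Rightarrow> real \<Rightarrow> 'w \<Rightarrow> real).
    (\<forall>j. square_integrable predictable_measure (process_fun (H j))) \<and>
    (\<forall>J j S. (\<forall>j. is_scalar_integral P \<T> F (W_comp j) (H j) (J j)) \<longrightarrow> simple_integrand P \<T> F S \<longrightarrow>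
      (\<integral>\<omega>. (M T \<omega> $ i - (\<Sum>j\<in>UNIV. J j T \<omega>)) * simple_integral (W_comp j) S T \<omega> \<partial>P) = 0)"
  have "\<forall>i. \<exists>H. ?Q i H"
  proof
    fix i
    show "\<exists>H. ?Q i H"
    proof (rule projection_onto_stochastic_integrals[OF M2_realD(2)[OF Mi T_in, of i]])
      fix H :: "'d \<Rightarrow> real \<Rightarrow> 'w \<Rightarrow> real"
      assume 1: "\<And>j. square_integrable predictable_measure (process_fun (H j))"
        and 2: "\<And>J j S. (\<And>j. is_scalar_integral P \<T> F (W_comp j) (H j) (J j)) \<Longrightarrow> simple_integrand P \<T> F S \<Longrightarrow>
          (\<integral>\<omega>. (M T \<omega> $ i - (\<Sum>j\<in>UNIV. J j T \<omega>)) * simple_integral (W_comp j) S T \<omega> \<partial>P) = 0"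
      show "\<exists>H. ?Q i H"
      proof (intro exI[of _ H] conjI allI impI)
        show "square_integrable predictable_measure (process_fun (H j))" for j by (rule 1)
      qed (rule 2, simp_all)
    qed
  qed
  from choice[OF this] obtain H where "\<forall>i. ?Q i (H i)" ..
  then have H: "\<And>i j. square_integrable predictable_measure (process_fun (H i j))"
    and ortho: "\<And>i J j S. \<forall>j. is_scalar_integral P \<T> F (W_comp j) (H i j) (J j) \<Longrightarrow> simple_integrand P \<T> F S \<Longrightarrow>
      (\<integral>\<omega>. (M T \<omega> $ i - (\<Sum>j\<in>UNIV. J j T \<omega>)) * simple_integral (W_comp j) S T \<omega> \<partial>P) = 0"
    by blast+
  define X :: "real \<Rightarrow> 'w \<Rightarrow> real^'d^'k" where "X s \<omega> = (\<chi> i j. H i j s \<omega>)" for s \<omega>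
  define J where "J i j = scalar_integral P \<T> F (W_comp j) (H i j)" for i j
  define N where "N t \<omega> = M t \<omega> - stoch_integral P \<T> F W X t \<omega>" for t \<omega>
  have X: "X \<in> L2 P \<T> F" unfolding L2_matrix_iff using H by (simp add: X_def)
  have J: "is_scalar_integral P \<T> F (W_comp j) (H i j) (J i j)" for i j
    unfolding J_def by (rule scalar_integral_is[OF H])
  have JM: "J i j \<in> M2 P \<T> F" for i j using J by (simp add: is_scalar_integral_def)
  have stoch: "stoch_integral P \<T> F W X t \<omega> $ i = (\<Sum>j\<in>UNIV. J i j t \<omega>)" for t \<omega> i
    by (simp add: stoch_integral_def X_def J_def)
  have Ni: "(\<lambda>t \<omega>. N t \<omega> $ i) = (\<lambda>t \<omega>. M t \<omega> $ i + (-1) * (\<Sum>j\<in>UNIV. J i j t \<omega>))" for i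
    by (simp add: N_def stoch fun_eq_iff)
  have NiM: "(\<lambda>t \<omega>. N t \<omega> $ i) \<in> M2 P \<T> F" for i
    unfolding Ni by (rule M2_real_lincomb[OF Mi M2_real_sum[OF JM]])
  have N_ortho: "(\<integral>\<omega>. N T \<omega> $ i * simple_integral (W_comp j) S T \<omega> \<partial>P) = 0"
    if "simple_integrand P \<T> F S" for i j S
    using ortho[of i "J i" S j] J that by (simp add: N_def stoch)
  have N0: "AE \<omega> in P. N 0 \<omega> = 0"
  proof -
    have "AE \<omega> in P. \<forall>i j. J i j 0 \<omega> = 0"
      using scalar_integral_at_0[OF H J] by (simp add: AE_all_countable)
    with M0 show ?thesis
      by eventually_elim (simp add: N_def stoch vec_eq_iff)
  qed
  have "orthogonal_martingales P \<T> F N L" if L: "L \<in> M2_star P \<T> F W" for L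
  proof -
    obtain Y :: "real \<Rightarrow> 'w \<Rightarrow> real^'d^'k" where Y: "Y \<in> L2 P \<T> F" and LY: "L = stoch_integral P \<T> F W Y"
      using L by (auto simp: M2_star_def)
    have Ysq: "square_integrable predictable_measure (process_fun (\<lambda>s \<omega>. Y s \<omega> $ i $ j))" for i j
      using Y by (simp add: L2_matrix_iff)
    define K where "K i j = scalar_integral P \<T> F (W_comp j) (\<lambda>s \<omega>. Y s \<omega> $ i $ j)" for i j
    have K: "is_scalar_integral P \<T> F (W_comp j) (\<lambda>s \<omega>. Y s \<omega> $ i $ j) (K i j)" for i j
      unfolding K_def by (rule scalar_integral_is[OF Ysq])
    have "(\<lambda>t \<omega>. N t \<omega> \<bullet> L t \<omega>) = (\<lambda>t \<omega>. \<Sum>i\<in>UNIV. \<Sum>j\<in>UNIV. N t \<omega> $ i * K i j t \<omega>)"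
      by (simp add: LY stoch_integral_def K_def inner_vec_def sum_distrib_left)
    moreover have "martingale_on P \<T> F \<dots>"
      by (intro martingale_on_sum martingale_mult_scalar_integral[OF Ysq K NiM] N_ortho)
    ultimately show ?thesis by (simp add: orthogonal_martingales_def)
  qed
  moreover have "stoch_integral P \<T> F W X \<in> M2_star P \<T> F W" using X by (auto simp: M2_star_def)
  moreover have "N \<in> M2 P \<T> F" unfolding M2_vec using NiM by blast
  moreover have "AE \<omega> in P. \<forall>t\<in>\<T>. M t \<omega> = stoch_integral P \<T> F W X t \<omega> + N t \<omega>" by (simp add: N_def)
  ultimately show ?thesis using X N0 by blast
qed

end

theorem theorem3p3:
  fixes \<T> :: "real set" and T :: real
    and P :: "'w measure" and F :: "real \<Rightarrow> 'w measure"
    and W :: "real \<Rightarrow> 'w \<Rightarrow> real^'d"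
    and M :: "real \<Rightarrow> 'w \<Rightarrow> real^'k"
  assumes "time_scale \<T> T" and "0 < T"
    and "prob_space P" and "filtration_on P \<T> F" and "usual_conditions P \<T> F"
    and "brownian_motion_on P \<T> F W"
    and "M \<in> M2 P \<T> F" and "AE \<omega> in P. M 0 \<omega> = 0"
  shows "\<exists>(X :: real \<Rightarrow> 'w \<Rightarrow> real^'d^'k) N.
    X \<in> L2 P \<T> F \<and>
    stoch_integral P \<T> F W X \<in> M2_star P \<T> F W \<and>
    N \<in> M2 P \<T> F \<and> (AE \<omega> in P. N 0 \<omega> = 0) \<and>
    (AE \<omega> in P. \<forall>t\<in>\<T>. M t \<omega> = stoch_integral P \<T> F W X t \<omega> + N t \<omega>) \<and>
    (\<forall>L \<in> M2_star P \<T> F W. orthogonal_martingales P \<T> F N L)"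
proof -
  interpret brownian_time_scale P \<T> T F W
    using assms by (simp add: brownian_time_scale_def brownian_time_scale_axioms_def
        filtered_time_scale_def filtered_time_scale_axioms_def)
  show ?thesis using assms by (intro martingale_decomposition)
qed

end
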